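(* Let $(R,\mathfrak m)$ be a Noetherian local ring and let $I$ be an integrally closed $\mathfrak m$-primary ideal of $R$ that is not a complete intersection. Then $\operatorname{Ann}(H_1(I))=I$.
   Context: $H_1(I)$ denotes the first homology module of the Koszul complex built on a minimal generating set of $I$. An ideal is integrally closed if it equals its integral closure. An ideal $I$ of a Noetherian local ring is called a complete intersection if its minimal number of generators equals its height; for an $\mathfrak m$-primary ideal this means that $I$ can be generated by $\dim R$ elements. *)

theory Defs
  imports "HOL-Algebra.Ring_Divisibility" "HOL-Algebra.Ideal_Product" "HOL-Algebra.Module"
    "HOL-Library.Extended_Nat"
begin

section \<open>Noetherian local rings and their ideals\<close>

locale noetherian_local_ring = noetherian_ring R + cring R for R (structure) +
  fixes \<mm>
  assumes maximal: "maximalideal \<mm> R"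
    and unique_maximal: "maximalideal M R \<Longrightarrow> M = \<mm>"

definition ideal_radical :: "('a, 'b) ring_scheme \<Rightarrow> 'a set \<Rightarrow> 'a set" where
  "ideal_radical R I = {x \<in> carrier R. \<exists>n::nat. x [^]\<^bsub>R\<^esub> n \<in> I}"

definition primary_ideal :: "('a, 'b) ring_scheme \<Rightarrow> 'a set \<Rightarrow> bool" where
  "primary_ideal R Q \<longleftrightarrow> ideal Q R \<and> Q \<noteq> carrier R \<and>
     (\<forall>a\<in>carrier R. \<forall>b\<in>carrier R. a \<otimes>\<^bsub>R\<^esub> b \<in> Q \<longrightarrow> a \<in> Q \<or> b \<in> ideal_radical R Q)"

definition primary_to :: "('a, 'b) ring_scheme \<Rightarrow> 'a set \<Rightarrow> 'a set \<Rightarrow> bool" where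
  "primary_to R P Q \<longleftrightarrow> primary_ideal R Q \<and> ideal_radical R Q = P"

text \<open>
  An element \<open>x\<close> is integral over \<open>I\<close> if it satisfies an equation
  \<open>x^n + c 1 * x^(n - 1) + \<dots> + c n = 0\<close> with \<open>n \<ge> 1\<close> and \<open>c i \<in> I^i\<close>.
  The power \<open>I^i\<close> is formed in the multiplicative monoid of ideals.
\<close>

definition integral_closure :: "('a, 'b) ring_scheme \<Rightarrow> 'a set \<Rightarrow> 'a set" where
  "integral_closure R I = {x \<in> carrier R. \<exists>n::nat. n \<ge> 1 \<and>
     (\<exists>c. (\<forall>i\<in>{1..n}. c i \<in> I [^]\<^bsub>ideals_set R\<^esub> i) \<and>
          x [^]\<^bsub>R\<^esub> n \<oplus>\<^bsub>R\<^esub> (\<Oplus>\<^bsub>R\<^esub>i\<in>{1..n}. c i \<otimes>\<^bsub>R\<^esub> x [^]\<^bsub>R\<^esub> (n - i)) = \<zero>\<^bsub>R\<^esub>)}"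

definition integrally_closed_ideal :: "('a, 'b) ring_scheme \<Rightarrow> 'a set \<Rightarrow> bool" where
  "integrally_closed_ideal R I \<longleftrightarrow> ideal I R \<and> integral_closure R I = I"

definition prime_height :: "('a, 'b) ring_scheme \<Rightarrow> 'a set \<Rightarrow> enat" where
  "prime_height R P = Sup {enat n | n. \<exists>C :: nat \<Rightarrow> 'a set.
     (\<forall>i\<le>n. primeideal (C i) R) \<and> (\<forall>i<n. C i \<subset> C (Suc i)) \<and> C n = P}"

definition ideal_height :: "('a, 'b) ring_scheme \<Rightarrow> 'a set \<Rightarrow> enat" where
  "ideal_height R I = Inf {prime_height R P | P. primeideal P R \<and> I \<subseteq> P}"

text \<open>The following number is meaningful for finitely generated ideals only.\<close>

definition min_num_generators :: "('a, 'b) ring_scheme \<Rightarrow> 'a set \<Rightarrow> nat" where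
  "min_num_generators R I =
     (LEAST n. \<exists>A. finite A \<and> card A = n \<and> A \<subseteq> carrier R \<and> Idl\<^bsub>R\<^esub> A = I)"

definition complete_intersection_ideal :: "('a, 'b) ring_scheme \<Rightarrow> 'a set \<Rightarrow> bool" where
  "complete_intersection_ideal R I \<longleftrightarrow> enat (min_num_generators R I) = ideal_height R I"

text \<open>The list enumerates, without repetition, a generating set that is minimal under inclusion.\<close>

definition minimal_generating_list :: "('a, 'b) ring_scheme \<Rightarrow> 'a set \<Rightarrow> 'a list \<Rightarrow> bool" where
  "minimal_generating_list R I as \<longleftrightarrow> distinct as \<and> set as \<subseteq> carrier R \<and>
     Idl\<^bsub>R\<^esub> (set as) = I \<and> (\<forall>B. B \<subset> set as \<longrightarrow> Idl\<^bsub>R\<^esub> B \<noteq> I)"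

section \<open>Quotient modules and annihilators\<close>

text \<open>
  Module records extend ring records; the fields \<open>mult\<close> and \<open>one\<close> play no role for a module.
\<close>

definition quotient_module :: "('a, 'c, 'd) module_scheme \<Rightarrow> 'c set \<Rightarrow> ('a, 'c set) module" where
  "quotient_module M N =
     \<lparr>carrier = a_rcosets\<^bsub>M\<^esub> N, mult = undefined, one = undefined,
      zero = N, add = set_add M,
      smult = (\<lambda>r A. \<Union>x\<in>A. N +>\<^bsub>M\<^esub> (r \<odot>\<^bsub>M\<^esub> x))\<rparr>"

definition annihilator :: "('a, 'b) ring_scheme \<Rightarrow> ('a, 'c, 'd) module_scheme \<Rightarrow> 'a set" where
  "annihilator R M = {r \<in> carrier R. \<forall>x\<in>carrier M. r \<odot>\<^bsub>M\<^esub> x = \<zero>\<^bsub>M\<^esub>}"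

section \<open>The Koszul complex\<close>

text \<open>
  Let \<open>n\<close> be the length of \<open>as\<close>. The degree \<open>p\<close> part of the Koszul complex is the \<open>p\<close>-th exterior
  power of \<open>R^n\<close>, the free module on the basis elements \<open>e S\<close> for the \<open>p\<close>-element subsets \<open>S\<close> of
  \<open>{..<n}\<close>. A chain is represented by its coefficient function, which is \<open>0\<close> at every other set.
\<close>

definition koszul_module ::
  "('a, 'b) ring_scheme \<Rightarrow> 'a list \<Rightarrow> nat \<Rightarrow> ('a, nat set \<Rightarrow> 'a) module" where
  "koszul_module R as p =
     \<lparr>carrier = {f. (\<forall>S. f S \<in> carrier R) \<and>
                    (\<forall>S. \<not> (S \<subseteq> {..<length as} \<and> card S = p) \<longrightarrow> f S = \<zero>\<^bsub>R\<^esub>)},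
      mult = undefined, one = undefined,
      zero = (\<lambda>S. \<zero>\<^bsub>R\<^esub>), add = (\<lambda>f g S. f S \<oplus>\<^bsub>R\<^esub> g S),
      smult = (\<lambda>r f S. r \<otimes>\<^bsub>R\<^esub> f S)\<rparr>"

text \<open>
  The differential sends \<open>e T\<close> to the sum over \<open>j \<in> T\<close> of
  \<open>(-1)^(card {i \<in> T. i < j}) * as ! j * e (T - {j})\<close>. The definition below gives the
  coefficient of \<open>e S\<close> in the image of \<open>f\<close>, to which the sets \<open>T = insert j S\<close> with \<open>j \<notin> S\<close>
  contribute.
\<close>

definition koszul_diff ::
  "('a, 'b) ring_scheme \<Rightarrow> 'a list \<Rightarrow> (nat set \<Rightarrow> 'a) \<Rightarrow> nat set \<Rightarrow> 'a" where
  "koszul_diff R as f S =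
     (\<Oplus>\<^bsub>R\<^esub>j\<in>{..<length as} - S.
        (\<ominus>\<^bsub>R\<^esub> \<one>\<^bsub>R\<^esub>) [^]\<^bsub>R\<^esub> card {i \<in> S. i < j} \<otimes>\<^bsub>R\<^esub> (as ! j) \<otimes>\<^bsub>R\<^esub> f (insert j S))"

definition koszul_cycles ::
  "('a, 'b) ring_scheme \<Rightarrow> 'a list \<Rightarrow> nat \<Rightarrow> (nat set \<Rightarrow> 'a) set" where
  "koszul_cycles R as p =
     {f \<in> carrier (koszul_module R as p). koszul_diff R as f = (\<lambda>S. \<zero>\<^bsub>R\<^esub>)}"

definition koszul_boundaries ::
  "('a, 'b) ring_scheme \<Rightarrow> 'a list \<Rightarrow> nat \<Rightarrow> (nat set \<Rightarrow> 'a) set" where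
  "koszul_boundaries R as p = koszul_diff R as ` carrier (koszul_module R as (Suc p))"

definition koszul_homology ::
  "('a, 'b) ring_scheme \<Rightarrow> 'a list \<Rightarrow> nat \<Rightarrow> ('a, (nat set \<Rightarrow> 'a) set) module" where
  "koszul_homology R as p =
     quotient_module ((koszul_module R as p)\<lparr>carrier := koszul_cycles R as p\<rparr>)
       (koszul_boundaries R as p)"

end

theory Submission
  imports Defs
begin

text \<open>
  Multiplication by a generator of \<open>I\<close> is null-homotopic on the Koszul complex, so \<open>I\<close> annihilates the
  homology. For the converse, suppose that some ring element outside \<open>I\<close> annihilates \<open>H\<^sub>1\<close>, and let \<open>n\<close> be
  the number of the given generators. Then \<open>\<mm>\<close> has height at least \<open>n\<close>. By Krull's height theorem this
  height is at most the minimal number of generators of \<open>I\<close>, which is at most \<open>n\<close>. So all these numbers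
  agree and \<open>I\<close> is a complete intersection, contrary to the hypothesis.

  The lower bound for the height is \<open>prime_chain_of_large_koszul_annihilator\<close>. If a unit annihilates \<open>H\<^sub>1\<close>,
  the generators form a regular sequence and the bound is immediate. Otherwise choose \<open>g\<close> in the annihilator
  but not in \<open>I\<close> with \<open>g \<mm> \<subseteq> I\<close>. If \<open>g \<mm>\<close> were contained in \<open>\<mm> I\<close>, the determinant trick would make \<open>g\<close>
  integral over \<open>I\<close>, and \<open>g\<close> would lie in \<open>I\<close>. Hence \<open>g x \<notin> \<mm> I\<close> for some \<open>x \<in> \<mm>\<close>, and \<open>g x\<close> may replace one
  of the generators, say \<open>a\<^sub>k\<close>. Let \<open>J\<close> be the ideal of the other generators and \<open>P = J : g\<close>.

  Because \<open>g\<close> annihilates \<open>H\<^sub>1\<close>, every \<open>z\<close> with \<open>z g x \<in> J\<close> satisfies \<open>z g \<in> J\<close>, so \<open>x\<close> is a nonzerodivisor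
  modulo \<open>P\<close>. On the other hand \<open>g \<mm> \<subseteq> I = J + (g x)\<close> says that \<open>\<mm> = P + (x)\<close>. Thus \<open>R / P\<close> is a discrete
  valuation ring, and \<open>P\<close> is a prime strictly below \<open>\<mm>\<close>. Some power of \<open>x\<close> lies in \<open>I\<close>
  and none in \<open>P\<close>, so \<open>I\<close> is not contained in \<open>P\<close>; as \<open>J\<close> is, \<open>g\<close> lies outside \<open>P\<close>. The syzygies that do not involve \<open>a\<^sub>k\<close> and the Nakayama lemma show that
  a multiple of \<open>g\<close> outside \<open>P\<close> annihilates the first Koszul homology of the \<open>n - 1\<close> generators of \<open>J\<close>. In the
  localization at \<open>P\<close> these generators therefore form a regular sequence, so \<open>P\<close> has height at least
  \<open>n - 1\<close> and \<open>\<mm>\<close> has height at least \<open>n\<close>.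

  Localizations and quotient rings are avoided throughout: a statement about the localization at \<open>P\<close> is
  expressed by multipliers outside \<open>P\<close>, and a statement about a quotient by ideals that contain the
  given one.
\<close>

section \<open>Ideals of Noetherian commutative rings\<close>

locale noetherian_cring = noetherian_ring R + cring R for R (structure)

sublocale noetherian_local_ring \<subseteq> noetherian_cring ..

context cring
begin

lemma ideal_carrier: "ideal I R \<Longrightarrow> x \<in> I \<Longrightarrow> x \<in> carrier R"
  by (rule ideal.Icarr)

lemma ideal_zero: "ideal I R \<Longrightarrow> \<zero> \<in> I"
  by (simp add: additive_subgroup.zero_closed ideal.axioms(1))

lemma ideal_add: "ideal I R \<Longrightarrow> x \<in> I \<Longrightarrow> y \<in> I \<Longrightarrow> x \<oplus> y \<in> I"
  by (simp add: additive_subgroup.a_closed ideal.axioms(1))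

lemma ideal_mult: "ideal I R \<Longrightarrow> x \<in> I \<Longrightarrow> r \<in> carrier R \<Longrightarrow> r \<otimes> x \<in> I"
  by (rule ideal.I_l_closed)

lemma ideal_mult': "ideal I R \<Longrightarrow> x \<in> I \<Longrightarrow> r \<in> carrier R \<Longrightarrow> x \<otimes> r \<in> I"
  by (rule ideal.I_r_closed)

lemma ideal_neg: "ideal I R \<Longrightarrow> x \<in> I \<Longrightarrow> \<ominus> x \<in> I"
  by (simp add: additive_subgroup.a_inv_closed ideal.axioms(1))

lemma ideal_diff: "ideal I R \<Longrightarrow> x \<in> I \<Longrightarrow> y \<in> I \<Longrightarrow> x \<ominus> y \<in> I"
  unfolding a_minus_def by (simp add: ideal_add ideal_neg)

lemma ideal_cancel:
  assumes "ideal I R" "x \<oplus> y \<in> I" "y \<in> I" "x \<in> carrier R"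
  shows "x \<in> I"
proof -
  have "y \<in> carrier R" using assms ideal_carrier by blast
  then have "x = (x \<oplus> y) \<ominus> y" using assms(4) by algebra
  then show ?thesis using ideal_diff[OF assms(1-3)] by simp
qed

lemma idealI_cring:
  assumes "I \<subseteq> carrier R" "\<zero> \<in> I"
    and add: "\<And>x y. x \<in> I \<Longrightarrow> y \<in> I \<Longrightarrow> x \<oplus> y \<in> I"
    and mult: "\<And>r x. r \<in> carrier R \<Longrightarrow> x \<in> I \<Longrightarrow> r \<otimes> x \<in> I"
  shows "ideal I R"
proof (rule idealI)
  show "ring R" by (rule ring_axioms)
  show "subgroup I (add_monoid R)"
  proof (rule subgroup.intro)
    show "inv\<^bsub>add_monoid R\<^esub> x \<in> I" if "x \<in> I" for x
    proof -
      have "x \<in> carrier R" using assms(1) that by auto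
      then have "\<ominus> x = (\<ominus> \<one>) \<otimes> x" by algebra
      then show ?thesis using mult[of "\<ominus> \<one>" x] that unfolding a_inv_def by simp
    qed
  qed (use assms in auto)
  show "x \<otimes> r \<in> I" if "x \<in> I" "r \<in> carrier R" for x r
    using mult[of r x] that assms(1) m_comm[of r x] by auto
qed (use mult in auto)

lemma prime_not_one: "primeideal P R \<Longrightarrow> \<one> \<notin> P"
  using ideal.one_imp_carrier primeideal.I_notcarr primeideal.axioms(1) by blast

lemma prime_mult_notin:
  "primeideal P R \<Longrightarrow> x \<in> carrier R \<Longrightarrow> y \<in> carrier R \<Longrightarrow> x \<notin> P \<Longrightarrow> y \<notin> P \<Longrightarrow> x \<otimes> y \<notin> P"
  using primeideal.I_prime by fastforce

lemma prime_pow_mem: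
  "primeideal P R \<Longrightarrow> x \<in> carrier R \<Longrightarrow> x [^] (n::nat) \<in> P \<Longrightarrow> x \<in> P"
  by (induction n) (auto dest: prime_not_one prime_mult_notin)

lemma prime_ideal: "primeideal P R \<Longrightarrow> ideal P R"
  by (rule primeideal.axioms(1))

lemma mem_add_PIdl:
  "x \<in> I <+>\<^bsub>R\<^esub> PIdl g \<longleftrightarrow> (\<exists>h\<in>I. \<exists>c\<in>carrier R. x = h \<oplus> c \<otimes> g)"
  unfolding set_add_def' cgenideal_def by auto

lemma ideal_add_PIdl: "ideal I R \<Longrightarrow> g \<in> carrier R \<Longrightarrow> ideal (I <+>\<^bsub>R\<^esub> PIdl g) R"
  by (simp add: add_ideals cgenideal_ideal)

lemma subset_add_PIdl: 
  assumes "ideal I R" "g \<in> carrier R" shows "I \<subseteq> I <+>\<^bsub>R\<^esub> PIdl g"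
proof
  fix x assume "x \<in> I"
  moreover from this have "x = x \<oplus> \<zero> \<otimes> g" using assms ideal_carrier by simp
  ultimately show "x \<in> I <+>\<^bsub>R\<^esub> PIdl g" unfolding mem_add_PIdl by blast
qed

lemma gen_in_add_PIdl: 
  assumes "ideal I R" "g \<in> carrier R" shows "g \<in> I <+>\<^bsub>R\<^esub> PIdl g"
proof -
  have "g = \<zero> \<oplus> \<one> \<otimes> g" using assms by simp
  then show ?thesis unfolding mem_add_PIdl using ideal_zero[OF assms(1)] by blast
qed

lemma add_PIdl_minimal:
  assumes "ideal K R" "I \<subseteq> K" "g \<in> K"
  shows "I <+>\<^bsub>R\<^esub> PIdl g \<subseteq> K"
  unfolding subset_iff mem_add_PIdl using assms ideal_add ideal_mult by blast

lemma colon_ideal: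
  assumes "ideal I R" "g \<in> carrier R"
  shows "ideal {x \<in> carrier R. x \<otimes> g \<in> I} R"
proof (rule idealI_cring)
  show "\<zero> \<in> {x \<in> carrier R. x \<otimes> g \<in> I}" using assms ideal_zero by simp
  show "x \<oplus> y \<in> {x \<in> carrier R. x \<otimes> g \<in> I}"
    if "x \<in> {x \<in> carrier R. x \<otimes> g \<in> I}" "y \<in> {x \<in> carrier R. x \<otimes> g \<in> I}" for x y
    using that assms ideal_add by (simp add: l_distr)
  show "r \<otimes> x \<in> {x \<in> carrier R. x \<otimes> g \<in> I}"
    if "r \<in> carrier R" "x \<in> {x \<in> carrier R. x \<otimes> g \<in> I}" for r x
    using that assms ideal_mult by (simp add: m_assoc)
qed auto

end

context noetherian_cring
begin

lemma maximal_ideal_in_family: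
  assumes "F \<noteq> {}" "\<And>K. K \<in> F \<Longrightarrow> ideal K R"
  shows "\<exists>M\<in>F. \<forall>K\<in>F. M \<subseteq> K \<longrightarrow> K = M"
proof (rule subset_Zorn)
  fix C assume C: "subset.chain F C"
  show "\<exists>U\<in>F. \<forall>X\<in>C. X \<subseteq> U"
  proof (cases "C = {}")
    case True
    then show ?thesis using assms(1) by blast
  next
    case False
    have "subset.chain {I. ideal I R} C"
      using C assms(2) unfolding pred_on.chain_def by blast
    then have "\<Union>C \<in> C" by (rule ideal_chain_is_trivial[OF False])
    moreover from this have "\<Union>C \<in> F" using C unfolding pred_on.chain_def by fastforce
    ultimately show ?thesis by (meson Union_upper)
  qed
qed

text \<open>
  An ideal that is maximal among those containing \<open>K\<close> and avoiding \<open>T\<close> is prime: two elements outside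
  it produce two elements of \<open>T\<close> modulo it, and the product of these lies in \<open>T\<close> as well.
\<close>

lemma prime_avoiding_multiplicative_set:
  assumes K: "ideal K R" and T: "T \<subseteq> carrier R" "\<one> \<in> T"
    and Tm: "\<And>s t. s \<in> T \<Longrightarrow> t \<in> T \<Longrightarrow> s \<otimes> t \<in> T"
    and disj: "K \<inter> T = {}"
  shows "\<exists>Q. primeideal Q R \<and> K \<subseteq> Q \<and> Q \<inter> T = {}"
proof -
  define F where "F = {M. ideal M R \<and> K \<subseteq> M \<and> M \<inter> T = {}}"
  have "F \<noteq> {}" using K disj unfolding F_def by blast
  moreover have "\<And>L. L \<in> F \<Longrightarrow> ideal L R" unfolding F_def by blast
  ultimately obtain M where M: "M \<in> F" and max: "\<And>L. L \<in> F \<Longrightarrow> M \<subseteq> L \<Longrightarrow> L = M"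
    using maximal_ideal_in_family[of F] by metis
  have Mi: "ideal M R" "K \<subseteq> M" "M \<inter> T = {}" using M unfolding F_def by auto
  have meets: "\<exists>h\<in>M. \<exists>c\<in>carrier R. h \<oplus> c \<otimes> a \<in> T" if a: "a \<in> carrier R" "a \<notin> M" for a
  proof (rule ccontr)
    assume "\<not> ?thesis"
    then have "(M <+>\<^bsub>R\<^esub> PIdl a) \<inter> T = {}" by (auto simp: mem_add_PIdl)
    then have "M <+>\<^bsub>R\<^esub> PIdl a \<in> F"
      using ideal_add_PIdl subset_add_PIdl Mi a(1) unfolding F_def by blast
    then have "M <+>\<^bsub>R\<^esub> PIdl a = M" using max subset_add_PIdl Mi(1) a(1) by blast
    then show False using gen_in_add_PIdl Mi(1) a by blast
  qed
  have "primeideal M R"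
  proof (rule primeidealI[OF Mi(1) is_cring])
    show "carrier R \<noteq> M" using Mi(3) T by blast
    show "a \<in> M \<or> b \<in> M" if ab: "a \<in> carrier R" "b \<in> carrier R" "a \<otimes> b \<in> M" for a b
    proof (rule ccontr)
      assume "\<not> ?thesis"
      then obtain h c h' c' where *: "h \<in> M" "c \<in> carrier R" "h \<oplus> c \<otimes> a \<in> T"
         "h' \<in> M" "c' \<in> carrier R" "h' \<oplus> c' \<otimes> b \<in> T" using meets ab by meson
      have hc: "h \<in> carrier R" "h' \<in> carrier R" using * Mi ideal_carrier by auto
      have "(h \<oplus> c \<otimes> a) \<otimes> (h' \<oplus> c' \<otimes> b) = (h' \<oplus> c' \<otimes> b) \<otimes> h \<oplus> (c \<otimes> a \<otimes> h' \<oplus> (c \<otimes> c') \<otimes> (a \<otimes> b))"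
        using hc *(2,5) ab by algebra
      also have "\<dots> \<in> M"
        using * ab hc by (simp add: ideal_add[OF Mi(1)] ideal_mult[OF Mi(1)])
      finally show False using Tm[OF *(3,6)] Mi(3) by blast
    qed
  qed
  then show ?thesis using Mi by blast
qed

text \<open>
  The products \<open>t \<otimes> p [^] j\<close> with \<open>t \<notin> P\<close> form a multiplicative set. A prime that avoids this
  set lies inside \<open>P\<close> because of the factors \<open>t\<close>, and omits \<open>p\<close> because of the powers. This replaces
  the choice of a prime in the localization at \<open>P\<close>.
\<close>

lemma prime_below_avoiding_element:
  assumes K: "ideal K R" and P: "primeideal P R" and p: "p \<in> P"
    and avoid: "\<And>t j. t \<in> carrier R \<Longrightarrow> t \<notin> P \<Longrightarrow> t \<otimes> p [^] (j::nat) \<notin> K"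
  shows "\<exists>Q. primeideal Q R \<and> K \<subseteq> Q \<and> Q \<subset> P \<and> p \<notin> Q"
proof -
  define T where "T = {t \<otimes> p [^] (j::nat) | t j. t \<in> carrier R \<and> t \<notin> P}"
  have pc: "p \<in> carrier R" using p P ideal_carrier prime_ideal by blast
  have inT: "t \<otimes> p [^] j \<in> T" if "t \<in> carrier R" "t \<notin> P" for t and j :: nat
    unfolding T_def using that by blast
  have "\<exists>Q. primeideal Q R \<and> K \<subseteq> Q \<and> Q \<inter> T = {}"
  proof (rule prime_avoiding_multiplicative_set[OF K])
    show "T \<subseteq> carrier R" unfolding T_def using pc by auto
    show "\<one> \<in> T" using inT[of \<one> 0] prime_not_one[OF P] by simp
    show "K \<inter> T = {}" unfolding T_def using avoid by blast
    fix s t assume "s \<in> T" "t \<in> T"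
    then obtain u i v j where *: "s = u \<otimes> p [^] (i::nat)" "u \<in> carrier R" "u \<notin> P"
      "t = v \<otimes> p [^] (j::nat)" "v \<in> carrier R" "v \<notin> P" unfolding T_def by blast
    have "s \<otimes> t = (u \<otimes> v) \<otimes> (p [^] i \<otimes> p [^] j)" using * pc by (simp add: m_ac)
    also have "\<dots> = (u \<otimes> v) \<otimes> p [^] (i + j)" using pc by (simp add: nat_pow_mult)
    finally show "s \<otimes> t \<in> T" using inT prime_mult_notin[OF P] * by auto
  qed
  then obtain Q where Q: "primeideal Q R" "K \<subseteq> Q" "Q \<inter> T = {}" by blast
  have "p \<notin> Q"
    using inT[of \<one> 1] prime_not_one[OF P] Q(3) pc by auto
  moreover have "Q \<subseteq> P"
  proof
    fix q assume "q \<in> Q"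
    then show "q \<in> P" using inT[of q 0] Q pc ideal_carrier prime_ideal by fastforce
  qed
  ultimately show ?thesis using Q p by blast
qed

text \<open>
  Elements of this kind form the socle of \<open>U\<close> modulo \<open>S\<close>. Among the colon ideals \<open>S : g\<close> of elements
  \<open>g \<in> U - S\<close> a maximal one does the job: if \<open>p \<otimes> g \<notin> S\<close>, then maximality gives
  \<open>S : (p \<otimes> g) = S : g\<close>, so that \<open>p [^] j \<otimes> g \<notin> S\<close> for all \<open>j\<close>, although some power of \<open>p\<close> lies in \<open>S\<close>.
\<close>

lemma socle_element:
  assumes S: "ideal S R" and U: "ideal U R" "\<not> U \<subseteq> S"
    and P: "P \<subseteq> carrier R" "\<And>p. p \<in> P \<Longrightarrow> \<exists>j::nat. p [^] j \<in> S"
  shows "\<exists>g\<in>U - S. \<forall>p\<in>P. p \<otimes> g \<in> S"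
proof -
  define F where "F = {{x \<in> carrier R. x \<otimes> g \<in> S} | g. g \<in> U - S}"
  have Uc: "u \<in> carrier R" if "u \<in> U" for u using that U(1) ideal_carrier by blast
  have "F \<noteq> {}" using U(2) unfolding F_def by blast
  moreover have "\<And>L. L \<in> F \<Longrightarrow> ideal L R" unfolding F_def using colon_ideal[OF S] Uc by blast
  ultimately obtain M where "M \<in> F" and max: "\<And>L. L \<in> F \<Longrightarrow> M \<subseteq> L \<Longrightarrow> L = M"
    using maximal_ideal_in_family[of F] by metis
  then obtain g where g: "g \<in> U" "g \<notin> S" and M: "M = {x \<in> carrier R. x \<otimes> g \<in> S}"
    unfolding F_def by blast
  have gc: "g \<in> carrier R" using Uc g by blast
  have "p \<otimes> g \<in> S" if p: "p \<in> P" for p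
  proof (rule ccontr)
    assume pg: "p \<otimes> g \<notin> S"
    have pc: "p \<in> carrier R" using P(1) p by blast
    have "{x \<in> carrier R. x \<otimes> (p \<otimes> g) \<in> S} \<in> F"
      unfolding F_def using pg ideal_mult[OF U(1) g(1) pc] by blast
    moreover have "M \<subseteq> {x \<in> carrier R. x \<otimes> (p \<otimes> g) \<in> S}"
    proof (unfold M, safe)
      fix x assume "x \<in> carrier R" "x \<otimes> g \<in> S"
      then show "x \<otimes> (p \<otimes> g) \<in> S" using ideal_mult[OF S, of "x \<otimes> g" p] pc gc by (simp add: m_ac)
    qed
    ultimately have eq: "{x \<in> carrier R. x \<otimes> (p \<otimes> g) \<in> S} = M" by (rule max)
    have "p [^] j \<otimes> g \<notin> S" for j :: nat
    proof (induction j)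
      case 0
      then show ?case using g gc by simp
    next
      case (Suc j)
      have "p [^] j \<notin> M" using Suc unfolding M by blast
      then have "p [^] j \<otimes> (p \<otimes> g) \<notin> S" using pc unfolding eq[symmetric] by blast
      then show ?case using pc gc by (simp add: m_assoc)
    qed
    moreover obtain j where "p [^] (j::nat) \<in> S" using P(2) p by blast
    ultimately show False using ideal_mult'[OF S] gc by blast
  qed
  then show ?thesis using g by blast
qed

end

section \<open>Submodules of free modules\<close>

context cring
begin

text \<open>
  Submodules of a free module, given by coefficient functions. The index type is arbitrary, so that
  ideals are covered by the one-point type and syzygies by any set of indices.
\<close>

definition submodule_of_functions :: "('i \<Rightarrow> 'a) set \<Rightarrow> bool" where
  "submodule_of_functions V \<longleftrightarrow> (\<forall>v\<in>V. \<forall>i. v i \<in> carrier R) \<and> (\<lambda>i. \<zero>) \<in> V \<and>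
     (\<forall>u\<in>V. \<forall>v\<in>V. (\<lambda>i. u i \<oplus> v i) \<in> V) \<and> (\<forall>r\<in>carrier R. \<forall>v\<in>V. (\<lambda>i. r \<otimes> v i) \<in> V)"

text \<open>
  The sum of \<open>B\<close> and of the multiples \<open>G \<cdot> z\<close> of the listed vectors. The recursion on the list allows
  elimination to remove one generator at a time.
\<close>

primrec lincombs :: "'a set \<Rightarrow> ('i \<Rightarrow> 'a) list \<Rightarrow> ('i \<Rightarrow> 'a) set \<Rightarrow> ('i \<Rightarrow> 'a) set" where
  "lincombs G [] B = B"
| "lincombs G (z # zs) B = {(\<lambda>i. g \<otimes> z i \<oplus> w i) | g w. g \<in> G \<and> w \<in> lincombs G zs B}"

lemma lincombs_ConsI:
  "g \<in> G \<Longrightarrow> w \<in> lincombs G zs B \<Longrightarrow> (\<lambda>i. g \<otimes> z i \<oplus> w i) \<in> lincombs G (z # zs) B"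
  by auto

lemma submodule_carrier: "submodule_of_functions V \<Longrightarrow> v \<in> V \<Longrightarrow> v i \<in> carrier R"
  unfolding submodule_of_functions_def by blast

lemma submodule_zero: "submodule_of_functions V \<Longrightarrow> (\<lambda>i. \<zero>) \<in> V"
  unfolding submodule_of_functions_def by blast

lemma submodule_add:
  "submodule_of_functions V \<Longrightarrow> u \<in> V \<Longrightarrow> v \<in> V \<Longrightarrow> (\<lambda>i. u i \<oplus> v i) \<in> V"
  unfolding submodule_of_functions_def by blast

lemma submodule_smult:
  "submodule_of_functions V \<Longrightarrow> r \<in> carrier R \<Longrightarrow> v \<in> V \<Longrightarrow> (\<lambda>i. r \<otimes> v i) \<in> V"
  unfolding submodule_of_functions_def by blast

lemma submodule_diff:
  assumes "submodule_of_functions V" "u \<in> V" "v \<in> V"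
  shows "(\<lambda>i. u i \<ominus> v i) \<in> V"
proof -
  have "(\<lambda>i. u i \<oplus> (\<ominus> \<one>) \<otimes> v i) \<in> V"
    using submodule_add[OF assms(1,2)] submodule_smult[OF assms(1) _ assms(3), of "\<ominus> \<one>"] by simp
  moreover have "u i \<oplus> (\<ominus> \<one>) \<otimes> v i = u i \<ominus> v i" for i
    using submodule_carrier[OF assms(1)] assms(2,3) by (simp add: l_minus minus_eq)
  ultimately show ?thesis by simp
qed

lemma submodule_zero_module: "submodule_of_functions {\<lambda>i. \<zero>}"
  unfolding submodule_of_functions_def by simp

lemma submodule_colon:
  assumes B: "submodule_of_functions B" and t: "t \<in> carrier R"
  shows "submodule_of_functions {v. (\<forall>i. v i \<in> carrier R) \<and> (\<lambda>i. t \<otimes> v i) \<in> B}"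
  unfolding submodule_of_functions_def
  using submodule_zero[OF B] submodule_add[OF B] submodule_smult[OF B] t
  by (auto simp: r_distr m_lcomm)

lemma submodule_component_ideal:
  assumes "submodule_of_functions V"
  shows "ideal ((\<lambda>v. v k) ` V) R"
proof (rule idealI_cring)
  show "(\<lambda>v. v k) ` V \<subseteq> carrier R" using submodule_carrier[OF assms] by blast
  show "\<zero> \<in> (\<lambda>v. v k) ` V" using submodule_zero[OF assms] by (rule rev_image_eqI) simp
  show "x \<oplus> y \<in> (\<lambda>v. v k) ` V" if xy: "x \<in> (\<lambda>v. v k) ` V" "y \<in> (\<lambda>v. v k) ` V" for x y
  proof -
    obtain u v where "x = u k" "u \<in> V" "y = v k" "v \<in> V" using xy by auto
    then show ?thesis by (intro rev_image_eqI[OF submodule_add[OF assms, of u v]]) auto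
  qed
  show "r \<otimes> x \<in> (\<lambda>v. v k) ` V" if r: "r \<in> carrier R" and x: "x \<in> (\<lambda>v. v k) ` V" for r x
  proof -
    obtain v where "x = v k" "v \<in> V" using x by auto
    then show ?thesis using r by (intro rev_image_eqI[OF submodule_smult[OF assms, of r v]]) auto
  qed
qed

lemma submodule_lincombs:
  assumes "ideal G R" "submodule_of_functions B" "\<And>z i. z \<in> set zs \<Longrightarrow> z i \<in> carrier R"
  shows "submodule_of_functions (lincombs G zs B)"
  using assms(3)
proof (induction zs)
  case Nil
  then show ?case using assms(2) by simp
next
  case (Cons z zs)
  let ?V = "lincombs G (z # zs) B"
  have zc: "z i \<in> carrier R" for i using Cons.prems by simp
  have W: "submodule_of_functions (lincombs G zs B)" using Cons by simp
  have Gc: "g \<in> carrier R" if "g \<in> G" for g using ideal_carrier assms(1) that by blast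
  note Wc = submodule_carrier[OF W]
  show ?case unfolding submodule_of_functions_def
  proof (intro conjI ballI allI)
    show "v i \<in> carrier R" if "v \<in> ?V" for v i using that zc Gc Wc by auto
    have "(\<lambda>i. \<zero> \<otimes> z i \<oplus> \<zero>) \<in> ?V"
      using ideal_zero[OF assms(1)] submodule_zero[OF W] by auto
    then show "(\<lambda>i. \<zero>) \<in> ?V" using zc by simp
    show "(\<lambda>i. u i \<oplus> v i) \<in> ?V" if uv: "u \<in> ?V" "v \<in> ?V" for u v
    proof -
      obtain g w h x where *: "g \<in> G" "w \<in> lincombs G zs B" "u = (\<lambda>i. g \<otimes> z i \<oplus> w i)"
        "h \<in> G" "x \<in> lincombs G zs B" "v = (\<lambda>i. h \<otimes> z i \<oplus> x i)" using uv by auto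
      have "u i \<oplus> v i = (g \<oplus> h) \<otimes> z i \<oplus> (w i \<oplus> x i)" for i
      proof -
        have "z i \<in> carrier R" "w i \<in> carrier R" "x i \<in> carrier R" "g \<in> carrier R" "h \<in> carrier R"
          using zc Gc Wc * by auto
        then show ?thesis unfolding *(3,6) by algebra
      qed
      then show ?thesis using ideal_add[OF assms(1) *(1,4)] submodule_add[OF W *(2,5)] by auto
    qed
    show "(\<lambda>i. r \<otimes> v i) \<in> ?V" if r: "r \<in> carrier R" and v: "v \<in> ?V" for r v
    proof -
      obtain g w where *: "g \<in> G" "w \<in> lincombs G zs B" "v = (\<lambda>i. g \<otimes> z i \<oplus> w i)"
        using v by auto
      have "r \<otimes> v i = (r \<otimes> g) \<otimes> z i \<oplus> r \<otimes> w i" for i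
      proof -
        have "z i \<in> carrier R" "w i \<in> carrier R" "g \<in> carrier R" using zc Gc Wc * by auto
        then show ?thesis unfolding *(3) using r by algebra
      qed
      then show ?thesis using ideal_mult[OF assms(1) *(1) r] submodule_smult[OF W r *(2)] by auto
    qed
  qed
qed

lemma base_subset_lincombs:
  assumes "ideal G R" "submodule_of_functions B" "\<And>z i. z \<in> set zs \<Longrightarrow> z i \<in> carrier R"
  shows "B \<subseteq> lincombs G zs B"
  using assms(3)
proof (induction zs)
  case (Cons z zs)
  show ?case
  proof
    fix b assume b: "b \<in> B"
    then have "b \<in> lincombs G zs B" using Cons by auto
    moreover have "b = (\<lambda>i. \<zero> \<otimes> z i \<oplus> b i)"
      using Cons.prems submodule_carrier[OF assms(2) b] by simp
    ultimately show "b \<in> lincombs G (z # zs) B" using ideal_zero[OF assms(1)] by auto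
  qed
qed auto

lemma multiple_in_lincombs:
  assumes "ideal G R" "submodule_of_functions B" "\<And>z i. z \<in> set zs \<Longrightarrow> z i \<in> carrier R"
    and "g \<in> G" "z \<in> set zs"
  shows "(\<lambda>i. g \<otimes> z i) \<in> lincombs G zs B"
  using assms(3,5)
proof (induction zs)
  case (Cons y zs)
  note gc = ideal_carrier[OF assms(1,4)]
  show ?case
  proof (cases "z = y")
    case True
    have "(\<lambda>i. g \<otimes> z i) = (\<lambda>i. g \<otimes> y i \<oplus> \<zero>)" using Cons.prems gc True by simp
    moreover have "(\<lambda>i. \<zero>) \<in> lincombs G zs B"
      by (rule submodule_zero, rule submodule_lincombs[OF assms(1,2)]) (use Cons.prems in simp)
    ultimately show ?thesis using assms(4) by auto
  next
    case False
    then have "(\<lambda>i. g \<otimes> z i) \<in> lincombs G zs B" using Cons by auto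
    then have "(\<lambda>i. \<zero> \<otimes> y i \<oplus> g \<otimes> z i) \<in> lincombs G (y # zs) B"
      using lincombs_ConsI[OF ideal_zero[OF assms(1)]] by blast
    then show ?thesis using Cons.prems gc by simp
  qed
qed auto

lemma lincombs_scale:
  assumes "ideal G R" "submodule_of_functions B" "\<And>z i. z \<in> set zs \<Longrightarrow> z i \<in> carrier R"
    and u: "u \<in> carrier R" "\<And>g. g \<in> G \<Longrightarrow> u \<otimes> g \<in> G'"
    and "v \<in> lincombs G zs B"
  shows "(\<lambda>i. u \<otimes> v i) \<in> lincombs G' zs B"
  using assms(3,6)
proof (induction zs arbitrary: v)
  case Nil
  then show ?case using submodule_smult[OF assms(2)] u by simp
next
  case (Cons z zs)
  obtain g w where *: "g \<in> G" "w \<in> lincombs G zs B" "v = (\<lambda>i. g \<otimes> z i \<oplus> w i)"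
    using Cons.prems by auto
  have W: "submodule_of_functions (lincombs G zs B)"
    using submodule_lincombs[OF assms(1,2)] Cons.prems by simp
  have "u \<otimes> v i = (u \<otimes> g) \<otimes> z i \<oplus> u \<otimes> w i" for i
  proof -
    have "z i \<in> carrier R" "w i \<in> carrier R" "g \<in> carrier R"
      using Cons.prems(1) submodule_carrier[OF W] ideal_carrier[OF assms(1)] * by auto
    then show ?thesis unfolding *(3) using u by algebra
  qed
  moreover have "(\<lambda>i. u \<otimes> w i) \<in> lincombs G' zs B" using Cons * by simp
  ultimately show ?case using u(2)[OF *(1)] by auto
qed

lemma lincombs_minimal:
  assumes "submodule_of_functions V" "B \<subseteq> V" "set zs \<subseteq> V" "G \<subseteq> carrier R"
  shows "lincombs G zs B \<subseteq> V"
  using assms(3)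
proof (induction zs)
  case (Cons z zs)
  show ?case
  proof
    fix v assume "v \<in> lincombs G (z # zs) B"
    then obtain g w where *: "g \<in> G" "w \<in> lincombs G zs B" "v = (\<lambda>i. g \<otimes> z i \<oplus> w i)" by auto
    moreover have "(\<lambda>i. g \<otimes> z i) \<in> V"
      using submodule_smult[OF assms(1)] *(1) assms(4) Cons.prems by auto
    ultimately show "v \<in> V" using submodule_add[OF assms(1)] Cons by auto
  qed
qed (use assms in auto)

text \<open>
  A version of the Cayley-Hamilton theorem that avoids determinants. Each relation expresses
  \<open>r [^] d\<close> times a generator through all generators, with coefficients in \<open>G d\<close>. Moving the diagonal term
  of the first relation to the left gives \<open>u = r [^] d \<ominus> g\<close> with \<open>u \<otimes> y\<close> a combination of the other
  generators; multiplying the other relations by \<open>u\<close> eliminates \<open>y\<close> and doubles the degree \<open>d\<close>.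

  The grading serves two purposes. With \<open>G\<close> constantly equal to a prime ideal the conclusion is the
  Nakayama lemma in a localization; with \<open>G d\<close> the ideal of the lower terms of integral equations of
  degree \<open>d\<close> it produces an equation of integral dependence.
\<close>

lemma cayley_hamilton_elimination:
  fixes G :: "nat \<Rightarrow> 'a set" and zs :: "('i \<Rightarrow> 'a) list"
  assumes G: "\<And>d. ideal (G d) R"
    and G_mult: "\<And>d e g h. g \<in> G d \<Longrightarrow> h \<in> G e \<Longrightarrow> g \<otimes> h \<in> G (d + e)"
    and r: "r \<in> carrier R"
    and r_mult: "\<And>d e h. h \<in> G e \<Longrightarrow> r [^] d \<otimes> h \<in> G (d + e)"
    and B: "submodule_of_functions B"
    and zs: "\<And>z i. z \<in> set zs \<Longrightarrow> z i \<in> carrier R"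
    and rel: "\<And>z. z \<in> set zs \<Longrightarrow> (\<lambda>i. r [^] d \<otimes> z i) \<in> lincombs (G d) zs B"
  shows "\<exists>e. \<exists>g\<in>G e. \<forall>z\<in>set zs. (\<lambda>i. (r [^] e \<oplus> g) \<otimes> z i) \<in> B"
  using zs rel
proof (induction zs arbitrary: d)
  case Nil
  then show ?case using ideal_zero[OF G] by auto
next
  case (Cons y zs)
  have yc: "y i \<in> carrier R" for i using Cons.prems by simp
  have zc: "z i \<in> carrier R" if "z \<in> set zs" for z i using Cons.prems that by simp
  have Gc: "g \<in> carrier R" if "g \<in> G d" for g d using ideal_carrier[OF G] that by blast
  note rdc = nat_pow_closed[OF r]
  have sub: "submodule_of_functions (lincombs (G d) zs B)" for d
    using submodule_lincombs[OF G B] zc by blast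
  obtain g w where gw: "g \<in> G d" "w \<in> lincombs (G d) zs B"
     "(\<lambda>i. r [^] d \<otimes> y i) = (\<lambda>i. g \<otimes> y i \<oplus> w i)"
    using Cons.prems(2)[of y] by auto
  define u where "u = r [^] d \<ominus> g"
  have uc: "u \<in> carrier R" unfolding u_def using Gc[OF gw(1)] rdc by simp
  have uG: "u \<otimes> h \<in> G (d + e)" if "h \<in> G e" for h e
  proof -
    have "u \<otimes> h = r [^] d \<otimes> h \<ominus> g \<otimes> h"
      unfolding u_def using Gc[OF gw(1)] Gc[OF that] rdc[of d] by algebra
    then show ?thesis using ideal_diff[OF G r_mult[OF that] G_mult[OF gw(1) that]] by simp
  qed
  have uy: "u \<otimes> y i = w i" for i
  proof -
    have "w i \<in> carrier R" using submodule_carrier[OF sub gw(2)] .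
    moreover have "r [^] d \<otimes> y i = g \<otimes> y i \<oplus> w i" using fun_cong[OF gw(3)] .
    moreover have "u \<otimes> y i = r [^] d \<otimes> y i \<ominus> g \<otimes> y i"
      unfolding u_def using Gc[OF gw(1)] rdc[of d] yc[of i] by algebra
    ultimately show ?thesis using Gc[OF gw(1)] yc[of i] by algebra
  qed
  have "(\<lambda>i. r [^] (d + d) \<otimes> z i) \<in> lincombs (G (d + d)) zs B" if z: "z \<in> set zs" for z
  proof -
    obtain h x where hx: "h \<in> G d" "x \<in> lincombs (G d) zs B"
       "(\<lambda>i. r [^] d \<otimes> z i) = (\<lambda>i. h \<otimes> y i \<oplus> x i)"
      using Cons.prems(2)[of z] z by auto
    have "(\<lambda>i. h \<otimes> w i) \<in> lincombs (G (d + d)) zs B"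
      by (rule lincombs_scale[OF G B _ Gc[OF hx(1)] _ gw(2)]) (use zc G_mult[OF hx(1)] in auto)
    moreover have "(\<lambda>i. u \<otimes> x i) \<in> lincombs (G (d + d)) zs B"
      by (rule lincombs_scale[OF G B _ uc _ hx(2)]) (use zc uG in auto)
    moreover have "(\<lambda>i. (r [^] d \<otimes> g) \<otimes> z i) \<in> lincombs (G (d + d)) zs B"
      by (rule multiple_in_lincombs[OF G B _ r_mult[OF gw(1)] z]) (use zc in auto)
    ultimately have "(\<lambda>i. (h \<otimes> w i \<oplus> u \<otimes> x i) \<oplus> (r [^] d \<otimes> g) \<otimes> z i) \<in> lincombs (G (d + d)) zs B"
      using submodule_add[OF sub] submodule_add[OF sub] by blast
    moreover have "(h \<otimes> w i \<oplus> u \<otimes> x i) \<oplus> (r [^] d \<otimes> g) \<otimes> z i = r [^] (d + d) \<otimes> z i" for i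
    proof -
      have c: "x i \<in> carrier R" "h \<in> carrier R" "g \<in> carrier R"
        using submodule_carrier[OF sub hx(2)] Gc hx gw by auto
      have "h \<otimes> w i \<oplus> u \<otimes> x i = u \<otimes> (h \<otimes> y i \<oplus> x i)"
        unfolding uy[symmetric] using c uc yc[of i] by algebra
      also have "\<dots> = u \<otimes> (r [^] d \<otimes> z i)" using fun_cong[OF hx(3), of i] by simp
      finally have "h \<otimes> w i \<oplus> u \<otimes> x i \<oplus> (r [^] d \<otimes> g) \<otimes> z i = (r [^] d \<otimes> r [^] d) \<otimes> z i"
        unfolding u_def using c rdc[of d] zc[OF z, of i] by algebra
      then show ?thesis using r by (simp add: nat_pow_mult)
    qed
    ultimately show ?thesis by simp
  qed
  then obtain e h where eh: "h \<in> G e" "\<And>z. z \<in> set zs \<Longrightarrow> (\<lambda>i. (r [^] e \<oplus> h) \<otimes> z i) \<in> B"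
    using Cons.IH[of "d + d"] zc by blast
  have hc: "h \<in> carrier R" using Gc eh by blast
  define k where "k = (r [^] d \<otimes> h \<ominus> r [^] e \<otimes> g) \<ominus> h \<otimes> g"
  have kG: "k \<in> G (e + d)"
    unfolding k_def using r_mult[OF eh(1), of d] r_mult[OF gw(1), of e] G_mult[OF eh(1) gw(1)]
    by (auto simp: add.commute[of d e] intro!: ideal_diff[OF G])
  have k: "(r [^] (e + d) \<oplus> k) \<otimes> a = (r [^] e \<oplus> h) \<otimes> (u \<otimes> a)" if "a \<in> carrier R" for a
    unfolding k_def u_def nat_pow_mult[OF r, symmetric]
    using hc Gc[OF gw(1)] rdc[of d] rdc[of e] that by algebra
  have "(\<lambda>i. (r [^] (e + d) \<oplus> k) \<otimes> z i) \<in> B" if z: "z \<in> set (y # zs)" for z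
  proof (cases "z = y")
    case True
    have "submodule_of_functions {v. (\<forall>i. v i \<in> carrier R) \<and> (\<lambda>i. (r [^] e \<oplus> h) \<otimes> v i) \<in> B}"
      using submodule_colon[OF B] hc rdc by simp
    then have "lincombs (G d) zs B \<subseteq> {v. (\<forall>i. v i \<in> carrier R) \<and> (\<lambda>i. (r [^] e \<oplus> h) \<otimes> v i) \<in> B}"
      using eh(2) zc submodule_smult[OF B] submodule_carrier[OF B] hc rdc Gc
      by (intro lincombs_minimal) auto
    then have "(\<lambda>i. (r [^] e \<oplus> h) \<otimes> w i) \<in> B" using gw(2) by blast
    then show ?thesis using k yc True uy by simp
  next
    case False
    then have zB: "(\<lambda>i. (r [^] e \<oplus> h) \<otimes> z i) \<in> B" and zc: "\<And>i. z i \<in> carrier R" 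
      using eh z zc by auto
    have "(\<lambda>i. u \<otimes> ((r [^] e \<oplus> h) \<otimes> z i)) \<in> B" using submodule_smult[OF B uc zB] .
    moreover have "u \<otimes> ((r [^] e \<oplus> h) \<otimes> z i) = (r [^] (e + d) \<oplus> k) \<otimes> z i" for i
      using k[OF zc] hc rdc uc zc by (simp add: m_lcomm)
    ultimately show ?thesis by simp
  qed
  then show ?case using kG by blast
qed

end

section \<open>Finite generation and the Nakayama lemma\<close>

context noetherian_cring
begin

text \<open>
  Induction on the support: the coefficients at \<open>k\<close> of the members of \<open>Z\<close> form an ideal, and after lifting
  finitely many generators of it only members vanishing at \<open>k\<close> remain.
\<close>

lemma submodule_of_functions_finitely_generated:
  fixes Z :: "('i \<Rightarrow> 'a) set"
  assumes "finite A" "submodule_of_functions Z" "\<forall>z\<in>Z. \<forall>i. i \<notin> A \<longrightarrow> z i = \<zero>"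
  shows "\<exists>zs. set zs \<subseteq> Z \<and> Z \<subseteq> lincombs (carrier R) zs {\<lambda>i. \<zero>}"
  using assms
proof (induction A arbitrary: Z rule: finite_induct)
  case empty
  then have "set [] \<subseteq> Z \<and> Z \<subseteq> lincombs (carrier R) [] {\<lambda>i. \<zero>}" by auto
  then show ?case by blast
next
  case (insert k A)
  note Z = insert.prems(1)
  let ?L = "\<lambda>zs. lincombs (carrier R) zs {\<lambda>i::'i. \<zero>}"
  have L: "submodule_of_functions (?L zs)" "set zs \<subseteq> ?L zs" if "set zs \<subseteq> Z" for zs
  proof -
    have c: "z i \<in> carrier R" if "z \<in> set zs" for z i
      using \<open>set zs \<subseteq> Z\<close> submodule_carrier[OF Z] that by blast
    show "submodule_of_functions (?L zs)"
      by (rule submodule_lincombs[OF oneideal submodule_zero_module]) (use c in auto)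
    show "set zs \<subseteq> ?L zs"
    proof
      fix z assume z: "z \<in> set zs"
      have "(\<lambda>i. \<one> \<otimes> z i) \<in> ?L zs"
        by (rule multiple_in_lincombs[OF oneideal submodule_zero_module _ _ z]) (use c in auto)
      then show "z \<in> ?L zs" using c[OF z] by simp
    qed
  qed
  obtain F where F: "F \<subseteq> carrier R" "finite F" "(\<lambda>z. z k) ` Z = Idl F"
    using finetely_gen[OF submodule_component_ideal[OF Z]] by blast
  then have "F \<subseteq> (\<lambda>z. z k) ` Z" using genideal_self by simp
  then have "\<forall>f\<in>F. \<exists>z\<in>Z. z k = f" by (auto dest!: subsetD)
  then obtain g where g: "\<And>f. f \<in> F \<Longrightarrow> g f \<in> Z \<and> g f k = f" by metis
  obtain zs1 where zs1: "set zs1 = g ` F" using finite_list[of "g ` F"] F(2) by blast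
  have zs1Z: "set zs1 \<subseteq> Z" using zs1 g by auto
  have "F \<subseteq> (\<lambda>v. v k) ` ?L zs1"
  proof
    fix f assume f: "f \<in> F"
    then have "g f \<in> ?L zs1" using L(2)[OF zs1Z] zs1 by blast
    then show "f \<in> (\<lambda>v. v k) ` ?L zs1" by (rule rev_image_eqI) (simp add: g f)
  qed
  then have comp: "(\<lambda>z. z k) ` Z \<subseteq> (\<lambda>v. v k) ` ?L zs1"
    unfolding F(3) by (rule genideal_minimal[OF submodule_component_ideal[OF L(1)[OF zs1Z]]])
  have L1Z: "?L zs1 \<subseteq> Z"
    using lincombs_minimal[OF Z _ zs1Z] submodule_zero[OF Z] by simp
  define Z0 where "Z0 = {z \<in> Z. z k = \<zero>}"
  have "submodule_of_functions Z0"
    using Z unfolding submodule_of_functions_def Z0_def by simp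
  moreover have "\<forall>z\<in>Z0. \<forall>i. i \<notin> A \<longrightarrow> z i = \<zero>"
    using insert.prems(2) unfolding Z0_def by (metis (mono_tags, lifting) insertE mem_Collect_eq)
  ultimately obtain zs2 where zs2: "set zs2 \<subseteq> Z0" "Z0 \<subseteq> ?L zs2" using insert.IH by blast
  have all: "set (zs1 @ zs2) \<subseteq> Z" using zs1Z zs2(1) unfolding Z0_def by auto
  note V = L[OF all]
  have sub: "?L ys \<subseteq> ?L (zs1 @ zs2)" if "set ys \<subseteq> set (zs1 @ zs2)" for ys
    by (rule lincombs_minimal[OF V(1)]) (use submodule_zero[OF V(1)] V(2) that in blast)+
  have "Z \<subseteq> ?L (zs1 @ zs2)"
  proof
    fix z assume z: "z \<in> Z"
    then have "z k \<in> (\<lambda>v. v k) ` ?L zs1" using comp by blast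
    then obtain v where v: "v \<in> ?L zs1" "z k = v k" by auto
    then have vZ: "v \<in> Z" using L1Z by blast
    have "(\<lambda>i. z i \<ominus> v i) \<in> Z0"
      using submodule_diff[OF Z z vZ] v(2) submodule_carrier[OF Z vZ] unfolding Z0_def
      by simp
    then have "(\<lambda>i. z i \<ominus> v i) \<in> ?L (zs1 @ zs2)" using sub[of zs2] zs2(2) by auto
    moreover have "v \<in> ?L (zs1 @ zs2)" using sub[of zs1] v(1) by auto
    ultimately have "(\<lambda>i. v i \<oplus> (z i \<ominus> v i)) \<in> ?L (zs1 @ zs2)"
      using submodule_add[OF V(1)] by blast
    moreover have "v i \<oplus> (z i \<ominus> v i) = z i" for i
      using submodule_carrier[OF Z vZ, of i] submodule_carrier[OF Z z, of i] by algebra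
    ultimately show "z \<in> ?L (zs1 @ zs2)" by simp
  qed
  then show ?case using all by blast
qed

lemma uniform_multiplier:
  assumes P: "primeideal P R" and V: "submodule_of_functions V" and "finite S"
    and "\<And>z i. z \<in> S \<Longrightarrow> z i \<in> carrier R"
    and "\<And>z. z \<in> S \<Longrightarrow> \<exists>t\<in>carrier R - P. (\<lambda>i. t \<otimes> z i) \<in> V"
  shows "\<exists>t\<in>carrier R - P. \<forall>z\<in>S. (\<lambda>i. t \<otimes> z i) \<in> V"
  using assms(3-5)
proof (induction S rule: finite_induct)
  case empty
  then show ?case using prime_not_one[OF P] by blast
next
  case (insert y S)
  obtain t where t: "t \<in> carrier R - P" "\<And>z. z \<in> S \<Longrightarrow> (\<lambda>i. t \<otimes> z i) \<in> V"
    using insert.IH insert.prems by blast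
  obtain u where u: "u \<in> carrier R - P" "(\<lambda>i. u \<otimes> y i) \<in> V" using insert.prems by blast
  have "(\<lambda>i. (u \<otimes> t) \<otimes> z i) \<in> V" if z: "z \<in> insert y S" for z
  proof (cases "z = y")
    case True
    have "(\<lambda>i. t \<otimes> (u \<otimes> z i)) \<in> V" using submodule_smult[OF V _ u(2)] t True by simp
    moreover have "t \<otimes> (u \<otimes> z i) = (u \<otimes> t) \<otimes> z i" for i
      using insert.prems(1)[OF z] t u by (simp add: m_ac)
    ultimately show ?thesis by simp
  next
    case False
    then have "(\<lambda>i. u \<otimes> (t \<otimes> z i)) \<in> V" using submodule_smult[OF V _ t(2)] u z by simp
    moreover have "u \<otimes> (t \<otimes> z i) = (u \<otimes> t) \<otimes> z i" for i
      using insert.prems(1)[OF z] t u by (simp add: m_ac)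
    ultimately show ?thesis by simp
  qed
  then show ?case using prime_mult_notin[OF P, of u t] t u by blast
qed

text \<open>
  The Nakayama lemma for the localizations of \<open>Z\<close> and \<open>B\<close> at \<open>P\<close>, stated without fractions: the hypothesis
  says that \<open>Z\<close> is contained in \<open>P Z + B\<close> locally, the conclusion that \<open>Z\<close> is contained in \<open>B\<close> locally.
\<close>

lemma nakayama_at_prime:
  fixes Z B :: "('i \<Rightarrow> 'a) set"
  assumes P: "primeideal P R" and A: "finite A"
    and Z: "submodule_of_functions Z" "\<forall>z\<in>Z. \<forall>i. i \<notin> A \<longrightarrow> z i = \<zero>"
    and B: "submodule_of_functions B"
    and rel: "\<And>z. z \<in> Z \<Longrightarrow>
      \<exists>t\<in>carrier R - P. \<exists>p\<in>P. \<exists>c\<in>Z. \<exists>b\<in>B. \<forall>i. t \<otimes> z i = p \<otimes> c i \<oplus> b i"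
  shows "\<exists>t\<in>carrier R - P. \<forall>z\<in>Z. (\<lambda>i. t \<otimes> z i) \<in> B"
proof -
  note Pi = prime_ideal[OF P]
  obtain zs where zs: "set zs \<subseteq> Z" "Z \<subseteq> lincombs (carrier R) zs {\<lambda>i. \<zero>}"
    using submodule_of_functions_finitely_generated[OF A Z] by blast
  have zc: "z i \<in> carrier R" if "z \<in> set zs" for z i
    using zs(1) submodule_carrier[OF Z(1)] that by blast
  have LB: "submodule_of_functions (lincombs G zs B)" if "ideal G R" for G
    by (rule submodule_lincombs[OF that B]) (use zc in auto)
  have ZL: "Z \<subseteq> lincombs (carrier R) zs B"
  proof -
    have "set zs \<subseteq> lincombs (carrier R) zs B"
    proof
      fix z assume z: "z \<in> set zs"
      have "(\<lambda>i. \<one> \<otimes> z i) \<in> lincombs (carrier R) zs B"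
        by (rule multiple_in_lincombs[OF oneideal B _ _ z]) (use zc in auto)
      then show "z \<in> lincombs (carrier R) zs B" using zc[OF z] by simp
    qed
    then have "lincombs (carrier R) zs {\<lambda>i. \<zero>} \<subseteq> lincombs (carrier R) zs B"
      using lincombs_minimal[OF LB[OF oneideal]] submodule_zero[OF LB[OF oneideal]] by simp
    then show ?thesis using zs(2) by blast
  qed
  have "\<exists>t\<in>carrier R - P. (\<lambda>i. t \<otimes> z i) \<in> lincombs P zs B" if z: "z \<in> set zs" for z
  proof -
    have "z \<in> Z" using z zs(1) by blast
    then obtain t p c b where *: "t \<in> carrier R - P" "p \<in> P" "c \<in> Z" "b \<in> B"
      "\<And>i. t \<otimes> z i = p \<otimes> c i \<oplus> b i" using rel by meson
    have "(\<lambda>i. p \<otimes> c i) \<in> lincombs P zs B"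
      by (rule lincombs_scale[OF oneideal B, where G' = P])
        (use zc * ZL ideal_carrier[OF Pi] ideal_mult'[OF Pi] in auto)
    moreover have "b \<in> lincombs P zs B"
      using base_subset_lincombs[OF Pi B] zc *(4) by blast
    ultimately have "(\<lambda>i. p \<otimes> c i \<oplus> b i) \<in> lincombs P zs B" by (rule submodule_add[OF LB[OF Pi]])
    then have "(\<lambda>i. t \<otimes> z i) \<in> lincombs P zs B" by (simp add: *(5))
    then show ?thesis using *(1) by blast
  qed
  then obtain r where r: "r \<in> carrier R - P"
    "\<And>z. z \<in> set zs \<Longrightarrow> (\<lambda>i. r \<otimes> z i) \<in> lincombs P zs B"
    using uniform_multiplier[OF P LB[OF Pi], of "set zs"] zc by blast
  have "\<exists>e. \<exists>g\<in>P. \<forall>z\<in>set zs. (\<lambda>i. (r [^] (e::nat) \<oplus> g) \<otimes> z i) \<in> B"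
    by (rule cayley_hamilton_elimination[where G = "\<lambda>_. P" and d = 1])
      (use Pi r B zc ideal_mult[OF Pi] ideal_carrier[OF Pi] in auto)
  then obtain e g where eg: "g \<in> P" "\<And>z. z \<in> set zs \<Longrightarrow> (\<lambda>i. (r [^] (e::nat) \<oplus> g) \<otimes> z i) \<in> B"
    by blast
  define t where "t = r [^] e \<oplus> g"
  have tc: "t \<in> carrier R" unfolding t_def using r eg ideal_carrier[OF Pi] by simp
  moreover have "t \<notin> P"
    using ideal_cancel[OF Pi, of "r [^] e" g] prime_pow_mem[OF P, of r e] r eg
    unfolding t_def by auto
  moreover have "(\<lambda>i. t \<otimes> z i) \<in> B" if "z \<in> Z" for z
  proof -
    let ?V = "{v. (\<forall>i. v i \<in> carrier R) \<and> (\<lambda>i. t \<otimes> v i) \<in> B}"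
    have "set zs \<subseteq> ?V" using eg(2) zc unfolding t_def by blast
    then have "lincombs (carrier R) zs {\<lambda>i. \<zero>} \<subseteq> ?V"
      using submodule_colon[OF B tc] submodule_zero[OF submodule_colon[OF B tc]]
      by (intro lincombs_minimal) auto
    then show ?thesis using that zs(2) by blast
  qed
  ultimately show ?thesis by blast
qed

end

section \<open>Syzygies and Koszul relations\<close>

context cring
begin

lemma genideal_image_eq:
  assumes "finite A" "\<forall>i\<in>A. a i \<in> carrier R"
  shows "Idl (a ` A) = {\<Oplus>i\<in>A. c i \<otimes> a i | c. \<forall>i. c i \<in> carrier R}" (is "_ = ?S")
proof
  have ac: "a ` A \<subseteq> carrier R" using assms(2) by auto
  have Si: "ideal ?S R"
  proof (rule idealI_cring)
    show "?S \<subseteq> carrier R" using assms(2) by (auto intro!: finsum_closed)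
    have "(\<Oplus>i\<in>A. \<zero> \<otimes> a i) = \<zero>" using assms(2) by (intro add.finprod_one_eqI) auto
    then show "\<zero> \<in> ?S" by (intro CollectI exI[of _ "\<lambda>_. \<zero>"]) simp
    show "x \<oplus> y \<in> ?S" if xy: "x \<in> ?S" "y \<in> ?S" for x y
    proof -
      obtain c d where *: "x = (\<Oplus>i\<in>A. c i \<otimes> a i)" "\<And>i. c i \<in> carrier R"
        "y = (\<Oplus>i\<in>A. d i \<otimes> a i)" "\<And>i. d i \<in> carrier R" using xy by auto
      have "x \<oplus> y = (\<Oplus>i\<in>A. c i \<otimes> a i \<oplus> d i \<otimes> a i)"
        unfolding * by (rule finsum_addf[symmetric]) (use * assms(2) in auto)
      also have "\<dots> = (\<Oplus>i\<in>A. (c i \<oplus> d i) \<otimes> a i)"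
        using * assms(2) by (intro finsum_cong') (auto simp: l_distr)
      finally show ?thesis using *(2,4) by (intro CollectI exI[of _ "\<lambda>i. c i \<oplus> d i"]) simp
    qed
    show "r \<otimes> x \<in> ?S" if r: "r \<in> carrier R" and x: "x \<in> ?S" for r x
    proof -
      obtain c where *: "x = (\<Oplus>i\<in>A. c i \<otimes> a i)" "\<And>i. c i \<in> carrier R" using x by auto
      have "r \<otimes> x = (\<Oplus>i\<in>A. r \<otimes> (c i \<otimes> a i))"
        unfolding * by (rule finsum_rdistr) (use * r assms in auto)
      also have "\<dots> = (\<Oplus>i\<in>A. (r \<otimes> c i) \<otimes> a i)"
        using * assms(2) r by (intro finsum_cong') (auto simp: m_assoc)
      finally show ?thesis using *(2) r by (intro CollectI exI[of _ "\<lambda>i. r \<otimes> c i"]) simp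
    qed
  qed
  have "a ` A \<subseteq> ?S"
  proof
    fix y assume "y \<in> a ` A"
    then obtain k where k: "k \<in> A" "y = a k" by blast
    have "(\<Oplus>i\<in>A. (if i = k then \<one> else \<zero>) \<otimes> a i) = (\<Oplus>i\<in>A. if k = i then a i else \<zero>)"
      using assms(2) by (intro finsum_cong') auto
    also have "\<dots> = y" using add.finprod_singleton[OF k(1) assms(1), of a] assms(2) k by auto
    finally show "y \<in> ?S" by (intro CollectI exI[of _ "\<lambda>i. if i = k then \<one> else \<zero>"]) auto
  qed
  then show "Idl (a ` A) \<subseteq> ?S" by (rule genideal_minimal[OF Si])
  have I: "ideal (Idl (a ` A)) R" by (rule genideal_ideal[OF ac])
  have gen: "a i \<in> Idl (a ` A)" if "i \<in> A" for i using genideal_self[OF ac] that by blast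
  have "(\<Oplus>i\<in>A. c i \<otimes> a i) \<in> Idl (a ` A)" if c: "\<And>i. c i \<in> carrier R" for c
  proof -
    have "(\<Oplus>i\<in>F. c i \<otimes> a i) \<in> Idl (a ` A)" if "finite F" "F \<subseteq> A" for F
      using that
    proof (induction F rule: finite_induct)
      case empty
      then show ?case using ideal_zero[OF I] by simp
    next
      case (insert j F)
      then have "(\<Oplus>i\<in>insert j F. c i \<otimes> a i) = c j \<otimes> a j \<oplus> (\<Oplus>i\<in>F. c i \<otimes> a i)"
        using c assms(2) by (intro finsum_insert) auto
      then show ?case using insert ideal_add[OF I] ideal_mult[OF I] gen c by simp
    qed
    then show ?thesis using assms(1) by blast
  qed
  then show "?S \<subseteq> Idl (a ` A)" by blast
qed

definition syzygies :: "'i set \<Rightarrow> ('i \<Rightarrow> 'a) \<Rightarrow> ('i \<Rightarrow> 'a) set" where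
  "syzygies A a = {z. (\<forall>i. z i \<in> carrier R) \<and> (\<forall>i. i \<notin> A \<longrightarrow> z i = \<zero>) \<and>
     (\<Oplus>i\<in>A. a i \<otimes> z i) = \<zero>}"

definition alternating :: "'i set \<Rightarrow> ('i \<Rightarrow> 'i \<Rightarrow> 'a) \<Rightarrow> bool" where
  "alternating A w \<longleftrightarrow> (\<forall>i j. w i j \<in> carrier R) \<and> (\<forall>i. w i i = \<zero>) \<and>
     (\<forall>i j. w i j = \<ominus> w j i) \<and> (\<forall>i j. i \<notin> A \<longrightarrow> w i j = \<zero>)"

text \<open>
  The first boundaries of the Koszul complex: the combination of the relations
  \<open>a j \<cdot> e i - a i \<cdot> e j\<close>, one for each unordered pair, with coefficients \<open>w i j\<close> is the product of the alternating matrix \<open>w\<close>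
  with the vector \<open>a\<close>. In this form an index can be dropped by deleting a row and a column.
\<close>

definition koszul_relations :: "'i set \<Rightarrow> ('i \<Rightarrow> 'a) \<Rightarrow> ('i \<Rightarrow> 'a) set" where
  "koszul_relations A a = {\<lambda>i. \<Oplus>j\<in>A. w i j \<otimes> a j | w. alternating A w}"

lemma alternating_closed: "alternating A w \<Longrightarrow> w i j \<in> carrier R"
  unfolding alternating_def by blast

lemma alternating_diag: "alternating A w \<Longrightarrow> w i i = \<zero>"
  unfolding alternating_def by blast

lemma alternating_skew: "alternating A w \<Longrightarrow> w i j = \<ominus> w j i"
  unfolding alternating_def by blast

lemma alternating_outside: "alternating A w \<Longrightarrow> i \<notin> A \<Longrightarrow> w i j = \<zero>"
  unfolding alternating_def by blast

lemma alternatingI: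
  assumes "\<And>i j. w i j \<in> carrier R" "\<And>i. w i i = \<zero>" "\<And>i j. w i j = \<ominus> w j i"
    and "\<And>i j. i \<notin> A \<Longrightarrow> w i j = \<zero>"
  shows "alternating A w"
  using assms unfolding alternating_def by blast

lemma submodule_syzygies:
  assumes "finite A" "\<forall>i\<in>A. a i \<in> carrier R"
  shows "submodule_of_functions (syzygies A a)"
  unfolding submodule_of_functions_def
proof (intro conjI ballI allI)
  show "v i \<in> carrier R" if "v \<in> syzygies A a" for v i using that unfolding syzygies_def by blast
  have "(\<Oplus>i\<in>A. a i \<otimes> \<zero>) = \<zero>" using assms(2) by (intro add.finprod_one_eqI) auto
  then show "(\<lambda>i. \<zero>) \<in> syzygies A a" unfolding syzygies_def by simp
  show "(\<lambda>i. u i \<oplus> v i) \<in> syzygies A a" if "u \<in> syzygies A a" "v \<in> syzygies A a" for u v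
  proof -
    have c: "u i \<in> carrier R" "v i \<in> carrier R" for i using that unfolding syzygies_def by auto
    have "(\<Oplus>i\<in>A. a i \<otimes> (u i \<oplus> v i)) = (\<Oplus>i\<in>A. a i \<otimes> u i \<oplus> a i \<otimes> v i)"
      using c assms(2) by (intro finsum_cong') (auto simp: r_distr)
    also have "\<dots> = (\<Oplus>i\<in>A. a i \<otimes> u i) \<oplus> (\<Oplus>i\<in>A. a i \<otimes> v i)"
      by (rule finsum_addf) (use c assms(2) in auto)
    finally show ?thesis using that c unfolding syzygies_def by simp
  qed
  show "(\<lambda>i. r \<otimes> v i) \<in> syzygies A a" if "r \<in> carrier R" "v \<in> syzygies A a" for r v
  proof -
    have c: "v i \<in> carrier R" for i using that unfolding syzygies_def by auto
    have "(\<Oplus>i\<in>A. a i \<otimes> (r \<otimes> v i)) = (\<Oplus>i\<in>A. r \<otimes> (a i \<otimes> v i))"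
      using c assms(2) that(1) by (intro finsum_cong') (auto simp: m_lcomm)
    also have "\<dots> = r \<otimes> (\<Oplus>i\<in>A. a i \<otimes> v i)"
      by (rule finsum_rdistr[symmetric]) (use c assms that(1) in auto)
    finally show ?thesis using that c unfolding syzygies_def by simp
  qed
qed

lemma submodule_koszul_relations:
  assumes "finite A" "\<forall>i\<in>A. a i \<in> carrier R"
  shows "submodule_of_functions (koszul_relations A a)"
  unfolding submodule_of_functions_def
proof (intro conjI ballI allI)
  have wc: "w i j \<in> carrier R" if "alternating A w" for w i j
    using that unfolding alternating_def by blast
  show "v i \<in> carrier R" if "v \<in> koszul_relations A a" for v i
    using that assms(2) wc unfolding koszul_relations_def by (auto intro!: finsum_closed)
  have "(\<Oplus>i\<in>A. \<zero> \<otimes> a i) = \<zero>" using assms(2) by (intro add.finprod_one_eqI) auto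
  moreover have "alternating A (\<lambda>i j. \<zero>)" unfolding alternating_def by simp
  ultimately show "(\<lambda>i. \<zero>) \<in> koszul_relations A a"
    unfolding koszul_relations_def by (intro CollectI exI[of _ "\<lambda>i j. \<zero>"]) simp
  show "(\<lambda>i. u i \<oplus> v i) \<in> koszul_relations A a"
    if uv: "u \<in> koszul_relations A a" "v \<in> koszul_relations A a" for u v
  proof -
    obtain w x where w: "alternating A w" "u = (\<lambda>i. \<Oplus>j\<in>A. w i j \<otimes> a j)"
      and x: "alternating A x" "v = (\<lambda>i. \<Oplus>j\<in>A. x i j \<otimes> a j)"
      using uv unfolding koszul_relations_def by blast
    have skew: "w i j \<oplus> x i j = \<ominus> (w j i \<oplus> x j i)" for i j
    proof -
      have "w i j = \<ominus> w j i" "x i j = \<ominus> x j i" using w(1) x(1) unfolding alternating_def by blast+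
      then show ?thesis using wc[OF w(1), of j i] wc[OF x(1), of j i] by (simp add: minus_add)
    qed
    have alt: "alternating A (\<lambda>i j. w i j \<oplus> x i j)"
      by (rule alternatingI[OF _ _ skew])
        (simp_all add: alternating_closed[OF w(1)] alternating_closed[OF x(1)]
          alternating_diag[OF w(1)] alternating_diag[OF x(1)]
          alternating_outside[OF w(1)] alternating_outside[OF x(1)])
    have "(\<Oplus>j\<in>A. (w i j \<oplus> x i j) \<otimes> a j) = u i \<oplus> v i" for i
    proof -
      have "(\<Oplus>j\<in>A. (w i j \<oplus> x i j) \<otimes> a j) = (\<Oplus>j\<in>A. w i j \<otimes> a j \<oplus> x i j \<otimes> a j)"
        using wc[OF w(1)] wc[OF x(1)] assms(2) by (intro finsum_cong') (auto simp: l_distr)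
      also have "\<dots> = u i \<oplus> v i" unfolding w(2) x(2)
        by (rule finsum_addf) (use wc[OF w(1)] wc[OF x(1)] assms(2) in auto)
      finally show ?thesis .
    qed
    then show ?thesis unfolding koszul_relations_def
      by (intro CollectI exI[of _ "\<lambda>i j. w i j \<oplus> x i j"] conjI[OF _ alt]) (simp add: fun_eq_iff)
  qed
  show "(\<lambda>i. r \<otimes> v i) \<in> koszul_relations A a"
    if r: "r \<in> carrier R" and v: "v \<in> koszul_relations A a" for r v
  proof -
    obtain w where w: "alternating A w" "v = (\<lambda>i. \<Oplus>j\<in>A. w i j \<otimes> a j)"
      using v unfolding koszul_relations_def by blast
    have skew: "r \<otimes> w i j = \<ominus> (r \<otimes> w j i)" for i j
    proof -
      have "w i j = \<ominus> w j i" using w(1) unfolding alternating_def by blast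
      then show ?thesis using wc[OF w(1), of j i] r by (simp add: r_minus)
    qed
    have alt: "alternating A (\<lambda>i j. r \<otimes> w i j)"
      by (rule alternatingI[OF _ _ skew])
        (simp_all add: r alternating_closed[OF w(1)] alternating_diag[OF w(1)]
          alternating_outside[OF w(1)])
    have "(\<Oplus>j\<in>A. (r \<otimes> w i j) \<otimes> a j) = r \<otimes> v i" for i
    proof -
      have "(\<Oplus>j\<in>A. (r \<otimes> w i j) \<otimes> a j) = (\<Oplus>j\<in>A. r \<otimes> (w i j \<otimes> a j))"
        using wc[OF w(1)] assms(2) r by (intro finsum_cong') (auto simp: m_assoc)
      also have "\<dots> = r \<otimes> v i" unfolding w(2)
        by (rule finsum_rdistr[symmetric]) (use wc[OF w(1)] assms r in auto)
      finally show ?thesis .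
    qed
    then show ?thesis unfolding koszul_relations_def
      by (intro CollectI exI[of _ "\<lambda>i j. r \<otimes> w i j"] conjI[OF _ alt]) (simp add: fun_eq_iff)
  qed
qed

text \<open>
  The diagonal entry of the alternating matrix vanishes, so \<open>a k\<close> does not contribute to the coefficient
  at \<open>k\<close>.
\<close>

lemma koszul_relation_component:
  assumes "finite A" "k \<notin> A" and a: "\<forall>i\<in>insert k A. a i \<in> carrier R"
    and b: "b \<in> koszul_relations (insert k A) a"
  shows "b k \<in> Idl (a ` A)"
proof -
  obtain w where w: "alternating (insert k A) w" "b = (\<lambda>i. \<Oplus>j\<in>insert k A. w i j \<otimes> a j)"
    using b unfolding koszul_relations_def by blast
  have "b k = w k k \<otimes> a k \<oplus> (\<Oplus>j\<in>A. w k j \<otimes> a j)"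
    unfolding w(2) using assms(1,2) a alternating_closed[OF w(1)]
    by (intro finsum_insert) auto
  also have "\<dots> = (\<Oplus>j\<in>A. w k j \<otimes> a j)"
    using a alternating_closed[OF w(1)] alternating_diag[OF w(1)] by (simp add: finsum_closed)
  finally show ?thesis
    using genideal_image_eq[OF assms(1), of a] a alternating_closed[OF w(1)] by auto
qed

text \<open>
  Split off column \<open>k\<close> of the alternating matrix. This column is a syzygy of the remaining elements, since
  by skew symmetry its pairing with them is the negative of \<open>b k\<close>.
\<close>

lemma koszul_relation_split:
  assumes A: "finite A" "k \<notin> A" and a: "\<forall>i\<in>insert k A. a i \<in> carrier R"
    and b: "b \<in> koszul_relations (insert k A) a" "b k = \<zero>"
  shows "\<exists>c\<in>syzygies A a. \<exists>b'\<in>koszul_relations A a. \<forall>i. b i = a k \<otimes> c i \<oplus> b' i"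
proof -
  obtain w where w: "alternating (insert k A) w" "b = (\<lambda>i. \<Oplus>j\<in>insert k A. w i j \<otimes> a j)"
    using b unfolding koszul_relations_def by blast
  note wc = alternating_closed[OF w(1)] and wd = alternating_diag[OF w(1)]
    and wo = alternating_outside[OF w(1)]
  have b_eq: "b i = w i k \<otimes> a k \<oplus> (\<Oplus>j\<in>A. w i j \<otimes> a j)" for i
    unfolding w(2) using A a wc by (intro finsum_insert) auto
  have sumk: "(\<Oplus>j\<in>A. w k j \<otimes> a j) = \<zero>"
    using b_eq[of k] b(2) a wc wd by (simp add: finsum_closed)
  have cA: "w i k = \<zero>" if "i \<notin> A" for i using wo[of i k] wd that by (cases "i = k") auto
  define c where "c = (\<lambda>i. w i k)"
  have "(\<Oplus>i\<in>A. a i \<otimes> w i k) = (\<Oplus>i\<in>A. (\<ominus> \<one>) \<otimes> (w k i \<otimes> a i))"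
  proof (rule finsum_cong')
    fix i assume "i \<in> A"
    have ik: "w i k = \<ominus> w k i" by (rule alternating_skew[OF w(1)])
    show "a i \<otimes> w i k = (\<ominus> \<one>) \<otimes> (w k i \<otimes> a i)"
      unfolding ik using a \<open>i \<in> A\<close> wc[of k i] by (simp add: l_minus r_minus m_comm)
  qed (use a wc in auto)
  also have "\<dots> = (\<ominus> \<one>) \<otimes> (\<Oplus>i\<in>A. w k i \<otimes> a i)"
    by (rule finsum_rdistr[symmetric]) (use A a wc in auto)
  finally have "c \<in> syzygies A a"
    unfolding c_def syzygies_def using wc cA sumk by simp
  moreover define w' where "w' = (\<lambda>i j. if i = k \<or> j = k then \<zero> else w i j)"
  have "alternating A w'"
  proof (rule alternatingI)
    show "w' i j = \<ominus> w' j i" for i j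
      unfolding w'_def using alternating_skew[OF w(1), of i j] by auto
    show "w' i j = \<zero>" if "i \<notin> A" for i j unfolding w'_def using wo that by auto
  qed (auto simp: w'_def wc wd)
  then have "(\<lambda>i. \<Oplus>j\<in>A. w' i j \<otimes> a j) \<in> koszul_relations A a"
    unfolding koszul_relations_def by blast
  moreover have "b i = a k \<otimes> c i \<oplus> (\<Oplus>j\<in>A. w' i j \<otimes> a j)" for i
  proof (cases "i = k")
    case True
    have "(\<Oplus>j\<in>A. w' k j \<otimes> a j) = \<zero>"
      unfolding w'_def using a by (intro add.finprod_one_eqI) auto
    then show ?thesis using True b(2) wd a unfolding c_def by simp
  next
    case False
    have "(\<Oplus>j\<in>A. w' i j \<otimes> a j) = (\<Oplus>j\<in>A. w i j \<otimes> a j)"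
      unfolding w'_def using False A a wc by (intro finsum_cong') auto
    then show ?thesis unfolding c_def b_eq using wc a by (simp add: m_comm)
  qed
  ultimately show ?thesis
    by (intro bexI[of _ c] bexI[of _ "\<lambda>i. \<Oplus>j\<in>A. w' i j \<otimes> a j"] allI) auto
qed

text \<open>
  The exterior product of \<open>z\<close> with the basis vector \<open>e i\<close> has boundary \<open>a i \<cdot> z\<close>, because \<open>z\<close> is a cycle;
  \<open>w\<close> is the alternating matrix of this exterior product.
\<close>

lemma generator_times_syzygy:
  assumes A: "finite A" and a: "\<forall>i\<in>A. a i \<in> carrier R"
    and i: "i \<in> A" and z: "z \<in> syzygies A a"
  shows "(\<lambda>p. a i \<otimes> z p) \<in> koszul_relations A a"
proof -
  have zc: "\<And>p. z p \<in> carrier R" and zo: "\<And>p. p \<notin> A \<Longrightarrow> z p = \<zero>"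
    and zs: "(\<Oplus>p\<in>A. a p \<otimes> z p) = \<zero>" using z unfolding syzygies_def by auto
  define w where "w = (\<lambda>p q. (if q = i then z p else \<zero>) \<ominus> (if p = i then z q else \<zero>))"
  have alt: "alternating A w"
    by (rule alternatingI) (use zc zo i in \<open>auto simp: w_def minus_eq minus_add a_comm r_neg\<close>)
  have "(\<Oplus>q\<in>A. w p q \<otimes> a q) = a i \<otimes> z p" for p
  proof -
    define e where "e = (if p = i then \<ominus> \<one> else \<zero>)"
    have ec: "e \<in> carrier R" unfolding e_def by simp
    have "(\<Oplus>q\<in>A. w p q \<otimes> a q) = (\<Oplus>q\<in>A. (if i = q then a q \<otimes> z p else \<zero>) \<oplus> e \<otimes> (a q \<otimes> z q))"
    proof (rule finsum_cong')
      fix q assume q: "q \<in> A"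
      show "w p q \<otimes> a q = (if i = q then a q \<otimes> z p else \<zero>) \<oplus> e \<otimes> (a q \<otimes> z q)"
        unfolding w_def e_def using zc[of p] zc[of q] bspec[OF a q]
        by (auto simp: minus_eq l_minus r_minus l_distr r_distr m_comm)
    qed (use a zc ec in auto)
    also have "\<dots> = (\<Oplus>q\<in>A. if i = q then a q \<otimes> z p else \<zero>) \<oplus> (\<Oplus>q\<in>A. e \<otimes> (a q \<otimes> z q))"
      by (rule finsum_addf) (use a zc ec in auto)
    also have "(\<Oplus>q\<in>A. if i = q then a q \<otimes> z p else \<zero>) = a i \<otimes> z p"
      by (rule add.finprod_singleton[OF i A]) (use a zc in auto)
    also have "(\<Oplus>q\<in>A. e \<otimes> (a q \<otimes> z q)) = e \<otimes> (\<Oplus>q\<in>A. a q \<otimes> z q)"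
      by (rule finsum_rdistr[symmetric]) (use A a zc ec in auto)
    finally show ?thesis using zs zc bspec[OF a i] ec by simp
  qed
  then show ?thesis unfolding koszul_relations_def
    by (intro CollectI exI[of _ w] conjI[OF _ alt]) (simp add: fun_eq_iff)
qed

lemma ideal_times_syzygy:
  assumes A: "finite A" and a: "\<forall>i\<in>A. a i \<in> carrier R"
    and u: "u \<in> Idl (a ` A)" and z: "z \<in> syzygies A a"
  shows "(\<lambda>p. u \<otimes> z p) \<in> koszul_relations A a"
proof -
  note B = submodule_koszul_relations[OF A a]
  have zc: "\<And>p. z p \<in> carrier R" using z unfolding syzygies_def by auto
  let ?U = "{u \<in> carrier R. (\<lambda>p. u \<otimes> z p) \<in> koszul_relations A a}"
  have "ideal ?U R"
  proof (rule idealI_cring)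
    show "\<zero> \<in> ?U" using submodule_zero[OF B] zc by simp
    show "x \<oplus> y \<in> ?U" if xy: "x \<in> ?U" "y \<in> ?U" for x y
    proof -
      have "(\<lambda>p. x \<otimes> z p \<oplus> y \<otimes> z p) \<in> koszul_relations A a"
        using submodule_add[OF B] xy by blast
      then show ?thesis using xy zc by (simp add: l_distr)
    qed
    show "r \<otimes> x \<in> ?U" if r: "r \<in> carrier R" "x \<in> ?U" for r x
    proof -
      have "(\<lambda>p. r \<otimes> (x \<otimes> z p)) \<in> koszul_relations A a"
        using submodule_smult[OF B] r by blast
      then show ?thesis using r zc by (simp add: m_assoc)
    qed
  qed auto
  moreover have "a ` A \<subseteq> ?U" using generator_times_syzygy[OF A a _ z] a by auto
  ultimately have "Idl (a ` A) \<subseteq> ?U" by (rule genideal_minimal)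
  then show ?thesis using u by blast
qed

text \<open>
  If \<open>u \<otimes> a k\<close> is a combination of the other elements, then \<open>u\<close> is the coefficient at \<open>k\<close> of a syzygy.
  Its multiple by \<open>r\<close> is a Koszul relation, whose coefficient at \<open>k\<close> involves only the other elements.
\<close>

lemma colon_of_syzygy_annihilator:
  assumes A: "finite A" "k \<notin> A" and a: "\<forall>i\<in>insert k A. a i \<in> carrier R"
    and r: "r \<in> carrier R"
    and ann: "\<And>z. z \<in> syzygies (insert k A) a \<Longrightarrow>
      (\<lambda>i. r \<otimes> z i) \<in> koszul_relations (insert k A) a"
    and u: "u \<in> carrier R" "u \<otimes> a k \<in> Idl (a ` A)"
  shows "r \<otimes> u \<in> Idl (a ` A)"
proof -
  have "u \<otimes> a k \<in> {\<Oplus>i\<in>A. c i \<otimes> a i | c. \<forall>i. c i \<in> carrier R}"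
    using genideal_image_eq[OF A(1), of a] a u(2) by simp
  then obtain c where c: "u \<otimes> a k = (\<Oplus>i\<in>A. c i \<otimes> a i)" "\<And>i. c i \<in> carrier R" by blast
  define z where "z = (\<lambda>i. if i = k then u else if i \<in> A then \<ominus> c i else \<zero>)"
  have zc: "z i \<in> carrier R" for i unfolding z_def using u c by simp
  have "(\<Oplus>i\<in>insert k A. a i \<otimes> z i) = a k \<otimes> z k \<oplus> (\<Oplus>i\<in>A. a i \<otimes> z i)"
    using A a zc by (intro finsum_insert) auto
  also have "(\<Oplus>i\<in>A. a i \<otimes> z i) = (\<Oplus>i\<in>A. (\<ominus> \<one>) \<otimes> (c i \<otimes> a i))"
    unfolding z_def using A a c
    by (intro finsum_cong') (auto simp: l_minus r_minus m_comm)
  also have "\<dots> = (\<ominus> \<one>) \<otimes> (u \<otimes> a k)"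
    unfolding c(1) by (rule finsum_rdistr[symmetric]) (use A a c in auto)
  also have "a k \<otimes> z k \<oplus> (\<ominus> \<one>) \<otimes> (u \<otimes> a k) = \<zero>"
  proof -
    have "z k = u" unfolding z_def by simp
    moreover have "a k \<in> carrier R" using a by simp
    ultimately show ?thesis using u(1) by algebra
  qed
  finally have "z \<in> syzygies (insert k A) a"
    unfolding syzygies_def using zc by (simp add: z_def)
  from koszul_relation_component[OF A a ann[OF this]] show ?thesis by (simp add: z_def)
qed

text \<open>
  A syzygy of the elements with index in \<open>A\<close> is a syzygy of all elements with coefficient \<open>0\<close> at \<open>k\<close>. The
  annihilator of the first homology for \<open>insert k A\<close> therefore carries the syzygies for \<open>A\<close> into
  \<open>a k\<close> times themselves up to Koszul relations, which prepares the Nakayama lemma.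
\<close>

lemma syzygy_annihilator_shift:
  assumes A: "finite A" "k \<notin> A" and a: "\<forall>i\<in>insert k A. a i \<in> carrier R"
    and r: "r \<in> carrier R"
    and ann: "\<And>z. z \<in> syzygies (insert k A) a \<Longrightarrow>
      (\<lambda>i. r \<otimes> z i) \<in> koszul_relations (insert k A) a"
    and z: "z \<in> syzygies A a"
  shows "\<exists>c\<in>syzygies A a. \<exists>b\<in>koszul_relations A a. \<forall>i. r \<otimes> z i = a k \<otimes> c i \<oplus> b i"
proof -
  have zc: "\<And>p. z p \<in> carrier R" and zo: "\<And>p. p \<notin> A \<Longrightarrow> z p = \<zero>"
    and zs: "(\<Oplus>p\<in>A. a p \<otimes> z p) = \<zero>" using z unfolding syzygies_def by auto
  have "(\<Oplus>i\<in>insert k A. a i \<otimes> z i) = a k \<otimes> z k \<oplus> (\<Oplus>i\<in>A. a i \<otimes> z i)"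
    using A a zc by (intro finsum_insert) auto
  then have "z \<in> syzygies (insert k A) a"
    unfolding syzygies_def using zc zo A(2) zs a by simp
  from koszul_relation_split[OF A a ann[OF this]] show ?thesis using zo[OF A(2)] r by simp
qed

section \<open>Chains of primes\<close>

inductive prime_chain :: "nat \<Rightarrow> 'a set \<Rightarrow> 'a set \<Rightarrow> bool" where
  prime_chain_0: "primeideal P R \<Longrightarrow> prime_chain 0 P P"
| prime_chain_Suc: "prime_chain n D Q \<Longrightarrow> primeideal P R \<Longrightarrow> Q \<subset> P \<Longrightarrow> prime_chain (Suc n) D P"

lemma prime_chain_top: "prime_chain n D P \<Longrightarrow> primeideal P R"
  by (induction rule: prime_chain.induct) auto

lemma prime_chain_bottom: "prime_chain n D P \<Longrightarrow> primeideal D R \<and> D \<subseteq> P"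
  by (induction rule: prime_chain.induct) auto

lemma prime_chain_of_function:
  assumes "\<forall>i\<le>n. primeideal (C i) R" "\<forall>i<n. C i \<subset> C (Suc i)"
  shows "prime_chain n (C (0::nat)) (C n)"
  using assms
proof (induction n)
  case 0
  then show ?case by (auto intro: prime_chain_0)
next
  case (Suc n)
  then have "prime_chain n (C 0) (C n)" by simp
  then show ?case by (rule prime_chain_Suc) (use Suc.prems in auto)
qed

lemma function_of_prime_chain:
  assumes "prime_chain n D P"
  shows "\<exists>C :: nat \<Rightarrow> 'a set. (\<forall>i\<le>n. primeideal (C i) R) \<and> (\<forall>i<n. C i \<subset> C (Suc i)) \<and> C n = P"
  using assms
proof (induction rule: prime_chain.induct)
  case (prime_chain_0 P)
  then show ?case by (intro exI[of _ "\<lambda>_. P"]) simp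
next
  case (prime_chain_Suc n D Q P)
  then obtain C where C: "\<forall>i\<le>n. primeideal (C i) R" "\<forall>i<n. C i \<subset> C (Suc i)" "C n = Q"
    by blast
  show ?case
    by (intro exI[of _ "C(Suc n := P)"]) (use C prime_chain_Suc in \<open>auto simp: le_Suc_eq less_Suc_eq\<close>)
qed

end

context noetherian_cring
begin

text \<open>
  Exactness of the localized Koszul complex in degree one makes the elements \<open>a i\<close> a regular sequence in
  the localization at \<open>P\<close>, whence \<open>P\<close> has height at least \<open>card A\<close>. Here the chain is built directly. For a
  chosen \<open>k\<close>, no product of a power of \<open>a k\<close> with an element outside \<open>P\<close> lies in the ideal of the other
  elements, so some prime \<open>Q \<subset> P\<close> contains the latter and omits \<open>a k\<close>. By the Nakayama lemma the complex
  of the other elements is exact at \<open>P\<close>, hence at \<open>Q\<close>, and the induction continues below \<open>Q\<close>.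
\<close>

lemma prime_chain_of_locally_exact_koszul:
  assumes "finite A" "primeideal P R" "a ` A \<subseteq> P" "r \<in> carrier R" "r \<notin> P"
    and "\<And>z. z \<in> syzygies A a \<Longrightarrow> (\<lambda>i. r \<otimes> z i) \<in> koszul_relations A a"
  shows "\<exists>D. prime_chain (card A) D P"
  using assms
proof (induction A arbitrary: P r rule: finite_induct)
  case empty
  then show ?case using prime_chain_0 by auto
next
  case (insert k A)
  note P = insert.prems(1) and Pi = prime_ideal[OF insert.prems(1)]
  have a: "\<forall>i\<in>insert k A. a i \<in> carrier R"
    using insert.prems(2) ideal_carrier[OF Pi] by blast
  have aA: "\<forall>i\<in>A. a i \<in> carrier R" using a by blast
  have aAs: "a ` A \<subseteq> carrier R" using aA by blast
  have Ki: "ideal (Idl (a ` A)) R" by (rule genideal_ideal[OF aAs])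
  have KP: "Idl (a ` A) \<subseteq> P" by (rule genideal_minimal[OF Pi]) (use insert.prems(2) in blast)
  have akP: "a k \<in> P" using insert.prems(2) by blast
  note akc = bspec[OF a insertI1]
  have avoid: "t \<otimes> a k [^] (j::nat) \<notin> Idl (a ` A)" if "t \<in> carrier R" "t \<notin> P" for t j
    using that
  proof (induction j arbitrary: t)
    case 0
    then show ?case using KP by auto
  next
    case (Suc j)
    show ?case
    proof
      assume "t \<otimes> a k [^] Suc j \<in> Idl (a ` A)"
      then have "(t \<otimes> a k [^] j) \<otimes> a k \<in> Idl (a ` A)" using Suc.prems akc by (simp add: m_assoc)
      then have "r \<otimes> (t \<otimes> a k [^] j) \<in> Idl (a ` A)"
        using colon_of_syzygy_annihilator[OF insert.hyps(1,2) a insert.prems(3) insert.prems(5)] akc Suc.prems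
        by simp
      then have "(r \<otimes> t) \<otimes> a k [^] j \<in> Idl (a ` A)"
        using insert.prems(3) Suc.prems akc by (simp add: m_assoc)
      then show False
        using Suc.IH[of "r \<otimes> t"] prime_mult_notin[OF P, of r t] insert.prems(3,4) Suc.prems by simp
    qed
  qed
  obtain Q where Q: "primeideal Q R" "Idl (a ` A) \<subseteq> Q" "Q \<subset> P"
    using prime_below_avoiding_element[OF Ki P akP avoid] by blast
  have "\<exists>t\<in>carrier R - P. \<forall>z\<in>syzygies A a. (\<lambda>i. t \<otimes> z i) \<in> koszul_relations A a"
  proof (rule nakayama_at_prime[OF P insert.hyps(1) submodule_syzygies[OF insert.hyps(1) aA] _
        submodule_koszul_relations[OF insert.hyps(1) aA]])
    show "\<forall>z\<in>syzygies A a. \<forall>i. i \<notin> A \<longrightarrow> z i = \<zero>" unfolding syzygies_def by blast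
    fix z assume "z \<in> syzygies A a"
    then show "\<exists>t\<in>carrier R - P. \<exists>p\<in>P. \<exists>c\<in>syzygies A a. \<exists>b\<in>koszul_relations A a.
        \<forall>i. t \<otimes> z i = p \<otimes> c i \<oplus> b i"
      using syzygy_annihilator_shift[OF insert.hyps(1,2) a insert.prems(3) insert.prems(5)] akP
        insert.prems(3,4) by blast
  qed
  then obtain t where t: "t \<in> carrier R" "t \<notin> P"
    "\<And>z. z \<in> syzygies A a \<Longrightarrow> (\<lambda>i. t \<otimes> z i) \<in> koszul_relations A a" by blast
  have "a ` A \<subseteq> Q" using genideal_self[OF aAs] Q(2) by blast
  then obtain D where "prime_chain (card A) D Q"
    using insert.IH[OF Q(1) _ t(1) _ t(3)] t(2) Q(3) by blast
  then have "prime_chain (Suc (card A)) D P" using P Q(3) by (rule prime_chain_Suc)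
  then show ?case using insert.hyps by auto
qed

end

section \<open>Krull's height theorem\<close>

context cring
begin

text \<open>
  The contraction to \<open>R\<close> of the extension of \<open>I\<close> to the localization at \<open>P\<close>.
\<close>

definition saturation :: "'a set \<Rightarrow> 'a set \<Rightarrow> 'a set" where
  "saturation P I = {x \<in> carrier R. \<exists>t\<in>carrier R - P. t \<otimes> x \<in> I}"

lemma saturation_ideal:
  assumes P: "primeideal P R" and I: "ideal I R"
  shows "ideal (saturation P I) R"
proof (rule idealI_cring)
  show "saturation P I \<subseteq> carrier R" unfolding saturation_def by blast
  show "\<zero> \<in> saturation P I"
    unfolding saturation_def using prime_not_one[OF P] ideal_zero[OF I] by force
  show "x \<oplus> y \<in> saturation P I" if xy: "x \<in> saturation P I" "y \<in> saturation P I" for x y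
  proof -
    obtain s t where *: "x \<in> carrier R" "y \<in> carrier R" "s \<in> carrier R" "s \<notin> P" "s \<otimes> x \<in> I"
      "t \<in> carrier R" "t \<notin> P" "t \<otimes> y \<in> I" using xy unfolding saturation_def by auto
    have "(s \<otimes> t) \<otimes> (x \<oplus> y) = t \<otimes> (s \<otimes> x) \<oplus> s \<otimes> (t \<otimes> y)" using *(1-3,6) by algebra
    also have "\<dots> \<in> I" using * by (simp add: ideal_add[OF I] ideal_mult[OF I])
    finally show ?thesis unfolding saturation_def using * prime_mult_notin[OF P, of s t] by blast
  qed
  show "r \<otimes> x \<in> saturation P I" if r: "r \<in> carrier R" and x: "x \<in> saturation P I" for r x
  proof -
    obtain t where *: "x \<in> carrier R" "t \<in> carrier R" "t \<notin> P" "t \<otimes> x \<in> I"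
      using x unfolding saturation_def by auto
    have "t \<otimes> (r \<otimes> x) = r \<otimes> (t \<otimes> x)" using * r by (simp add: m_lcomm)
    also have "\<dots> \<in> I" using * r by (simp add: ideal_mult[OF I])
    finally show ?thesis unfolding saturation_def using * r by blast
  qed
qed

lemma saturation_superset:
  assumes "primeideal P R" "ideal I R" shows "I \<subseteq> saturation P I"
proof
  fix x assume x: "x \<in> I"
  then have "\<one> \<otimes> x \<in> I" using ideal_carrier[OF assms(2)] by simp
  then show "x \<in> saturation P I"
    unfolding saturation_def using prime_not_one[OF assms(1)] x ideal_carrier[OF assms(2)] by blast
qed

lemma saturation_mono: "I \<subseteq> J \<Longrightarrow> saturation P I \<subseteq> saturation P J"
  unfolding saturation_def by blast

lemma saturation_saturated:
  assumes P: "primeideal P R" and x: "x \<in> carrier R" and t: "t \<in> carrier R" "t \<notin> P"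
    and tx: "t \<otimes> x \<in> saturation P I"
  shows "x \<in> saturation P I"
proof -
  obtain s where s: "s \<in> carrier R" "s \<notin> P" "s \<otimes> (t \<otimes> x) \<in> I"
    using tx unfolding saturation_def by auto
  have "(s \<otimes> t) \<otimes> x \<in> I" using s x t by (simp add: m_assoc)
  then show ?thesis unfolding saturation_def
    using prime_mult_notin[OF P, of s t] s t x by blast
qed

text \<open>
  The ideals that arise from \<open>X\<close> by finitely many steps, each of which adds a quotient that is zero or a
  one-dimensional residue space locally at \<open>P\<close>. Hence \<open>G\<close> modulo \<open>X\<close> has finite length locally.
\<close>

inductive simple_extensions :: "'a set \<Rightarrow> 'a set \<Rightarrow> 'a set \<Rightarrow> bool" for P X where
  simple_extensions_base: "simple_extensions P X X"
| simple_extensions_step: "simple_extensions P X G \<Longrightarrow> g \<in> carrier R \<Longrightarrow>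
    \<forall>p\<in>P. p \<otimes> g \<in> saturation P G \<Longrightarrow> simple_extensions P X (G <+>\<^bsub>R\<^esub> PIdl g)"

lemma simple_extensions_ideal:
  "simple_extensions P X G \<Longrightarrow> ideal X R \<Longrightarrow> ideal G R \<and> X \<subseteq> G"
  by (induction rule: simple_extensions.induct) (auto intro: ideal_add_PIdl subset_add_PIdl[THEN subsetD])

text \<open>
  The descending chain condition in finite length. In a step from \<open>G\<close> to \<open>G + (g)\<close> the only new information
  about \<open>A n\<close> is whether it contains a member of \<open>G + c g\<close> with \<open>c \<notin> P\<close>. This property can only be lost
  when \<open>n\<close> grows, so it is eventually constant.
\<close>

lemma descending_chain_stable_on_simple_extensions:
  fixes A :: "nat \<Rightarrow> 'a set"
  assumes P: "primeideal P R" and X: "ideal X R"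
    and A: "\<And>n. ideal (A n) R" "\<And>n. X \<subseteq> A n" "\<And>m n. m \<le> n \<Longrightarrow> A n \<subseteq> A m"
    and sat: "\<And>n x t. x \<in> carrier R \<Longrightarrow> t \<in> carrier R \<Longrightarrow> t \<notin> P \<Longrightarrow> t \<otimes> x \<in> A n \<Longrightarrow> x \<in> A n"
    and G: "simple_extensions P X G"
  shows "\<exists>N. \<forall>n\<ge>N. A N \<inter> G \<subseteq> A n"
  using G
proof (induction rule: simple_extensions.induct)
  case simple_extensions_base
  then show ?case using A(2) by blast
next
  case (simple_extensions_step G g)
  have Gi: "ideal G R" using simple_extensions_ideal simple_extensions_step(1) X by blast
  note gc = simple_extensions_step(2)
  obtain N where N: "\<And>n. n \<ge> N \<Longrightarrow> A N \<inter> G \<subseteq> A n" using simple_extensions_step by blast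
  define meets where "meets n \<longleftrightarrow> (\<exists>c\<in>carrier R - P. \<exists>h\<in>G. h \<oplus> c \<otimes> g \<in> A n)" for n
  obtain M where M: "M \<ge> N" "\<And>n. n \<ge> M \<Longrightarrow> meets M \<Longrightarrow> meets n"
  proof (cases "\<forall>n. meets n")
    case False
    then obtain m where m: "\<not> meets m" by blast
    have "\<not> meets (max m N)"
      using m A(3)[of m "max m N"] unfolding meets_def by (meson max.cobounded1 subsetD)
    then show ?thesis using that[of "max m N"] by auto
  qed (use that in auto)
  have "A M \<inter> (G <+>\<^bsub>R\<^esub> PIdl g) \<subseteq> A n" if n: "n \<ge> M" for n
  proof
    fix a assume a: "a \<in> A M \<inter> (G <+>\<^bsub>R\<^esub> PIdl g)"
    then obtain h c where hc: "h \<in> G" "c \<in> carrier R" "a = h \<oplus> c \<otimes> g"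
      unfolding Int_iff mem_add_PIdl by blast
    have ac: "a \<in> carrier R" using a ideal_carrier[OF A(1)] by blast
    have hcc: "h \<in> carrier R" using hc(1) ideal_carrier[OF Gi] by blast
    have AMN: "A M \<subseteq> A N" using A(3) M(1) by blast
    have key: "x \<in> A n" if "x \<in> A M" "x \<in> G" for x using N[of n] n M(1) AMN that by fastforce
    show "a \<in> A n"
    proof (cases "c \<in> P")
      case True
      then have "c \<otimes> g \<in> saturation P G" using simple_extensions_step(3) by blast
      then have "a \<in> saturation P G"
        using ideal_add[OF saturation_ideal[OF P Gi]] saturation_superset[OF P Gi] hc by blast
      then obtain t where t: "t \<in> carrier R" "t \<notin> P" "t \<otimes> a \<in> G" unfolding saturation_def by blast
      have "t \<otimes> a \<in> A M" using a ideal_mult[OF A(1)] t by blast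
      then show ?thesis using key t sat ac by blast
    next
      case False
      then have "meets M" unfolding meets_def using hc a by blast
      then obtain c' h' where c': "c' \<in> carrier R" "c' \<notin> P" "h' \<in> G" "h' \<oplus> c' \<otimes> g \<in> A n"
        using M(2)[OF n] unfolding meets_def by blast
      have h'c: "h' \<in> carrier R" using c'(3) ideal_carrier[OF Gi] by blast
      define b where "b = h' \<oplus> c' \<otimes> g"
      have bn: "b \<in> A n" using c' unfolding b_def by simp
      have bM: "b \<in> A M" using bn A(3)[OF n] by blast
      have bc: "b \<in> carrier R" using bn ideal_carrier[OF A(1)] by blast
      have "c' \<otimes> a \<ominus> c \<otimes> b = c' \<otimes> h \<ominus> c \<otimes> h'"
        unfolding hc(3) b_def using hc(2) hcc h'c c'(1) gc by algebra
      also have "\<dots> \<in> G" using hc c' by (simp add: ideal_diff[OF Gi] ideal_mult[OF Gi])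
      finally have "c' \<otimes> a \<ominus> c \<otimes> b \<in> G" .
      moreover have "c' \<otimes> a \<ominus> c \<otimes> b \<in> A M"
        using a bM c'(1) hc(2) by (simp add: ideal_diff[OF A(1)] ideal_mult[OF A(1)])
      ultimately have "c' \<otimes> a \<ominus> c \<otimes> b \<in> A n" using key by blast
      then have "(c' \<otimes> a \<ominus> c \<otimes> b) \<oplus> c \<otimes> b \<in> A n"
        using ideal_add[OF A(1)] ideal_mult[OF A(1) bn hc(2)] by blast
      also have "(c' \<otimes> a \<ominus> c \<otimes> b) \<oplus> c \<otimes> b = c' \<otimes> a" using c'(1) ac hc(2) bc by algebra
      finally show ?thesis using sat ac c'(1,2) by blast
    qed
  qed
  then show ?case by blast
qed

end

context noetherian_cring
begin

text \<open>
  Locally at \<open>P\<close> the whole ring has finite length modulo \<open>X\<close>, since \<open>P\<close> is nilpotent modulo \<open>X\<close> there.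
  An ideal that is maximal among the simple extensions cannot lie in \<open>P\<close>, as a socle element of the ring
  modulo its saturation would extend it.
\<close>

lemma simple_extensions_reach_outside:
  assumes P: "primeideal P R" and X: "ideal X R"
    and nil: "\<And>p. p \<in> P \<Longrightarrow> \<exists>t\<in>carrier R - P. \<exists>j::nat. t \<otimes> p [^] j \<in> X"
  shows "\<exists>G. simple_extensions P X G \<and> \<not> G \<subseteq> P"
proof -
  define F where "F = Collect (simple_extensions P X)"
  have "F \<noteq> {}" unfolding F_def using simple_extensions_base by blast
  moreover have FI: "\<And>G. G \<in> F \<Longrightarrow> ideal G R"
    unfolding F_def using simple_extensions_ideal X by blast
  ultimately obtain G where G: "G \<in> F" and max: "\<And>L. L \<in> F \<Longrightarrow> G \<subseteq> L \<Longrightarrow> L = G"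
    using maximal_ideal_in_family[of F] by metis
  have Gi: "ideal G R" using FI G by blast
  have XG: "X \<subseteq> G" using G simple_extensions_ideal X unfolding F_def by blast
  have "\<not> G \<subseteq> P"
  proof
    assume GP: "G \<subseteq> P"
    have "\<one> \<notin> saturation P G"
      unfolding saturation_def using GP by auto
    then have "\<not> carrier R \<subseteq> saturation P G" by blast
    moreover have "\<exists>j::nat. p [^] j \<in> saturation P G" if "p \<in> P" for p
      using nil[OF that] XG ideal_carrier[OF prime_ideal[OF P] that] unfolding saturation_def by blast
    moreover have "P \<subseteq> carrier R" using ideal_carrier[OF prime_ideal[OF P]] by blast
    ultimately obtain g where g: "g \<in> carrier R - saturation P G" "\<forall>p\<in>P. p \<otimes> g \<in> saturation P G"
      using socle_element[OF saturation_ideal[OF P Gi] oneideal, of P] by blast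
    have "G <+>\<^bsub>R\<^esub> PIdl g \<in> F"
      using G g simple_extensions_step unfolding F_def by blast
    then have "G <+>\<^bsub>R\<^esub> PIdl g = G" using max subset_add_PIdl[OF Gi] g(1) by blast
    then have "g \<in> G" using gen_in_add_PIdl[OF Gi] g(1) by blast
    then show False using g(1) saturation_superset[OF P Gi] by blast
  qed
  then show ?thesis using G unfolding F_def by blast
qed

text \<open>
  Krull's principal ideal theorem in the form: a prime that is minimal over \<open>D + (x)\<close> has no prime
  strictly between itself and \<open>D\<close>. If it failed, every element of \<open>P\<close> would be nilpotent modulo \<open>D + (x)\<close>
  locally at \<open>P\<close>, so that descending chains of ideals above \<open>D + (x)\<close> become stationary there. This applies
  to the ideals \<open>A n + (x)\<close>, where \<open>A n\<close> is the contraction of \<open>D + (y [^] n)\<close> from the localization at \<open>Q\<close>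
  for some \<open>y \<in> Q - D\<close>. As \<open>x \<notin> Q\<close>, stationarity and the Nakayama lemma give \<open>A N = A (Suc N)\<close> locally at
  \<open>P\<close>, and then \<open>y [^] N\<close> would be a multiple of \<open>y [^] Suc N\<close> modulo \<open>D\<close> locally at \<open>Q\<close>, which is
  impossible in a domain in which \<open>y\<close> is neither zero nor a unit.
\<close>

theorem krull_principal_ideal:
  assumes D: "primeideal D R" and Q: "primeideal Q R" and P: "primeideal P R"
    and sub: "D \<subset> Q" "Q \<subset> P" and x: "x \<in> P"
  shows "\<exists>C. primeideal C R \<and> D \<subseteq> C \<and> x \<in> C \<and> C \<subset> P"
proof (cases "x \<in> Q")
  case True
  then show ?thesis using Q sub by blast
next
  case xQ: False
  note Pi = prime_ideal[OF P] and Di = prime_ideal[OF D] and Qi = prime_ideal[OF Q]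
  have xc: "x \<in> carrier R" using x ideal_carrier[OF Pi] by blast
  obtain y where y: "y \<in> Q" "y \<notin> D" using sub by blast
  have yc: "y \<in> carrier R" using y ideal_carrier[OF Qi] by blast
  define X where "X = D <+>\<^bsub>R\<^esub> PIdl x"
  have Xi: "ideal X R" unfolding X_def by (rule ideal_add_PIdl[OF Di xc])
  show ?thesis
  proof (rule ccontr)
    assume no: "\<not> ?thesis"
    have "\<exists>t\<in>carrier R - P. \<exists>j::nat. t \<otimes> p [^] j \<in> X" if p: "p \<in> P" for p
    proof (rule ccontr)
      assume "\<not> ?thesis"
      then obtain C where "primeideal C R" "X \<subseteq> C" "C \<subset> P"
        using prime_below_avoiding_element[OF Xi P p] by blast
      then show False using no subset_add_PIdl[OF Di xc] gen_in_add_PIdl[OF Di xc]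
        unfolding X_def by blast
    qed
    then obtain G where G: "simple_extensions P X G" "\<not> G \<subseteq> P"
      using simple_extensions_reach_outside[OF P Xi] by blast
    have Gi: "ideal G R" using simple_extensions_ideal G Xi by blast
    obtain s where s: "s \<in> G" "s \<notin> P" "s \<in> carrier R" using G(2) ideal_carrier[OF Gi] by blast
    \<comment> \<open>Up to contraction these are the powers of \<open>y\<close> in the localization of the quotient by \<open>D\<close> at \<open>Q\<close>.\<close>
    define A where "A n = saturation Q (D <+>\<^bsub>R\<^esub> PIdl (y [^] (n::nat)))" for n
    have Ji: "ideal (D <+>\<^bsub>R\<^esub> PIdl (y [^] n)) R" for n :: nat
      by (rule ideal_add_PIdl[OF Di]) (simp add: yc)
    have Ai: "ideal (A n) R" for n unfolding A_def by (rule saturation_ideal[OF Q Ji])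
    have DA: "D \<subseteq> A n" for n
      unfolding A_def using saturation_superset[OF Q Ji] subset_add_PIdl[OF Di, of "y [^] n"] yc by auto
    have yA: "y [^] n \<in> A n" for n :: nat
      unfolding A_def using saturation_superset[OF Q Ji] gen_in_add_PIdl[OF Di, of "y [^] n"] yc by auto
    have Adec: "A n \<subseteq> A m" if "m \<le> n" for m n
    proof -
      have "y [^] n = y [^] (n - m) \<otimes> y [^] m" using yc that by (simp add: nat_pow_mult)
      then have "y [^] n \<in> D <+>\<^bsub>R\<^esub> PIdl (y [^] m)"
        using ideal_mult[OF Ji gen_in_add_PIdl[OF Di, of "y [^] m"]] yc by simp
      then have "D <+>\<^bsub>R\<^esub> PIdl (y [^] n) \<subseteq> D <+>\<^bsub>R\<^esub> PIdl (y [^] m)"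
        using subset_add_PIdl[OF Di, of "y [^] m"] yc by (intro add_PIdl_minimal[OF Ji]) auto
      then show ?thesis unfolding A_def by (rule saturation_mono)
    qed
    define B where "B n = saturation P (A n <+>\<^bsub>R\<^esub> PIdl x)" for n
    have Ki: "ideal (A n <+>\<^bsub>R\<^esub> PIdl x) R" for n by (rule ideal_add_PIdl[OF Ai xc])
    have Bi: "ideal (B n) R" for n unfolding B_def by (rule saturation_ideal[OF P Ki])
    have XB: "X \<subseteq> B n" for n
    proof -
      have "X \<subseteq> A n <+>\<^bsub>R\<^esub> PIdl x" unfolding X_def
        using DA subset_add_PIdl[OF Ai xc] gen_in_add_PIdl[OF Ai xc]
        by (intro add_PIdl_minimal[OF Ki]) blast+
      then show ?thesis unfolding B_def using saturation_superset[OF P Ki] by blast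
    qed
    have Bdec: "B n \<subseteq> B m" if "m \<le> n" for m n
    proof -
      have "A n <+>\<^bsub>R\<^esub> PIdl x \<subseteq> A m <+>\<^bsub>R\<^esub> PIdl x"
        using Adec[OF that] subset_add_PIdl[OF Ai xc] gen_in_add_PIdl[OF Ai xc]
        by (intro add_PIdl_minimal[OF Ki]) blast+
      then show ?thesis unfolding B_def by (rule saturation_mono)
    qed
    have Bsat: "a \<in> B n" if "a \<in> carrier R" "t \<in> carrier R" "t \<notin> P" "t \<otimes> a \<in> B n" for a t n
      using saturation_saturated[OF P that(1-3)] that(4) unfolding B_def by blast
    have "\<exists>N. \<forall>n\<ge>N. B N \<inter> G \<subseteq> B n"
      by (rule descending_chain_stable_on_simple_extensions[where A = B, OF P Xi Bi XB _ _ G(1)])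
        (use Bdec Bsat in blast)+
    then obtain N where N: "\<And>n. n \<ge> N \<Longrightarrow> B N \<inter> G \<subseteq> B n" by blast
    have step: "\<exists>t\<in>carrier R - P. \<exists>q\<in>A N. \<exists>b\<in>A (Suc N). t \<otimes> a = x \<otimes> q \<oplus> b" if a: "a \<in> A N" for a
    proof -
      have ac: "a \<in> carrier R" using a ideal_carrier[OF Ai] by blast
      have "a \<in> B N" unfolding B_def
        using a saturation_superset[OF P Ki] subset_add_PIdl[OF Ai xc] by blast
      then have "s \<otimes> a \<in> B N \<inter> G" using ideal_mult[OF Bi] ideal_mult'[OF Gi s(1)] s(3) ac by blast
      then have "s \<otimes> a \<in> B (Suc N)" using N[of "Suc N"] by auto
      then have "a \<in> B (Suc N)" using Bsat[OF ac] s by blast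
      then obtain t where t: "t \<in> carrier R" "t \<notin> P" "t \<otimes> a \<in> A (Suc N) <+>\<^bsub>R\<^esub> PIdl x"
        unfolding B_def saturation_def by blast
      then obtain b q where bq: "b \<in> A (Suc N)" "q \<in> carrier R" "t \<otimes> a = b \<oplus> q \<otimes> x"
        unfolding mem_add_PIdl by blast
      have bc: "b \<in> carrier R" using bq(1) ideal_carrier[OF Ai] by blast
      have "b \<in> A N" using bq(1) Adec[of N "Suc N"] by auto
      moreover have "q \<otimes> x \<oplus> b \<in> A N"
        using ideal_mult[OF Ai a t(1)] bq bc xc by (simp add: a_comm)
      ultimately have "q \<otimes> x \<in> A N" using ideal_cancel[OF Ai] bq(2) xc by simp
      then have "x \<otimes> q \<in> A N" using bq(2) xc by (simp add: m_comm)
      then have "q \<in> A N"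
        using saturation_saturated[OF Q bq(2) xc xQ] unfolding A_def by blast
      moreover have "t \<otimes> a = x \<otimes> q \<oplus> b" using bq bc xc by (simp add: a_comm m_comm)
      ultimately show ?thesis using t bq(1) by blast
    qed
    \<comment> \<open>The Nakayama lemma speaks of functions, so ideals are passed to it as functions on a one-point type.\<close>
    define Z where "Z I = {z :: unit \<Rightarrow> 'a. z () \<in> I}" for I :: "'a set"
    have Zs: "submodule_of_functions (Z I)" if I: "ideal I R" for I
      unfolding submodule_of_functions_def Z_def
      using ideal_carrier[OF I] ideal_zero[OF I] ideal_add[OF I] ideal_mult[OF I] by auto
    have "\<exists>t\<in>carrier R - P. \<forall>z\<in>Z (A N). (\<lambda>i. t \<otimes> z i) \<in> Z (A (Suc N))"
    proof (rule nakayama_at_prime[OF P _ Zs[OF Ai] _ Zs[OF Ai]])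
      show "finite (UNIV :: unit set)" by simp
      fix z assume "z \<in> Z (A N)"
      then obtain t q b where tqb: "t \<in> carrier R - P" "q \<in> A N" "b \<in> A (Suc N)" "t \<otimes> z () = x \<otimes> q \<oplus> b"
        using step[of "z ()"] unfolding Z_def by auto
      then show "\<exists>t\<in>carrier R - P. \<exists>p\<in>P. \<exists>c\<in>Z (A N). \<exists>b\<in>Z (A (Suc N)). \<forall>i. t \<otimes> z i = p \<otimes> c i \<oplus> b i"
        unfolding Z_def using x
        by (intro bexI[of _ t] bexI[of _ x] bexI[of _ "\<lambda>_. q"] bexI[of _ "\<lambda>_. b"]) auto
    qed simp
    then obtain t where t: "t \<in> carrier R" "t \<notin> P" "\<And>z. z \<in> Z (A N) \<Longrightarrow> (\<lambda>i. t \<otimes> z i) \<in> Z (A (Suc N))"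
      by blast
    have "t \<otimes> y [^] N \<in> A (Suc N)" using t(3)[of "\<lambda>_. y [^] N"] yA unfolding Z_def by simp
    then obtain u where u: "u \<in> carrier R" "u \<notin> Q" "u \<otimes> (t \<otimes> y [^] N) \<in> D <+>\<^bsub>R\<^esub> PIdl (y [^] Suc N)"
      unfolding A_def saturation_def by blast
    then obtain d c where dc: "d \<in> D" "c \<in> carrier R" "u \<otimes> (t \<otimes> y [^] N) = d \<oplus> c \<otimes> y [^] Suc N"
      unfolding mem_add_PIdl by blast
    have dcc: "d \<in> carrier R" using dc(1) ideal_carrier[OF Di] by blast
    have "y [^] N \<otimes> (u \<otimes> t \<ominus> c \<otimes> y) = u \<otimes> (t \<otimes> y [^] N) \<ominus> c \<otimes> (y [^] N \<otimes> y)"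
      using u(1) t(1) dc(2) yc nat_pow_closed[OF yc, of N] by algebra
    also have "\<dots> = d"
      using dc(2,3) dcc yc nat_pow_closed[OF yc, of "Suc N"] by (simp add: minus_eq a_assoc r_neg)
    finally have "y [^] N \<otimes> (u \<otimes> t \<ominus> c \<otimes> y) \<in> D" using dc(1) by simp
    then have "u \<otimes> t \<ominus> c \<otimes> y \<in> D"
      using primeideal.I_prime[OF D, of "y [^] N" "u \<otimes> t \<ominus> c \<otimes> y"] prime_pow_mem[OF D yc, of N] y(2)
        u(1) t(1) dc(2) yc by auto
    then have "u \<otimes> t \<ominus> c \<otimes> y \<in> Q" using sub by blast
    then have "(u \<otimes> t \<ominus> c \<otimes> y) \<oplus> c \<otimes> y \<in> Q"
      using ideal_add[OF Qi] ideal_mult[OF Qi y(1) dc(2)] by blast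
    also have "(u \<otimes> t \<ominus> c \<otimes> y) \<oplus> c \<otimes> y = u \<otimes> t" using u(1) t(1) dc(2) yc by algebra
    finally have "u \<otimes> t \<in> Q" .
    moreover have "t \<notin> Q" using t(2) sub by blast
    ultimately show False using prime_mult_notin[OF Q u(1) t(1) u(2)] by blast
  qed
qed

text \<open>
  The principal ideal theorem replaces the members of the chain from the top downwards by primes that
  contain \<open>x\<close>, at the cost of the bottom prime.
\<close>

lemma prime_chain_through_element:
  assumes "prime_chain (Suc k) D P" "x \<in> P"
  shows "\<exists>D'. prime_chain k D' P \<and> D \<subseteq> D' \<and> x \<in> D'"
  using assms
proof (induction k arbitrary: P)
  case 0
  then have "primeideal P R" "D \<subseteq> P" using prime_chain_top prime_chain_bottom by blast+
  then show ?case using 0(2) prime_chain_0 by blast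
next
  case (Suc k)
  from Suc.prems(1) obtain Q where Q: "prime_chain (Suc k) D Q" "primeideal P R" "Q \<subset> P"
    by (cases rule: prime_chain.cases) auto
  from Q(1) obtain Q' where Q': "prime_chain k D Q'" "primeideal Q R" "Q' \<subset> Q"
    by (cases rule: prime_chain.cases) auto
  obtain C where C: "primeideal C R" "Q' \<subseteq> C" "x \<in> C" "C \<subset> P" "prime_chain (Suc k) D C"
  proof (cases "x \<in> Q")
    case True
    then show ?thesis using that[of Q] Q Q' by blast
  next
    case False
    obtain C where C: "primeideal C R" "Q' \<subseteq> C" "x \<in> C" "C \<subset> P"
      using krull_principal_ideal[OF prime_chain_top[OF Q'(1)] Q'(2) Q(2) Q'(3) Q(3) Suc.prems(2)] by blast
    moreover have "Q' \<subset> C" using C False Q'(3) by blast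
    ultimately show ?thesis using that prime_chain_Suc[OF Q'(1)] by blast
  qed
  obtain D' where "prime_chain k D' C" "D \<subseteq> D'" "x \<in> D'" using Suc.IH[OF C(5,3)] by blast
  then show ?case using prime_chain_Suc[OF _ Q(2) C(4)] by blast
qed

text \<open>
  Each generator is moved into the lower end of the chain, which shortens the chain by one; when all
  generators are used up, minimality leaves a chain of length \<open>0\<close>.
\<close>

theorem krull_height:
  assumes "prime_chain k D P" "K \<subseteq> D" "set xs \<subseteq> P"
    and "\<And>C. primeideal C R \<Longrightarrow> K \<union> set xs \<subseteq> C \<Longrightarrow> C \<subseteq> P \<Longrightarrow> C = P"
  shows "k \<le> length xs"
  using assms
proof (induction xs arbitrary: k D K)
  case Nil
  have "D = P" using Nil prime_chain_bottom[OF Nil.prems(1)] by auto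
  with Nil.prems(1) show ?case
    by (cases rule: prime_chain.cases) (use prime_chain_bottom in blast)+
next
  case (Cons x xs)
  show ?case
  proof (cases k)
    case (Suc k')
    obtain D' where D': "prime_chain k' D' P" "D \<subseteq> D'" "x \<in> D'"
      using prime_chain_through_element[of k' D P x] Cons.prems Suc by auto
    have "k' \<le> length xs"
      by (rule Cons.IH[OF D'(1), of "insert x K"]) (use D' Cons.prems in auto)
    then show ?thesis using Suc by simp
  qed simp
qed

end

section \<open>Integrality over an ideal\<close>

context cring
begin

lemma ideal_power_ideal: "ideal I R \<Longrightarrow> ideal (I [^]\<^bsub>ideals_set R\<^esub> (n::nat)) R"
  using monoid.nat_pow_closed[OF comm_monoid.axioms(1)[OF ideals_set_is_comm_monoid], of I n]
  unfolding ideals_set_def by simp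

lemma ideal_power_mult:
  assumes I: "ideal I R"
    and x: "x \<in> I [^]\<^bsub>ideals_set R\<^esub> (m::nat)" and y: "y \<in> I [^]\<^bsub>ideals_set R\<^esub> (n::nat)"
  shows "x \<otimes> y \<in> I [^]\<^bsub>ideals_set R\<^esub> (m + n)"
proof -
  have "I [^]\<^bsub>ideals_set R\<^esub> m \<otimes>\<^bsub>ideals_set R\<^esub> I [^]\<^bsub>ideals_set R\<^esub> n = I [^]\<^bsub>ideals_set R\<^esub> (m + n)"
    using monoid.nat_pow_mult[OF comm_monoid.axioms(1)[OF ideals_set_is_comm_monoid], of I m n] I
    by (simp add: ideals_set_def)
  moreover have "x \<otimes> y \<in> I [^]\<^bsub>ideals_set R\<^esub> m \<otimes>\<^bsub>ideals_set R\<^esub> I [^]\<^bsub>ideals_set R\<^esub> n"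
    using ideal_prod.prod[OF x y, of R] by (simp add: ideals_set_def)
  ultimately show ?thesis by simp
qed

text \<open>
  The possible lower terms \<open>c 1 \<otimes> r [^] (d - 1) \<oplus> \<dots> \<oplus> c d\<close> with \<open>c i\<close> in the \<open>i\<close>-th power of \<open>I\<close> of an
  equation of integral dependence of degree \<open>d\<close>, in Horner form.
\<close>

primrec lower_terms :: "'a set \<Rightarrow> 'a \<Rightarrow> nat \<Rightarrow> 'a set" where
  "lower_terms I r 0 = {\<zero>}"
| "lower_terms I r (Suc d) = {r \<otimes> h \<oplus> c | h c. h \<in> lower_terms I r d \<and> c \<in> I [^]\<^bsub>ideals_set R\<^esub> Suc d}"

lemma lower_terms_SucI:
  "h \<in> lower_terms I r d \<Longrightarrow> c \<in> I [^]\<^bsub>ideals_set R\<^esub> Suc d \<Longrightarrow> r \<otimes> h \<oplus> c \<in> lower_terms I r (Suc d)"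
  by auto

lemma lower_terms_SucE:
  assumes "g \<in> lower_terms I r (Suc d)"
  obtains h c where "h \<in> lower_terms I r d" "c \<in> I [^]\<^bsub>ideals_set R\<^esub> Suc d" "g = r \<otimes> h \<oplus> c"
  using assms by auto

lemma lower_terms_ideal:
  assumes I: "ideal I R" and r: "r \<in> carrier R"
  shows "ideal (lower_terms I r d) R"
proof (induction d)
  case 0
  then show ?case by (simp add: zeroideal)
next
  case (Suc d)
  note J = ideal_power_ideal[OF I, of "Suc d"]
  show ?case
  proof (rule idealI_cring)
    show "lower_terms I r (Suc d) \<subseteq> carrier R"
      using ideal_carrier[OF Suc] ideal_carrier[OF J] r by (auto elim!: lower_terms_SucE simp del: lower_terms.simps)
    show "\<zero> \<in> lower_terms I r (Suc d)"
      using lower_terms_SucI[OF ideal_zero[OF Suc] ideal_zero[OF J]] r by simp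
    show "x \<oplus> y \<in> lower_terms I r (Suc d)"
      if x: "x \<in> lower_terms I r (Suc d)" and y: "y \<in> lower_terms I r (Suc d)" for x y
    proof -
      obtain h c where hc: "h \<in> lower_terms I r d" "c \<in> I [^]\<^bsub>ideals_set R\<^esub> Suc d" "x = r \<otimes> h \<oplus> c"
        using x by (rule lower_terms_SucE)
      obtain h' c' where hc': "h' \<in> lower_terms I r d" "c' \<in> I [^]\<^bsub>ideals_set R\<^esub> Suc d" "y = r \<otimes> h' \<oplus> c'"
        using y by (rule lower_terms_SucE)
      have "x \<oplus> y = r \<otimes> (h \<oplus> h') \<oplus> (c \<oplus> c')"
        unfolding hc(3) hc'(3)
        using ideal_carrier[OF Suc hc(1)] ideal_carrier[OF Suc hc'(1)]
          ideal_carrier[OF J hc(2)] ideal_carrier[OF J hc'(2)] r by algebra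
      then show ?thesis
        using lower_terms_SucI[OF ideal_add[OF Suc hc(1) hc'(1)] ideal_add[OF J hc(2) hc'(2)]] by metis
    qed
    show "s \<otimes> x \<in> lower_terms I r (Suc d)" if s: "s \<in> carrier R" and x: "x \<in> lower_terms I r (Suc d)" for s x
    proof -
      obtain h c where hc: "h \<in> lower_terms I r d" "c \<in> I [^]\<^bsub>ideals_set R\<^esub> Suc d" "x = r \<otimes> h \<oplus> c"
        using x by (rule lower_terms_SucE)
      have "s \<otimes> x = r \<otimes> (s \<otimes> h) \<oplus> s \<otimes> c"
        unfolding hc(3) using ideal_carrier[OF Suc hc(1)] ideal_carrier[OF J hc(2)] r s by algebra
      then show ?thesis
        using lower_terms_SucI[OF ideal_mult[OF Suc hc(1) s] ideal_mult[OF J hc(2) s]] by metis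
    qed
  qed
qed

lemma times_lower_terms:
  assumes I: "ideal I R" and r: "r \<in> carrier R" and h: "h \<in> lower_terms I r d"
  shows "r \<otimes> h \<in> lower_terms I r (Suc d)"
  using lower_terms_SucI[OF h ideal_zero[OF ideal_power_ideal[OF I]]]
    ideal_carrier[OF lower_terms_ideal[OF I r] h] r by simp

lemma power_times_lower_terms:
  assumes I: "ideal I R" and r: "r \<in> carrier R" and h: "h \<in> lower_terms I r e"
  shows "r [^] d \<otimes> h \<in> lower_terms I r (d + e)"
proof (induction d)
  case 0
  then show ?case using h ideal_carrier[OF lower_terms_ideal[OF I r] h] by simp
next
  case (Suc d)
  have "r [^] Suc d \<otimes> h = r \<otimes> (r [^] d \<otimes> h)"
    using r ideal_carrier[OF lower_terms_ideal[OF I r] h] by (simp add: m_ac)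
  then show ?case using times_lower_terms[OF I r Suc] by simp
qed

lemma ideal_power_times_lower_terms:
  assumes I: "ideal I R" and r: "r \<in> carrier R"
    and c: "c \<in> I [^]\<^bsub>ideals_set R\<^esub> m" and g: "g \<in> lower_terms I r e"
  shows "c \<otimes> g \<in> lower_terms I r (m + e)"
  using g
proof (induction e arbitrary: g)
  case 0
  then show ?case
    using ideal_zero[OF lower_terms_ideal[OF I r]] ideal_carrier[OF ideal_power_ideal[OF I] c] by simp
next
  case (Suc e)
  obtain h c' where hc: "h \<in> lower_terms I r e" "c' \<in> I [^]\<^bsub>ideals_set R\<^esub> Suc e" "g = r \<otimes> h \<oplus> c'"
    using Suc.prems by (rule lower_terms_SucE)
  have "c \<otimes> g = r \<otimes> (c \<otimes> h) \<oplus> c \<otimes> c'"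
    unfolding hc(3) using ideal_carrier[OF lower_terms_ideal[OF I r] hc(1)] r
      ideal_carrier[OF ideal_power_ideal[OF I] hc(2)] ideal_carrier[OF ideal_power_ideal[OF I] c]
    by algebra
  moreover have "r \<otimes> (c \<otimes> h) \<oplus> c \<otimes> c' \<in> lower_terms I r (Suc (m + e))"
    using lower_terms_SucI[OF Suc.IH[OF hc(1)]] ideal_power_mult[OF I c hc(2)] by (metis add_Suc_right)
  ultimately show ?case by (metis add_Suc_right)
qed

lemma lower_terms_mult:
  assumes I: "ideal I R" and r: "r \<in> carrier R"
    and g: "g \<in> lower_terms I r d" and h: "h \<in> lower_terms I r e"
  shows "g \<otimes> h \<in> lower_terms I r (d + e)"
  using g
proof (induction d arbitrary: g)
  case 0
  then show ?case
    using ideal_zero[OF lower_terms_ideal[OF I r]] ideal_carrier[OF lower_terms_ideal[OF I r] h] by simp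
next
  case (Suc d)
  obtain g' c where gc: "g' \<in> lower_terms I r d" "c \<in> I [^]\<^bsub>ideals_set R\<^esub> Suc d" "g = r \<otimes> g' \<oplus> c"
    using Suc.prems by (rule lower_terms_SucE)
  have "g \<otimes> h = r \<otimes> (g' \<otimes> h) \<oplus> c \<otimes> h"
    unfolding gc(3) using ideal_carrier[OF lower_terms_ideal[OF I r] gc(1)] r
      ideal_carrier[OF ideal_power_ideal[OF I] gc(2)] ideal_carrier[OF lower_terms_ideal[OF I r] h]
    by algebra
  moreover have "r \<otimes> (g' \<otimes> h) \<in> lower_terms I r (Suc d + e)"
    using times_lower_terms[OF I r Suc.IH[OF gc(1)]] by simp
  moreover have "c \<otimes> h \<in> lower_terms I r (Suc d + e)"
    by (rule ideal_power_times_lower_terms[OF I r gc(2) h])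
  ultimately show ?case using ideal_add[OF lower_terms_ideal[OF I r]] by metis
qed

lemma lower_terms_expansion:
  assumes I: "ideal I R" and r: "r \<in> carrier R" and g: "g \<in> lower_terms I r e"
  shows "\<exists>c. (\<forall>i\<in>{1..e}. c i \<in> I [^]\<^bsub>ideals_set R\<^esub> i) \<and> g = (\<Oplus>i\<in>{1..e}. c i \<otimes> r [^] (e - i))"
  using g
proof (induction e arbitrary: g)
  case 0
  then show ?case by simp
next
  case (Suc e)
  obtain h b where hb: "h \<in> lower_terms I r e" "b \<in> I [^]\<^bsub>ideals_set R\<^esub> Suc e" "g = r \<otimes> h \<oplus> b"
    using Suc.prems by (rule lower_terms_SucE)
  obtain c where c: "\<And>i. i \<in> {1..e} \<Longrightarrow> c i \<in> I [^]\<^bsub>ideals_set R\<^esub> i"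
    "h = (\<Oplus>i\<in>{1..e}. c i \<otimes> r [^] (e - i))" using Suc.IH[OF hb(1)] by blast
  have cc: "c i \<in> carrier R" if "i \<in> {1..e}" for i
    using ideal_carrier[OF ideal_power_ideal[OF I] c(1)[OF that]] .
  have bc: "b \<in> carrier R" using ideal_carrier[OF ideal_power_ideal[OF I] hb(2)] .
  define c' where "c' = c(Suc e := b)"
  have c'c: "c' i \<in> carrier R" if "i \<in> insert (Suc e) {1..e}" for i
    using cc bc that unfolding c'_def by auto
  have "(\<Oplus>i\<in>{1..Suc e}. c' i \<otimes> r [^] (Suc e - i)) = (\<Oplus>i\<in>insert (Suc e) {1..e}. c' i \<otimes> r [^] (Suc e - i))"
    by (simp add: atLeastAtMostSuc_conv)
  also have "\<dots> = c' (Suc e) \<otimes> r [^] (Suc e - Suc e) \<oplus> (\<Oplus>i\<in>{1..e}. c' i \<otimes> r [^] (Suc e - i))"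
    using c'c r by (intro finsum_insert) auto
  also have "(\<Oplus>i\<in>{1..e}. c' i \<otimes> r [^] (Suc e - i)) = (\<Oplus>i\<in>{1..e}. r \<otimes> (c i \<otimes> r [^] (e - i)))"
  proof (rule finsum_cong')
    fix i assume i: "i \<in> {1..e}"
    then have "r [^] (Suc e - i) = r [^] (e - i) \<otimes> r" by (simp add: Suc_diff_le)
    then show "c' i \<otimes> r [^] (Suc e - i) = r \<otimes> (c i \<otimes> r [^] (e - i))"
      using i cc[OF i] r unfolding c'_def by (auto simp: m_ac)
  qed (use cc r in auto)
  also have "\<dots> = r \<otimes> h"
    unfolding c(2) by (rule finsum_rdistr[symmetric]) (use cc r in auto)
  finally have "g = (\<Oplus>i\<in>{1..Suc e}. c' i \<otimes> r [^] (Suc e - i))"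
    unfolding hb(3) c'_def using bc r ideal_carrier[OF lower_terms_ideal[OF I r] hb(1)]
    by (simp add: a_comm)
  moreover have "\<forall>i\<in>{1..Suc e}. c' i \<in> I [^]\<^bsub>ideals_set R\<^esub> i"
    using c(1) hb(2) unfolding c'_def by (auto simp: le_Suc_eq simp del: nat_pow_Suc)
  ultimately show ?case by blast
qed

end

context noetherian_cring
begin

text \<open>
  Apply the elimination lemma to generators of \<open>M\<close>: some \<open>r [^] e \<oplus> g\<close> with \<open>g\<close> a sum of lower terms
  annihilates \<open>M\<close>. Since \<open>r\<close> itself belongs to \<open>M\<close>, multiplying by \<open>r\<close> gives an integral equation
  even when \<open>M\<close> has nonzero annihilator.
\<close>

lemma integral_closure_of_multiplier:
  assumes I: "ideal I R" and M: "ideal M R" and r: "r \<in> M"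
    and mult: "\<And>y. y \<in> M \<Longrightarrow> r \<otimes> y \<in> M \<cdot> I"
  shows "r \<in> integral_closure R I"
proof -
  have rc: "r \<in> carrier R" using ideal_carrier[OF M r] .
  obtain F where F: "F \<subseteq> carrier R" "finite F" "M = Idl F" using finetely_gen[OF M] by blast
  have FM: "F \<subseteq> M" using genideal_self[OF F(1)] F(3) by simp
  obtain ys where ys: "set ys = F" using finite_list F(2) by blast
  define zs where "zs = map (\<lambda>y (_::unit). y) ys"
  have zs: "z \<in> set zs \<longleftrightarrow> (\<exists>y\<in>F. z = (\<lambda>_. y))" for z unfolding zs_def using ys by auto
  have zc: "z i \<in> carrier R" if "z \<in> set zs" for z i using that zs F(1) by auto
  have B: "submodule_of_functions {\<lambda>_::unit. \<zero>}" by (rule submodule_zero_module)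
  let ?L = "lincombs (lower_terms I r 1) zs {\<lambda>_. \<zero>}"
  have L: "submodule_of_functions ?L"
    by (rule submodule_lincombs[OF lower_terms_ideal[OF I rc] B]) (use zc in auto)
  have I1: "i \<in> lower_terms I r 1" if "i \<in> I" for i
  proof -
    have "I [^]\<^bsub>ideals_set R\<^esub> Suc 0 = carrier R \<cdot> I" by (simp add: ideals_set_def)
    also have "\<dots> = I" using ideal_prod_commute[OF oneideal I] ideal_prod_one[OF I] by simp
    finally have "r \<otimes> \<zero> \<oplus> i \<in> lower_terms I r (Suc 0)"
      using lower_terms_SucI[of \<zero> I r 0 i] that by simp
    then show ?thesis using rc ideal_carrier[OF I that] by simp
  qed
  have product: "(\<lambda>_. m \<otimes> i) \<in> ?L" if m: "m \<in> M" and i: "i \<in> I" for m i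
  proof -
    have ic: "i \<in> carrier R" using ideal_carrier[OF I i] .
    let ?K = "{m \<in> carrier R. (\<lambda>_. m \<otimes> i) \<in> ?L}"
    have "ideal ?K R"
    proof (rule idealI_cring)
      show "\<zero> \<in> ?K" using submodule_zero[OF L] ic by simp
      show "x \<oplus> y \<in> ?K" if "x \<in> ?K" "y \<in> ?K" for x y
        using submodule_add[OF L, of "\<lambda>_. x \<otimes> i" "\<lambda>_. y \<otimes> i"] that ic by (simp add: l_distr)
      show "s \<otimes> x \<in> ?K" if "s \<in> carrier R" "x \<in> ?K" for s x
        using submodule_smult[OF L, of s "\<lambda>_. x \<otimes> i"] that ic by (simp add: m_assoc)
    qed auto
    moreover have "F \<subseteq> ?K"
    proof
      fix f assume f: "f \<in> F"
      have fc: "f \<in> carrier R" using f F(1) by blast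
      have "(\<lambda>j. i \<otimes> (\<lambda>_. f) j) \<in> ?L"
        by (rule multiple_in_lincombs[OF lower_terms_ideal[OF I rc] B _ I1[OF i]])
          (use zc zs f in auto)
      then show "f \<in> ?K" using fc ic by (simp add: m_comm)
    qed
    ultimately have "M \<subseteq> ?K" unfolding F(3) by (rule genideal_minimal)
    then show ?thesis using m by blast
  qed
  have prodL: "(\<lambda>_. p) \<in> ?L" if "p \<in> M \<cdot> I" for p
    using that
  proof (induction p rule: ideal_prod.induct)
    case (prod i j)
    then show ?case using product by blast
  next
    case (sum s t)
    then show ?case using submodule_add[OF L] by blast
  qed
  have "\<exists>e. \<exists>g\<in>lower_terms I r e. \<forall>z\<in>set zs. (\<lambda>i. (r [^] e \<oplus> g) \<otimes> z i) \<in> {\<lambda>_. \<zero>}"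
  proof (rule cayley_hamilton_elimination[where d = 1])
    show "(\<lambda>i. r [^] (1::nat) \<otimes> z i) \<in> ?L" if z: "z \<in> set zs" for z
    proof -
      obtain y where y: "y \<in> F" "z = (\<lambda>_. y)" using z unfolding zs by (elim bexE)
      have "(\<lambda>_. r \<otimes> y) \<in> ?L" by (rule prodL, rule mult) (use y FM in blast)
      then show ?thesis unfolding y(2) using rc by simp
    qed
  qed (use lower_terms_ideal[OF I rc] lower_terms_mult[OF I rc] rc
      power_times_lower_terms[OF I rc] B zc in auto)
  then obtain e g where g: "g \<in> lower_terms I r e"
    "\<And>z. z \<in> set zs \<Longrightarrow> (\<lambda>i. (r [^] e \<oplus> g) \<otimes> z i) = (\<lambda>_. \<zero>)" by auto
  have gc: "g \<in> carrier R" using ideal_carrier[OF lower_terms_ideal[OF I rc] g(1)] .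
  let ?K = "{x \<in> carrier R. x \<otimes> (r [^] e \<oplus> g) \<in> {\<zero>}}"
  have "F \<subseteq> ?K"
  proof
    fix f assume f: "f \<in> F"
    then have "(\<lambda>_. f) \<in> set zs" unfolding zs by (rule bexI[rotated]) simp
    from fun_cong[OF g(2)[OF this]] have "(r [^] e \<oplus> g) \<otimes> f = \<zero>" by simp
    then show "f \<in> ?K" using f F(1) rc gc m_comm[of f "r [^] e \<oplus> g"] by auto
  qed
  then have "M \<subseteq> ?K" unfolding F(3)
    by (rule genideal_minimal[OF colon_ideal[OF zeroideal], rotated]) (use rc gc in simp)
  then have "r \<otimes> (r [^] e \<oplus> g) = \<zero>" using r by blast
  then have eq: "r [^] Suc e \<oplus> r \<otimes> g = \<zero>" using rc gc by (simp add: r_distr m_comm)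
  obtain c where c: "\<forall>i\<in>{1..Suc e}. c i \<in> I [^]\<^bsub>ideals_set R\<^esub> i"
    "r \<otimes> g = (\<Oplus>i\<in>{1..Suc e}. c i \<otimes> r [^] (Suc e - i))"
    using lower_terms_expansion[OF I rc times_lower_terms[OF I rc g(1)]] by blast
  show ?thesis unfolding integral_closure_def
    using rc c eq by (intro CollectI conjI exI[of _ "Suc e"] exI[of _ c]) auto
qed

end

section \<open>The annihilator of the first Koszul homology\<close>

context cring
begin

text \<open>
  The chain of degree one with the given coefficients at the singletons.
\<close>

definition degree_one :: "(nat \<Rightarrow> 'a) \<Rightarrow> nat set \<Rightarrow> 'a" where
  "degree_one z = (\<lambda>S. if is_singleton S then z (the_elem S) else \<zero>)"

lemma degree_one_singleton [simp]: "degree_one z {i} = z i"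
  unfolding degree_one_def by simp

lemma degree_one_eq_iff: "degree_one z = degree_one w \<longleftrightarrow> z = w"
proof
  assume eq: "degree_one z = degree_one w"
  show "z = w"
  proof
    fix i show "z i = w i" using fun_cong[OF eq, of "{i}"] by simp
  qed
qed simp

lemma degree_one_add: "degree_one (\<lambda>i. z i \<oplus> w i) = (\<lambda>S. degree_one z S \<oplus> degree_one w S)"
  unfolding degree_one_def by (auto simp: fun_eq_iff)

lemma degree_one_smult: "r \<in> carrier R \<Longrightarrow> degree_one (\<lambda>i. r \<otimes> z i) = (\<lambda>S. r \<otimes> degree_one z S)"
  unfolding degree_one_def by (auto simp: fun_eq_iff)

lemma submodule_degree_one_image:
  assumes V: "submodule_of_functions V"
  shows "submodule_of_functions (degree_one ` V)"
  unfolding submodule_of_functions_def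
proof (intro conjI ballI allI)
  show "v S \<in> carrier R" if "v \<in> degree_one ` V" for v S
    using that submodule_carrier[OF V] unfolding degree_one_def by auto
  have "degree_one (\<lambda>i. \<zero>) = (\<lambda>S. \<zero>)" unfolding degree_one_def by auto
  then show "(\<lambda>S. \<zero>) \<in> degree_one ` V" using submodule_zero[OF V] by (metis image_eqI)
  show "(\<lambda>S. u S \<oplus> v S) \<in> degree_one ` V"
    if uv: "u \<in> degree_one ` V" "v \<in> degree_one ` V" for u v
  proof -
    obtain z w where zw: "z \<in> V" "u = degree_one z" "w \<in> V" "v = degree_one w" using uv by blast
    show ?thesis unfolding zw(2,4) degree_one_add[symmetric] using submodule_add[OF V zw(1,3)] by blast
  qed
  show "(\<lambda>S. r \<otimes> v S) \<in> degree_one ` V" if r: "r \<in> carrier R" and v: "v \<in> degree_one ` V" for r v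
  proof -
    obtain z where z: "z \<in> V" "v = degree_one z" using v by blast
    show ?thesis unfolding z(2) degree_one_smult[OF r, symmetric]
      using submodule_smult[OF V r z(1)] by blast
  qed
qed

lemma koszul_cycles_one:
  assumes "set as \<subseteq> carrier R"
  shows "koszul_cycles R as 1 = degree_one ` syzygies {..<length as} ((!) as)"
proof
  have ac: "as ! j \<in> carrier R" if "j < length as" for j using that assms by force
  show "koszul_cycles R as 1 \<subseteq> degree_one ` syzygies {..<length as} ((!) as)"
  proof
    fix f assume f: "f \<in> koszul_cycles R as 1"
    have fc: "\<And>S. f S \<in> carrier R"
      and f0: "\<And>S. \<not> (S \<subseteq> {..<length as} \<and> card S = 1) \<Longrightarrow> f S = \<zero>"
      and d: "koszul_diff R as f = (\<lambda>S. \<zero>)"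
      using f unfolding koszul_cycles_def koszul_module_def by auto
    define z where "z = (\<lambda>i. f {i})"
    have "f = degree_one z"
    proof
      fix S show "f S = degree_one z S"
      proof (cases "is_singleton S")
        case True
        then obtain i where "S = {i}" by (auto elim: is_singletonE)
        then show ?thesis unfolding z_def by simp
      next
        case False
        then show ?thesis using f0[of S] unfolding degree_one_def is_singleton_altdef by auto
      qed
    qed
    moreover have "(\<Oplus>j\<in>{..<length as}. as ! j \<otimes> z j) = \<zero>"
    proof -
      have "(\<Oplus>j\<in>{..<length as}. as ! j \<otimes> z j) = koszul_diff R as f {}"
        unfolding koszul_diff_def z_def using ac fc by (intro finsum_cong') auto
      then show ?thesis using d by simp
    qed
    then have "z \<in> syzygies {..<length as} ((!) as)"
      unfolding syzygies_def z_def using fc f0 by auto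
    ultimately show "f \<in> degree_one ` syzygies {..<length as} ((!) as)" by blast
  qed
  show "degree_one ` syzygies {..<length as} ((!) as) \<subseteq> koszul_cycles R as 1"
  proof
    fix f assume "f \<in> degree_one ` syzygies {..<length as} ((!) as)"
    then obtain z where z: "z \<in> syzygies {..<length as} ((!) as)" "f = degree_one z" by blast
    have zc: "\<And>i. z i \<in> carrier R" and z0: "\<And>i. \<not> i < length as \<Longrightarrow> z i = \<zero>"
      and zs: "(\<Oplus>j\<in>{..<length as}. as ! j \<otimes> z j) = \<zero>" using z(1) unfolding syzygies_def by auto
    have fc: "f S \<in> carrier R" for S unfolding z(2) degree_one_def using zc by simp
    have "f S = \<zero>" if "\<not> (S \<subseteq> {..<length as} \<and> card S = 1)" for S
    proof (cases "is_singleton S")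
      case True
      then obtain i where "S = {i}" by (auto elim: is_singletonE)
      then show ?thesis using that z0 unfolding z(2) by simp
    qed (simp add: z(2) degree_one_def)
    moreover have "koszul_diff R as f S = \<zero>" for S
    proof (cases "S = {}")
      case True
      have "koszul_diff R as f {} = (\<Oplus>j\<in>{..<length as}. as ! j \<otimes> z j)"
        unfolding koszul_diff_def z(2) using ac zc by (intro finsum_cong') auto
      then show ?thesis using zs True by simp
    next
      case False
      have "f (insert j S) = \<zero>" if "j \<notin> S" for j
        using that False unfolding z(2) degree_one_def by (auto elim!: is_singletonE)
      then show ?thesis unfolding koszul_diff_def using ac by (intro add.finprod_one_eqI) auto
    qed
    ultimately show "f \<in> koszul_cycles R as 1"
      unfolding koszul_cycles_def koszul_module_def using fc by auto
  qed
qed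

text \<open>
  The sign in the differential at \<open>{i}\<close> depends only on whether \<open>i < j\<close>, and the two signs make the
  coefficients at the pairs into an alternating matrix.
\<close>

lemma koszul_diff_two:
  assumes as: "set as \<subseteq> carrier R" and g: "g \<in> carrier (koszul_module R as (Suc 1))"
  defines "w \<equiv> \<lambda>i j. if i < j then \<ominus> g {i, j} else g {i, j}"
  shows "alternating {..<length as} w"
    and "koszul_diff R as g = degree_one (\<lambda>i. \<Oplus>j\<in>{..<length as}. w i j \<otimes> as ! j)"
proof -
  have ac: "as ! j \<in> carrier R" if "j < length as" for j using that as by force
  have gc: "\<And>S. g S \<in> carrier R"
    and g0: "\<And>S. \<not> (S \<subseteq> {..<length as} \<and> card S = 2) \<Longrightarrow> g S = \<zero>"
    using g unfolding koszul_module_def by (auto simp: numeral_2_eq_2)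
  have gd: "g {i} = \<zero>" for i using g0[of "{i}"] by simp
  have g_out: "g {i, j} = \<zero>" if "\<not> i < length as" for i j using g0[of "{i, j}"] that by simp
  have wc: "w i j \<in> carrier R" for i j unfolding w_def using gc by simp
  show "alternating {..<length as} w"
  proof (rule alternatingI)
    show "w i j = \<ominus> w j i" for i j
    proof (cases i j rule: linorder_cases)
      case equal
      then show ?thesis unfolding w_def using gd by simp
    qed (use gc in \<open>auto simp: w_def insert_commute\<close>)
  qed (use wc gd g_out in \<open>auto simp: w_def\<close>)
  show "koszul_diff R as g = degree_one (\<lambda>i. \<Oplus>j\<in>{..<length as}. w i j \<otimes> as ! j)"
  proof
    fix S
    show "koszul_diff R as g S = degree_one (\<lambda>i. \<Oplus>j\<in>{..<length as}. w i j \<otimes> as ! j) S"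
    proof (cases "is_singleton S")
      case True
      then obtain i where S: "S = {i}" by (auto elim: is_singletonE)
      have "koszul_diff R as g S = (\<Oplus>j\<in>{..<length as} - {i}. w i j \<otimes> as ! j)"
        unfolding koszul_diff_def S
      proof (rule finsum_cong')
        fix j assume j: "j \<in> {..<length as} - {i}"
        have "{p \<in> {i}. p < j} = (if i < j then {i} else {})" by auto
        then have "card {p \<in> {i}. p < j} = (if i < j then 1 else 0)" by simp
        then show "(\<ominus> \<one>) [^] card {p \<in> {i}. p < j} \<otimes> as ! j \<otimes> g (insert j {i}) = w i j \<otimes> as ! j"
          unfolding w_def using ac j gc by (auto simp: insert_commute l_minus r_minus m_comm)
      qed (use wc ac in auto)
      also have "\<dots> = (\<Oplus>j\<in>{..<length as}. w i j \<otimes> as ! j)"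
        by (rule add.finprod_mono_neutral_cong_left) (use wc ac gd in \<open>auto simp: w_def\<close>)
      finally show ?thesis unfolding S by simp
    next
      case False
      have "g (insert j S) = \<zero>" if "j \<notin> S" for j
      proof (rule g0, rule notI)
        assume c: "insert j S \<subseteq> {..<length as} \<and> card (insert j S) = 2"
        then have "finite S" using finite_subset by auto
        then have "card S = 1" using c that by simp
        then show False using False unfolding is_singleton_altdef by simp
      qed
      then have "koszul_diff R as g S = \<zero>"
        unfolding koszul_diff_def using ac by (intro add.finprod_one_eqI) auto
      then show ?thesis using False unfolding degree_one_def by simp
    qed
  qed
qed

lemma koszul_boundaries_one:
  assumes as: "set as \<subseteq> carrier R"
  shows "koszul_boundaries R as 1 = degree_one ` koszul_relations {..<length as} ((!) as)"
proof
  show "koszul_boundaries R as 1 \<subseteq> degree_one ` koszul_relations {..<length as} ((!) as)"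
    unfolding koszul_boundaries_def
  proof (rule image_subsetI)
    fix g assume "g \<in> carrier (koszul_module R as (Suc 1))"
    note d = koszul_diff_two[OF as this]
    show "koszul_diff R as g \<in> degree_one ` koszul_relations {..<length as} ((!) as)"
      unfolding koszul_relations_def d(2) 
      by (intro imageI CollectI exI[of _ "\<lambda>i j. if i < j then \<ominus> g {i, j} else g {i, j}"] conjI refl d(1))
  qed
  show "degree_one ` koszul_relations {..<length as} ((!) as) \<subseteq> koszul_boundaries R as 1"
  proof
    fix f assume "f \<in> degree_one ` koszul_relations {..<length as} ((!) as)"
    then obtain b where b: "f = degree_one b" "b \<in> koszul_relations {..<length as} ((!) as)" by blast
    from b obtain w where w: "alternating {..<length as} w"
      "f = degree_one (\<lambda>i. \<Oplus>j\<in>{..<length as}. w i j \<otimes> as ! j)"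
      unfolding koszul_relations_def by auto
    define g where "g = (\<lambda>S. if S \<subseteq> {..<length as} \<and> card S = 2 then \<ominus> w (Min S) (Max S) else \<zero>)"
    have g: "g \<in> carrier (koszul_module R as (Suc 1))"
      unfolding koszul_module_def g_def using alternating_closed[OF w(1)]
      by (auto simp: numeral_2_eq_2)
    have g2: "g {i, j} = \<ominus> w i j" if "i < j" for i j
    proof (cases "j < length as")
      case True
      then show ?thesis unfolding g_def using that by simp
    next
      case False
      have "w i j = \<ominus> w j i" by (rule alternating_skew[OF w(1)])
      then have "w i j = \<zero>" using alternating_outside[OF w(1)] False by simp
      then show ?thesis unfolding g_def using False by simp
    qed
    have "(if i < j then \<ominus> g {i, j} else g {i, j}) = w i j" for i j
    proof (cases i j rule: linorder_cases)
      case less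
      then show ?thesis using g2 alternating_closed[OF w(1)] by simp
    next
      case equal
      then show ?thesis using alternating_diag[OF w(1)] unfolding g_def by simp
    next
      case greater
      then show ?thesis using g2[OF greater] alternating_skew[OF w(1), of i j]
        by (simp add: insert_commute)
    qed
    then have "koszul_diff R as g = f" unfolding w(2) koszul_diff_two(2)[OF as g] by presburger
    then show "f \<in> koszul_boundaries R as 1" unfolding koszul_boundaries_def using g by blast
  qed
qed

text \<open>
  A multiple of the coset of a cycle is the zero coset exactly when the multiple of the cycle is a
  boundary.
\<close>

theorem annihilator_koszul_homology_one:
  assumes as: "set as \<subseteq> carrier R"
  shows "annihilator R (koszul_homology R as 1) =
    {r \<in> carrier R. \<forall>z\<in>syzygies {..<length as} ((!) as).
       (\<lambda>i. r \<otimes> z i) \<in> koszul_relations {..<length as} ((!) as)}"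
proof -
  let ?Z = "syzygies {..<length as} ((!) as)" and ?B = "koszul_relations {..<length as} ((!) as)"
  have ac: "\<forall>j\<in>{..<length as}. as ! j \<in> carrier R" using as by force
  have Zs: "submodule_of_functions (degree_one ` ?Z)"
    by (rule submodule_degree_one_image[OF submodule_syzygies]) (use ac in auto)
  define N where "N = degree_one ` ?B"
  have N: "submodule_of_functions N" unfolding N_def
    by (rule submodule_degree_one_image[OF submodule_koszul_relations]) (use ac in auto)
  have coset: "(\<Union>x\<in>(\<Union>h\<in>N. {\<lambda>S. h S \<oplus> f S}). \<Union>h\<in>N. {\<lambda>S. h S \<oplus> r \<otimes> x S}) = N \<longleftrightarrow>
      (\<lambda>S. r \<otimes> f S) \<in> N" (is "?U = N \<longleftrightarrow> _")
    if r: "r \<in> carrier R" and f: "f \<in> degree_one ` ?Z" for r and f :: "nat set \<Rightarrow> 'a"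
  proof
    have fc: "f S \<in> carrier R" for S using submodule_carrier[OF Zs f] .
    have Nc: "h S \<in> carrier R" if "h \<in> N" for h S using submodule_carrier[OF N that] .
    { assume "?U = N"
      moreover have "(\<lambda>S. \<zero> \<oplus> r \<otimes> (\<zero> \<oplus> f S)) \<in> ?U"
        using submodule_zero[OF N] by (intro UN_I[of "\<lambda>S. \<zero> \<oplus> f S"] UN_I[of "\<lambda>S. \<zero>"]) auto
      ultimately show "(\<lambda>S. r \<otimes> f S) \<in> N" using r fc by simp }
    { assume rf: "(\<lambda>S. r \<otimes> f S) \<in> N"
      show "?U = N"
      proof
        show "?U \<subseteq> N"
        proof
          fix x assume "x \<in> ?U"
          then obtain h h' where h: "h \<in> N" "h' \<in> N" "x = (\<lambda>S. h' S \<oplus> r \<otimes> (h S \<oplus> f S))" by auto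
          have "x = (\<lambda>S. h' S \<oplus> (r \<otimes> h S \<oplus> r \<otimes> f S))"
            unfolding h(3) using Nc[OF h(1)] fc r by (simp add: r_distr)
          then show "x \<in> N"
            using submodule_add[OF N h(2) submodule_add[OF N submodule_smult[OF N r h(1)] rf]] by simp
        qed
        show "N \<subseteq> ?U"
        proof
          fix x assume x: "x \<in> N"
          define h' where "h' = (\<lambda>S. x S \<ominus> r \<otimes> f S)"
          have h': "h' \<in> N" unfolding h'_def by (rule submodule_diff[OF N x rf])
          have "x S = h' S \<oplus> r \<otimes> (\<zero> \<oplus> f S)" for S
            unfolding h'_def using Nc[OF x, of S] fc[of S] r by (simp add: minus_eq a_assoc l_neg)
          then have "x = (\<lambda>S. h' S \<oplus> r \<otimes> (\<zero> \<oplus> f S))" by blast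
          then show "x \<in> ?U" using submodule_zero[OF N] h'
            by (intro UN_I[of "\<lambda>S. \<zero> \<oplus> f S"] UN_I[of "\<lambda>S. \<zero>"] UN_I[of h']) auto
        qed
      qed }
  qed
  have hom: "koszul_homology R as 1 = quotient_module ((koszul_module R as 1)\<lparr>carrier := degree_one ` ?Z\<rparr>) N"
    unfolding koszul_homology_def koszul_cycles_one[OF as] koszul_boundaries_one[OF as] N_def ..
  have "annihilator R (koszul_homology R as 1) =
      {r \<in> carrier R. \<forall>f\<in>degree_one ` ?Z.
         (\<Union>x\<in>(\<Union>h\<in>N. {\<lambda>S. h S \<oplus> f S}). \<Union>h\<in>N. {\<lambda>S. h S \<oplus> r \<otimes> x S}) = N}"
    unfolding hom annihilator_def quotient_module_def A_RCOSETS_def' a_r_coset_def' koszul_module_def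
    by simp
  also have "\<dots> = {r \<in> carrier R. \<forall>f\<in>degree_one ` ?Z. (\<lambda>S. r \<otimes> f S) \<in> N}"
    by (intro Collect_cong conj_cong refl ball_cong coset) assumption+
  also have "\<dots> = {r \<in> carrier R. \<forall>z\<in>?Z. (\<lambda>i. r \<otimes> z i) \<in> ?B}"
  proof -
    have "(\<lambda>S. r \<otimes> degree_one z S) \<in> N \<longleftrightarrow> (\<lambda>i. r \<otimes> z i) \<in> ?B" if "r \<in> carrier R" for r z
      unfolding N_def degree_one_smult[OF that, symmetric]
      by (rule inj_image_mem_iff) (simp add: inj_def degree_one_eq_iff)
    then show ?thesis by auto
  qed
  finally show ?thesis .
qed

end

section \<open>The annihilator and the height of the ideal\<close>

context noetherian_local_ring
begin

lemma maximal_ideal: "ideal \<mm> R"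
  using maximal maximalideal.axioms(1) by blast

lemma maximal_prime: "primeideal \<mm> R"
  by (rule maximalideal_prime[OF maximal])

lemma proper_ideal_subset_maximal:
  assumes K: "ideal K R" "\<one> \<notin> K"
  shows "K \<subseteq> \<mm>"
proof -
  define F where "F = {L. ideal L R \<and> K \<subseteq> L \<and> \<one> \<notin> L}"
  have "F \<noteq> {}" unfolding F_def using K by blast
  moreover have "\<And>L. L \<in> F \<Longrightarrow> ideal L R" unfolding F_def by blast
  ultimately obtain M where M: "M \<in> F" and max: "\<And>L. L \<in> F \<Longrightarrow> M \<subseteq> L \<Longrightarrow> L = M"
    using maximal_ideal_in_family[of F] by metis
  have "maximalideal M R"
  proof (rule maximalidealI)
    show "ideal M R" using M unfolding F_def by blast
    show "carrier R \<noteq> M" using M unfolding F_def by auto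
    fix J assume J: "ideal J R" "M \<subseteq> J" "J \<subseteq> carrier R"
    show "J = M \<or> J = carrier R"
    proof (cases "\<one> \<in> J")
      case True
      then show ?thesis using ideal.one_imp_carrier[OF J(1)] by blast
    next
      case False
      then have "J \<in> F" using J M unfolding F_def by blast
      then show ?thesis using max J(2) by blast
    qed
  qed
  then have "M = \<mm>" by (rule unique_maximal)
  then show ?thesis using M unfolding F_def by blast
qed

lemma unit_outside_maximal:
  assumes u: "u \<in> carrier R" "u \<notin> \<mm>"
  shows "\<exists>v\<in>carrier R. v \<otimes> u = \<one>"
proof -
  have "\<one> \<in> PIdl u"
  proof (rule ccontr)
    assume "\<one> \<notin> PIdl u"
    then have "PIdl u \<subseteq> \<mm>" by (rule proper_ideal_subset_maximal[OF cgenideal_ideal[OF u(1)]])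
    then show False using u cgenideal_self[OF u(1)] by blast
  qed
  then show ?thesis unfolding cgenideal_def by auto
qed

text \<open>
  The quotient by \<open>P\<close> is a local ring whose maximal ideal is generated by the image of \<open>x\<close>, a nonzerodivisor;
  such a Noetherian ring is a discrete valuation ring. Indeed every \<open>u \<notin> P\<close> is a power of \<open>x\<close> times a unit
  modulo \<open>P\<close>. Otherwise choose a counterexample \<open>v\<close> with \<open>P + (v)\<close> maximal and divide it by \<open>x\<close>: the
  quotient \<open>s\<close> is again a counterexample, so it lies in \<open>P + (v)\<close>, and then \<open>(\<one> \<ominus> c \<otimes> x) \<otimes> s \<in> P\<close> with
  a unit in front of \<open>s\<close>.
\<close>

lemma prime_of_principal_nonzerodivisor:
  assumes P: "ideal P R" "\<one> \<notin> P" and x: "x \<in> \<mm>"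
    and nzd: "\<And>z. z \<in> carrier R \<Longrightarrow> z \<otimes> x \<in> P \<Longrightarrow> z \<in> P"
    and gen: "\<mm> \<subseteq> P <+>\<^bsub>R\<^esub> PIdl x"
  shows "primeideal P R"
proof -
  note mi = maximal_ideal
  have xc: "x \<in> carrier R" using x ideal_carrier[OF mi] by blast
  have Pm: "P \<subseteq> \<mm>" by (rule proper_ideal_subset_maximal[OF P])
  define decomp where "decomp u \<longleftrightarrow>
    (\<exists>k::nat. \<exists>e\<in>carrier R - \<mm>. \<exists>p\<in>P. u = x [^] k \<otimes> e \<oplus> p)" for u
  have decomp: "decomp u" if "u \<in> carrier R" "u \<notin> P" for u
  proof (rule ccontr)
    assume "\<not> decomp u"
    define F where "F = {P <+>\<^bsub>R\<^esub> PIdl v | v. v \<in> carrier R \<and> v \<notin> P \<and> \<not> decomp v}"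
    have "F \<noteq> {}" unfolding F_def using that \<open>\<not> decomp u\<close> by blast
    moreover have "\<And>L. L \<in> F \<Longrightarrow> ideal L R" unfolding F_def using ideal_add_PIdl[OF P(1)] by blast
    ultimately obtain M where M: "M \<in> F" and max: "\<And>L. L \<in> F \<Longrightarrow> M \<subseteq> L \<Longrightarrow> L = M"
      using maximal_ideal_in_family[of F] by metis
    obtain v where v: "v \<in> carrier R" "v \<notin> P" "\<not> decomp v" "M = P <+>\<^bsub>R\<^esub> PIdl v"
      using M unfolding F_def by blast
    have "v \<in> \<mm>"
    proof (rule ccontr)
      assume "v \<notin> \<mm>"
      moreover have "v = x [^] (0::nat) \<otimes> v \<oplus> \<zero>" using v(1) by simp
      ultimately show False using v(1,3) ideal_zero[OF P(1)] unfolding decomp_def by blast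
    qed
    then obtain p s where ps: "p \<in> P" "s \<in> carrier R" "v = p \<oplus> s \<otimes> x"
      using gen mem_add_PIdl[of v P x] by blast
    have pc: "p \<in> carrier R" using ideal_carrier[OF P(1) ps(1)] .
    have sP: "s \<notin> P"
      using ps(1,3) v(2) ideal_add[OF P(1)] ideal_mult'[OF P(1) _ xc] by blast
    show False
    proof (cases "decomp s")
      case True
      then obtain k e p' where *: "e \<in> carrier R" "e \<notin> \<mm>" "p' \<in> P" "s = x [^] (k::nat) \<otimes> e \<oplus> p'"
        unfolding decomp_def by blast
      have p'c: "p' \<in> carrier R" using ideal_carrier[OF P(1) *(3)] .
      have "v = (x [^] k \<otimes> x) \<otimes> e \<oplus> (p \<oplus> x \<otimes> p')"
        unfolding ps(3) *(4) using pc p'c *(1) xc nat_pow_closed[OF xc, of k] by algebra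
      also have "x [^] k \<otimes> x = x [^] Suc k" by simp
      finally have "v = x [^] Suc k \<otimes> e \<oplus> (p \<oplus> x \<otimes> p')" .
      moreover have "p \<oplus> x \<otimes> p' \<in> P" using ideal_add[OF P(1) ps(1)] ideal_mult[OF P(1) *(3) xc] by blast
      ultimately show False using v(3) *(1,2) unfolding decomp_def by blast
    next
      case False
      then have "P <+>\<^bsub>R\<^esub> PIdl s \<in> F" unfolding F_def using ps(2) sP by blast
      moreover have Ls: "ideal (P <+>\<^bsub>R\<^esub> PIdl s) R" by (rule ideal_add_PIdl[OF P(1) ps(2)])
      have "v \<in> P <+>\<^bsub>R\<^esub> PIdl s"
        unfolding mem_add_PIdl using ps xc by (metis m_comm)
      then have "M \<subseteq> P <+>\<^bsub>R\<^esub> PIdl s"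
        unfolding v(4) by (rule add_PIdl_minimal[OF Ls subset_add_PIdl[OF P(1) ps(2)]])
      ultimately have "P <+>\<^bsub>R\<^esub> PIdl s = M" using max by blast
      then have "s \<in> P <+>\<^bsub>R\<^esub> PIdl v" using gen_in_add_PIdl[OF P(1) ps(2)] v(4) by simp
      then obtain h c where hc: "h \<in> P" "c \<in> carrier R" "s = h \<oplus> c \<otimes> v"
        unfolding mem_add_PIdl by blast
      have hcc: "h \<in> carrier R" using ideal_carrier[OF P(1) hc(1)] .
      have eq: "h \<oplus> c \<otimes> (p \<oplus> s \<otimes> x) = s" using hc(3) ps(3) by simp
      have "(\<one> \<ominus> c \<otimes> x) \<otimes> s = (s \<ominus> c \<otimes> (p \<oplus> s \<otimes> x)) \<oplus> c \<otimes> p"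
        using hc(2) ps(2) pc xc by algebra
      also have "s \<ominus> c \<otimes> (p \<oplus> s \<otimes> x) = (h \<oplus> c \<otimes> (p \<oplus> s \<otimes> x)) \<ominus> c \<otimes> (p \<oplus> s \<otimes> x)"
        unfolding eq ..
      also have "\<dots> = h" using hcc hc(2) ps(2) pc xc by algebra
      also have "h \<oplus> c \<otimes> p \<in> P" using ideal_add[OF P(1) hc(1)] ideal_mult[OF P(1) ps(1) hc(2)] by blast
      finally have in_P: "(\<one> \<ominus> c \<otimes> x) \<otimes> s \<in> P" .
      have cxm: "c \<otimes> x \<in> \<mm>" using ideal_mult[OF mi x hc(2)] .
      have "\<one> \<ominus> c \<otimes> x \<notin> \<mm>"
      proof
        assume "\<one> \<ominus> c \<otimes> x \<in> \<mm>"
        then have "(\<one> \<ominus> c \<otimes> x) \<oplus> c \<otimes> x \<in> \<mm>" using cxm ideal_add[OF mi] by blast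
        also have "(\<one> \<ominus> c \<otimes> x) \<oplus> c \<otimes> x = \<one>" using hc(2) xc by algebra
        finally show False using prime_not_one[OF maximal_prime] by blast
      qed
      then obtain w where w: "w \<in> carrier R" "w \<otimes> (\<one> \<ominus> c \<otimes> x) = \<one>"
        using unit_outside_maximal[of "\<one> \<ominus> c \<otimes> x"] hc(2) xc by auto
      have "w \<otimes> ((\<one> \<ominus> c \<otimes> x) \<otimes> s) = (w \<otimes> (\<one> \<ominus> c \<otimes> x)) \<otimes> s"
        using w(1) hc(2) xc ps(2) by (simp add: m_assoc)
      then have "w \<otimes> ((\<one> \<ominus> c \<otimes> x) \<otimes> s) = s" using w(2) ps(2) by simp
      then show False using ideal_mult[OF P(1) in_P w(1)] sP by simp
    qed
  qed
  show ?thesis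
  proof (rule primeidealI[OF P(1) is_cring])
    show "carrier R \<noteq> P" using P(2) by auto
    show "u \<in> P \<or> v \<in> P" if uv: "u \<in> carrier R" "v \<in> carrier R" "u \<otimes> v \<in> P" for u v
    proof (rule ccontr)
      assume "\<not> ?thesis"
      then have "decomp u" "decomp v" using decomp uv by auto
      then obtain k e p l f q where *: "e \<in> carrier R" "e \<notin> \<mm>" "p \<in> P" "u = x [^] (k::nat) \<otimes> e \<oplus> p"
        "f \<in> carrier R" "f \<notin> \<mm>" "q \<in> P" "v = x [^] (l::nat) \<otimes> f \<oplus> q" unfolding decomp_def by blast
      have pqc: "p \<in> carrier R" "q \<in> carrier R" using ideal_carrier[OF P(1)] * by auto
      have "(e \<otimes> f) \<otimes> (x [^] k \<otimes> x [^] l) \<oplus> (v \<otimes> p \<oplus> (x [^] k \<otimes> e) \<otimes> q) = u \<otimes> v"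
        unfolding *(4,8) using *(1,5) pqc nat_pow_closed[OF xc, of k] nat_pow_closed[OF xc, of l]
        by algebra
      then have sum: "(e \<otimes> f) \<otimes> (x [^] k \<otimes> x [^] l) \<oplus> (v \<otimes> p \<oplus> (x [^] k \<otimes> e) \<otimes> q) \<in> P"
        using uv(3) by (simp only:)
      have "v \<otimes> p \<oplus> (x [^] k \<otimes> e) \<otimes> q \<in> P"
        using * uv(2) xc by (simp add: ideal_add[OF P(1)] ideal_mult[OF P(1)])
      then have "(e \<otimes> f) \<otimes> (x [^] k \<otimes> x [^] l) \<in> P"
        by (rule ideal_cancel[OF P(1) sum]) (use *(1,5) xc in simp)
      then have pw: "(e \<otimes> f) \<otimes> x [^] (k + l) \<in> P" using xc by (simp add: nat_pow_mult)
      have "e \<otimes> f \<in> P" if "(e \<otimes> f) \<otimes> x [^] (n::nat) \<in> P" for n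
        using that
      proof (induction n)
        case 0
        then show ?case using *(1,5) by simp
      next
        case (Suc n)
        then have "((e \<otimes> f) \<otimes> x [^] n) \<otimes> x \<in> P" using *(1,5) xc by (simp add: m_assoc)
        then have "(e \<otimes> f) \<otimes> x [^] n \<in> P" by (rule nzd[rotated]) (use *(1,5) xc in simp)
        then show ?case by (rule Suc.IH)
      qed
      then have "e \<otimes> f \<in> \<mm>" using pw Pm by blast
      then show False using prime_mult_notin[OF maximal_prime] * by blast
    qed
  qed
qed

lemma ideal_finsum:
  assumes K: "ideal K R" and "finite A" "\<forall>i\<in>A. f i \<in> K"
  shows "(\<Oplus>i\<in>A. f i) \<in> K"
  using assms(2,3)
proof (induction A rule: finite_induct)
  case empty
  then show ?case using ideal_zero[OF K] by simp
next
  case (insert j A)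
  then have "(\<Oplus>i\<in>insert j A. f i) = f j \<oplus> (\<Oplus>i\<in>A. f i)"
    using ideal_carrier[OF K] by (intro finsum_insert) auto
  then show ?case using insert ideal_add[OF K] by simp
qed

text \<open>
  Either the whole Koszul complex is exact in degree one, or a socle element
  \<open>g\<close> of the annihilator modulo the ideal leads to a prime \<open>P = J : g\<close>, where \<open>J\<close> is generated by all
  but one of the generators. In the second case the dropped generator is recovered as \<open>g \<otimes> x\<close>, up to a
  unit and modulo \<open>J\<close>, and this makes \<open>x\<close> a nonzerodivisor modulo \<open>P\<close> that generates the maximal ideal
  modulo \<open>P\<close>.
\<close>

theorem prime_chain_of_large_koszul_annihilator:
  fixes a :: "'i \<Rightarrow> 'a"
  assumes A: "finite A" and a: "\<forall>i\<in>A. a i \<in> carrier R"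
    and rad: "ideal_radical R (Idl (a ` A)) = \<mm>"
    and closed: "integral_closure R (Idl (a ` A)) \<subseteq> Idl (a ` A)"
    and r: "r \<in> carrier R" "r \<notin> Idl (a ` A)"
    and ann: "\<And>z. z \<in> syzygies A a \<Longrightarrow> (\<lambda>i. r \<otimes> z i) \<in> koszul_relations A a"
  shows "\<exists>D. prime_chain (card A) D \<mm>"
proof -
  define I where "I = Idl (a ` A)"
  have aA: "a ` A \<subseteq> carrier R" using a by blast
  have Ii: "ideal I R" unfolding I_def by (rule genideal_ideal[OF aA])
  have aI: "a ` A \<subseteq> I" unfolding I_def by (rule genideal_self[OF aA])
  note mi = maximal_ideal and mp = maximal_prime
  have powI: "\<exists>j::nat. p [^] j \<in> I" if "p \<in> \<mm>" for p
    using that rad unfolding I_def ideal_radical_def by blast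
  have Im: "I \<subseteq> \<mm>"
  proof
    fix p assume p: "p \<in> I"
    then have "p \<in> carrier R" "p [^] (1::nat) \<in> I" using ideal_carrier[OF Ii] by auto
    then show "p \<in> \<mm>" unfolding rad[symmetric] I_def[symmetric] ideal_radical_def by blast
  qed
  define U where "U = {r \<in> carrier R. \<forall>z\<in>syzygies A a. (\<lambda>i. r \<otimes> z i) \<in> koszul_relations A a}"
  note Bs = submodule_koszul_relations[OF A a]
  note Zs = submodule_syzygies[OF A a]
  have Ui: "ideal U R"
  proof (rule idealI_cring)
    show "U \<subseteq> carrier R" unfolding U_def by blast
    show "\<zero> \<in> U" unfolding U_def using submodule_carrier[OF Zs] submodule_zero[OF Bs] by simp
    show "x \<oplus> y \<in> U" if xy: "x \<in> U" "y \<in> U" for x y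
    proof -
      have "(\<lambda>i. (x \<oplus> y) \<otimes> z i) \<in> koszul_relations A a" if z: "z \<in> syzygies A a" for z
      proof -
        have "(\<lambda>i. x \<otimes> z i \<oplus> y \<otimes> z i) \<in> koszul_relations A a"
          by (rule submodule_add[OF Bs]) (use xy z in \<open>auto simp: U_def\<close>)
        then show ?thesis using xy submodule_carrier[OF Zs z] unfolding U_def by (simp add: l_distr)
      qed
      then show ?thesis using xy unfolding U_def by simp
    qed
    show "s \<otimes> x \<in> U" if s: "s \<in> carrier R" and x: "x \<in> U" for s x
    proof -
      have "(\<lambda>i. (s \<otimes> x) \<otimes> z i) \<in> koszul_relations A a" if z: "z \<in> syzygies A a" for z
      proof -
        have "(\<lambda>i. s \<otimes> (x \<otimes> z i)) \<in> koszul_relations A a"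
          by (rule submodule_smult[OF Bs s]) (use x z in \<open>auto simp: U_def\<close>)
        then show ?thesis using x s submodule_carrier[OF Zs z] unfolding U_def by (simp add: m_assoc)
      qed
      then show ?thesis using x s unfolding U_def by simp
    qed
  qed
  have rU: "r \<in> U" unfolding U_def using r(1) ann by blast
  show ?thesis
  proof (cases "U \<subseteq> \<mm>")
    case False
    then obtain s where s: "s \<in> carrier R" "s \<notin> \<mm>"
      "\<And>z. z \<in> syzygies A a \<Longrightarrow> (\<lambda>i. s \<otimes> z i) \<in> koszul_relations A a" unfolding U_def by blast
    show ?thesis
      by (rule prime_chain_of_locally_exact_koszul[OF A mp _ s]) (use aI Im in auto)
  next
    case Um: True
    have mc: "\<mm> \<subseteq> carrier R" using ideal_carrier[OF mi] by blast
    \<comment> \<open>A socle element \<open>g\<close> multiplies the maximal ideal into \<open>I\<close>, but not into \<open>\<mm> \<cdot> I\<close>: otherwise it would be integral over \<open>I\<close>.\<close>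
    have "\<not> U \<subseteq> I" using rU r(2) unfolding I_def by blast
    then obtain g where g: "g \<in> U" "g \<notin> I" "\<forall>p\<in>\<mm>. p \<otimes> g \<in> I"
      using socle_element[OF Ii Ui _ mc powI] by blast
    have gm: "g \<in> \<mm>" using g(1) Um by blast
    have gc: "g \<in> carrier R" using gm mc by blast
    have gann: "\<And>z. z \<in> syzygies A a \<Longrightarrow> (\<lambda>i. g \<otimes> z i) \<in> koszul_relations A a"
      using g(1) unfolding U_def by blast
    have "g \<notin> integral_closure R I" using closed g(2) unfolding I_def by blast
    then obtain x where x: "x \<in> \<mm>" "g \<otimes> x \<notin> \<mm> \<cdot> I"
      using integral_closure_of_multiplier[OF Ii mi gm] by blast
    have xc: "x \<in> carrier R" using x mc by blast
    have "g \<otimes> x \<in> I" using bspec[OF g(3) x(1)] m_comm[OF gc xc] by simp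
    then have "g \<otimes> x \<in> {\<Oplus>i\<in>A. c i \<otimes> a i | c. \<forall>i. c i \<in> carrier R}"
      unfolding I_def genideal_image_eq[OF A a] .
    then obtain c where c: "g \<otimes> x = (\<Oplus>i\<in>A. c i \<otimes> a i)" "\<And>i. c i \<in> carrier R" by blast
    have mIi: "ideal (\<mm> \<cdot> I) R" by (rule ideal_prod_is_ideal[OF mi Ii])
    \<comment> \<open>Some coefficient is a unit, so \<open>g \<otimes> x\<close> can take the place of the generator \<open>a k\<close>.\<close>
    obtain k where k: "k \<in> A" "c k \<notin> \<mm>"
    proof (rule ccontr)
      assume no: "\<not> thesis"
      have "(\<Oplus>i\<in>A. c i \<otimes> a i) \<in> \<mm> \<cdot> I"
      proof (rule ideal_finsum[OF mIi A], rule ballI)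
        fix i assume i: "i \<in> A"
        then have "c i \<in> \<mm>" using no that by blast
        moreover have "a i \<in> I" using aI i by blast
        ultimately show "c i \<otimes> a i \<in> \<mm> \<cdot> I" by (rule ideal_prod.prod)
      qed
      then show False using x(2) c(1) by simp
    qed
    obtain v where v: "v \<in> carrier R" "v \<otimes> c k = \<one>" using unit_outside_maximal[OF c(2) k(2)] by blast
    define A' where "A' = A - {k}"
    have A': "finite A'" "k \<notin> A'" "A = insert k A'" unfolding A'_def using A k by auto
    have aA': "\<forall>i\<in>insert k A'. a i \<in> carrier R" using a A'(3) by simp
    have aA'': "\<forall>i\<in>A'. a i \<in> carrier R" using aA' by blast
    have aA's: "a ` A' \<subseteq> carrier R" using aA'' by blast
    have akc: "a k \<in> carrier R" using aA' by blast
    define J where "J = Idl (a ` A')"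
    have Ji: "ideal J R" unfolding J_def by (rule genideal_ideal[OF aA's])
    have aJ: "a ` A' \<subseteq> J" unfolding J_def by (rule genideal_self[OF aA's])
    have JI: "J \<subseteq> I" unfolding J_def by (rule genideal_minimal[OF Ii]) (use aI A'(3) in blast)
    have gann': "\<And>z. z \<in> syzygies (insert k A') a \<Longrightarrow> (\<lambda>i. g \<otimes> z i) \<in> koszul_relations (insert k A') a"
      using gann unfolding A'(3) .
    define j where "j = (\<Oplus>i\<in>A'. c i \<otimes> a i)"
    have jJ: "j \<in> J" unfolding j_def
      by (rule ideal_finsum[OF Ji A'(1)]) (use ideal_mult[OF Ji _ c(2)] aJ in auto)
    have jc: "j \<in> carrier R" using ideal_carrier[OF Ji jJ] .
    have gx: "g \<otimes> x = c k \<otimes> a k \<oplus> j"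
      unfolding c(1) j_def A'(3) using A' aA' c(2) by (intro finsum_insert) auto
    have ak: "a k = v \<otimes> (g \<otimes> x) \<ominus> v \<otimes> j"
    proof -
      have "v \<otimes> (g \<otimes> x) \<ominus> v \<otimes> j = (v \<otimes> c k) \<otimes> a k"
        unfolding gx using v(1) c(2)[of k] akc jc by algebra
      then show ?thesis using v(2) akc by simp
    qed
    \<comment> \<open>Since \<open>g\<close> annihilates the homology, \<open>J : (g \<otimes> x) = J : g\<close>; this is the content of \<open>nzd\<close>.\<close>
    define P where "P = {z \<in> carrier R. z \<otimes> g \<in> J}"
    have Pi: "ideal P R" unfolding P_def by (rule colon_ideal[OF Ji gc])
    have P1: "\<one> \<notin> P" unfolding P_def using g(2) JI gc by auto
    have JP: "J \<subseteq> P" unfolding P_def using ideal_carrier[OF Ji] ideal_mult'[OF Ji _ gc] by blast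
    have nzd: "z \<in> P" if z: "z \<in> carrier R" "z \<otimes> x \<in> P" for z
    proof -
      have "(z \<otimes> x) \<otimes> g \<in> J" using z(2) unfolding P_def by blast
      moreover have "(z \<otimes> x) \<otimes> g = (z \<otimes> c k) \<otimes> a k \<oplus> z \<otimes> j"
      proof -
        have "(z \<otimes> x) \<otimes> g = z \<otimes> (g \<otimes> x)" using z xc gc by algebra
        also have "\<dots> = (z \<otimes> c k) \<otimes> a k \<oplus> z \<otimes> j"
          unfolding gx using z(1) c(2)[of k] akc jc by algebra
        finally show ?thesis .
      qed
      ultimately have "(z \<otimes> c k) \<otimes> a k \<in> J"
        using ideal_cancel[OF Ji] ideal_mult[OF Ji jJ z(1)] z(1) c(2) akc by simp
      then have "g \<otimes> (z \<otimes> c k) \<in> J"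
        using colon_of_syzygy_annihilator[OF A'(1,2) aA' gc gann'] z(1) c(2) unfolding J_def by simp
      then have "v \<otimes> (g \<otimes> (z \<otimes> c k)) \<in> J" using ideal_mult[OF Ji] v(1) by blast
      also have "v \<otimes> (g \<otimes> (z \<otimes> c k)) = (v \<otimes> c k) \<otimes> (z \<otimes> g)"
        using v(1) gc z(1) c(2)[of k] by algebra
      also have "\<dots> = z \<otimes> g" using v(2) z(1) gc by simp
      finally show ?thesis unfolding P_def using z(1) by blast
    qed
    have gxc: "g \<otimes> x \<in> carrier R" using gc xc by simp
    have I_sub: "I \<subseteq> J <+>\<^bsub>R\<^esub> PIdl (g \<otimes> x)"
      unfolding I_def
    proof (rule genideal_minimal[OF ideal_add_PIdl[OF Ji gxc]])
      have "a k = (\<ominus> v) \<otimes> j \<oplus> v \<otimes> (g \<otimes> x)"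
        using ak v(1) jc gxc by (simp add: minus_eq l_minus a_comm)
      moreover have "(\<ominus> v) \<otimes> j \<in> J" using ideal_mult[OF Ji jJ] v(1) by simp
      ultimately have "a k \<in> J <+>\<^bsub>R\<^esub> PIdl (g \<otimes> x)" unfolding mem_add_PIdl using v(1) by blast
      then show "a ` A \<subseteq> J <+>\<^bsub>R\<^esub> PIdl (g \<otimes> x)"
        unfolding A'(3) using aJ subset_add_PIdl[OF Ji gxc] by blast
    qed
    have gen: "\<mm> \<subseteq> P <+>\<^bsub>R\<^esub> PIdl x"
    proof
      fix y assume y: "y \<in> \<mm>"
      have yc: "y \<in> carrier R" using y mc by blast
      have "y \<otimes> g \<in> J <+>\<^bsub>R\<^esub> PIdl (g \<otimes> x)"
        by (rule subsetD[OF I_sub bspec[OF g(3) y]])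
      then obtain h s where hs: "h \<in> J" "s \<in> carrier R" "y \<otimes> g = h \<oplus> s \<otimes> (g \<otimes> x)"
        unfolding mem_add_PIdl by blast
      have hc: "h \<in> carrier R" using ideal_carrier[OF Ji hs(1)] .
      have "(y \<ominus> s \<otimes> x) \<otimes> g = y \<otimes> g \<ominus> s \<otimes> (g \<otimes> x)" using yc hs(2) xc gc by algebra
      also have "\<dots> = h" unfolding hs(3) using hc hs(2) gxc by algebra
      finally have "y \<ominus> s \<otimes> x \<in> P" unfolding P_def using hs(1,2) yc xc by simp
      moreover have "y = (y \<ominus> s \<otimes> x) \<oplus> s \<otimes> x" using yc hs(2) xc by algebra
      ultimately show "y \<in> P <+>\<^bsub>R\<^esub> PIdl x" unfolding mem_add_PIdl using hs(2) by blast
    qed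
    have Pp: "primeideal P R" by (rule prime_of_principal_nonzerodivisor[OF Pi P1 x(1) nzd gen])
    have xP: "x \<notin> P" using nzd[of \<one>] P1 xc by auto
    \<comment> \<open>Otherwise \<open>P\<close> would contain \<open>J\<close> and \<open>g \<otimes> x\<close>, hence \<open>I\<close>, and with it a power of \<open>x\<close>.\<close>
    have gP: "g \<notin> P"
    proof
      assume gP: "g \<in> P"
      have "g \<otimes> x \<in> P" using ideal_mult'[OF Pi gP xc] .
      moreover have "j \<in> P" using jJ JP by blast
      ultimately have "a k \<in> P" unfolding ak using v(1) by (simp add: ideal_diff[OF Pi] ideal_mult[OF Pi])
      then have "I \<subseteq> P" unfolding I_def using aJ JP A'(3)
        by (intro genideal_minimal[OF Pi]) auto
      then show False using powI[OF x(1)] prime_pow_mem[OF Pp xc] xP by blast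
    qed
    have Pm: "P \<subset> \<mm>" using proper_ideal_subset_maximal[OF Pi P1] x(1) xP by blast
    note Zs' = submodule_syzygies[OF A'(1) aA'']
    note Bs' = submodule_koszul_relations[OF A'(1) aA'']
    \<comment> \<open>The relation \<open>g \<cdot> z = a k \<cdot> w + b\<close> becomes \<open>g \<cdot> (z - v x \<cdot> w) = b - v j \<cdot> w\<close>, whose right-hand side is a
      Koszul relation. So the syzygies \<open>z\<close> lie in \<open>\<mm>\<close> times the syzygies plus the submodule \<open>?B\<close>.\<close>
    let ?B = "{v. (\<forall>i. v i \<in> carrier R) \<and> (\<lambda>i. g \<otimes> v i) \<in> koszul_relations A' a}"
    have "\<exists>t\<in>carrier R - \<mm>. \<forall>z\<in>syzygies A' a. (\<lambda>i. t \<otimes> z i) \<in> ?B"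
    proof (rule nakayama_at_prime[OF mp A'(1) Zs' _ submodule_colon[OF Bs' gc]])
      show "\<forall>z\<in>syzygies A' a. \<forall>i. i \<notin> A' \<longrightarrow> z i = \<zero>" unfolding syzygies_def by blast
      fix z assume z: "z \<in> syzygies A' a"
      obtain w b where wb: "w \<in> syzygies A' a" "b \<in> koszul_relations A' a"
        "\<And>i. g \<otimes> z i = a k \<otimes> w i \<oplus> b i"
        using syzygy_annihilator_shift[OF A'(1,2) aA' gc gann' z] by blast
      note zc = submodule_carrier[OF Zs' z] and wc = submodule_carrier[OF Zs' wb(1)]
        and bc = submodule_carrier[OF Bs' wb(2)]
      define y where "y = (\<lambda>i. z i \<ominus> (v \<otimes> x) \<otimes> w i)"
      have yc: "y i \<in> carrier R" for i unfolding y_def using zc wc v(1) xc by simp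
      have vj: "v \<otimes> j \<in> Idl (a ` A')" using ideal_mult[OF Ji jJ v(1)] unfolding J_def .
      have "(\<lambda>i. b i \<ominus> (v \<otimes> j) \<otimes> w i) \<in> koszul_relations A' a"
        by (rule submodule_diff[OF Bs' wb(2) ideal_times_syzygy[OF A'(1) aA'' vj wb(1)]])
      moreover have "g \<otimes> y i = b i \<ominus> (v \<otimes> j) \<otimes> w i" for i
      proof -
        have "g \<otimes> y i = g \<otimes> z i \<ominus> (v \<otimes> (g \<otimes> x)) \<otimes> w i"
          unfolding y_def using zc[of i] wc[of i] v(1) xc gc by algebra
        also have "\<dots> = b i \<ominus> (v \<otimes> j) \<otimes> w i"
          unfolding wb(3) ak using bc[of i] wc[of i] v(1) gxc jc by algebra
        finally show ?thesis .
      qed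
      ultimately have "y \<in> ?B" using yc by simp
      moreover have "\<one> \<otimes> z i = (v \<otimes> x) \<otimes> w i \<oplus> y i" for i
        unfolding y_def using zc[of i] wc[of i] v(1) xc by algebra
      moreover have "v \<otimes> x \<in> \<mm>" using ideal_mult[OF mi x(1) v(1)] .
      moreover have "\<one> \<in> carrier R - \<mm>" using prime_not_one[OF mp] by simp
      ultimately show "\<exists>t\<in>carrier R - \<mm>. \<exists>p\<in>\<mm>. \<exists>c\<in>syzygies A' a. \<exists>b\<in>?B.
          \<forall>i. t \<otimes> z i = p \<otimes> c i \<oplus> b i" using wb(1) by blast
    qed
    then obtain t where t: "t \<in> carrier R" "t \<notin> \<mm>"
      "\<And>z. z \<in> syzygies A' a \<Longrightarrow> (\<lambda>i. g \<otimes> (t \<otimes> z i)) \<in> koszul_relations A' a" by blast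
    have tP: "t \<notin> P" using t(2) Pm by blast
    have gt: "(\<lambda>i. (g \<otimes> t) \<otimes> z i) \<in> koszul_relations A' a" if z: "z \<in> syzygies A' a" for z
      using t(3)[OF z] gc t(1) submodule_carrier[OF Zs' z] by (simp add: m_assoc)
    have "\<exists>D. prime_chain (card A') D P"
      by (rule prime_chain_of_locally_exact_koszul[OF A'(1) Pp _ _ _ gt])
        (use aJ JP gc t(1) prime_mult_notin[OF Pp gc t(1) gP tP] in auto)
    then obtain D where "prime_chain (card A') D P" by blast
    then have "prime_chain (Suc (card A')) D \<mm>" using mp Pm by (rule prime_chain_Suc)
    then show ?thesis using A' by auto
  qed
qed

end

theorem corollary2p5:
  fixes R :: "('a, 'b) ring_scheme"
    and \<mm> I :: "'a set"
    and as :: "'a list"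
  assumes "noetherian_local_ring R \<mm>"
    and "primary_to R \<mm> I"
    and "integrally_closed_ideal R I"
    and "\<not> complete_intersection_ideal R I"
    and "minimal_generating_list R I as"
  shows "annihilator R (koszul_homology R as 1) = I"
proof -
  interpret noetherian_local_ring R \<mm> by fact
  let ?A = "{..<length as}" and ?a = "(!) as"
  have as: "set as \<subseteq> carrier R" and gen: "Idl\<^bsub>R\<^esub> (set as) = I"
    using assms(5) unfolding minimal_generating_list_def by auto
  have a: "\<forall>i\<in>?A. ?a i \<in> carrier R" using as by force
  have im: "?a ` ?A = set as" by (auto simp: in_set_conv_nth)
  have genA: "Idl\<^bsub>R\<^esub> (?a ` ?A) = I" using im gen by simp
  have rad: "ideal_radical R I = \<mm>" using assms(2) unfolding primary_to_def by blast
  have Ii: "ideal I R" and closed: "integral_closure R I = I"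
    using assms(3) unfolding integrally_closed_ideal_def by auto
  note ann = annihilator_koszul_homology_one[OF as]
  have "I \<subseteq> annihilator R (koszul_homology R as 1)"
    unfolding ann using ideal_times_syzygy[of ?A ?a, OF _ a] genA ideal_carrier[OF Ii] by auto
  moreover have "annihilator R (koszul_homology R as 1) \<subseteq> I"
  proof (rule ccontr)
    assume "\<not> ?thesis"
    then obtain r where r: "r \<in> carrier R" "r \<notin> I"
      "\<And>z. z \<in> syzygies ?A ?a \<Longrightarrow> (\<lambda>i. r \<otimes>\<^bsub>R\<^esub> z i) \<in> koszul_relations ?A ?a"
      unfolding ann by blast
    have "\<exists>D. prime_chain (card ?A) D \<mm>"
      by (rule prime_chain_of_large_koszul_annihilator[of ?A ?a r]) (use a r rad closed genA in auto)
    then obtain D where "prime_chain (length as) D \<mm>" by auto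
    then obtain C :: "nat \<Rightarrow> 'a set" where C: "\<forall>i\<le>length as. primeideal (C i) R"
      "\<forall>i<length as. C i \<subset> C (Suc i)" "C (length as) = \<mm>" using function_of_prime_chain by blast
    let ?\<mu> = "min_num_generators R I"
    let ?gen = "\<lambda>n. \<exists>B. finite B \<and> card B = n \<and> B \<subseteq> carrier R \<and> Idl\<^bsub>R\<^esub> B = I"
    have g0: "?gen (card (set as))" using as gen by blast
    \<comment> \<open>The lower bound for the height comes from the given list and the upper bound from a shortest generating
      set, so the trivial inequality \<open>?\<mu> \<le> length as\<close> closes the circle.\<close>
    have "?\<mu> \<le> card (set as)" unfolding min_num_generators_def by (rule Least_le[of ?gen, OF g0])
    then have le1: "enat ?\<mu> \<le> enat (length as)" using card_length[of as] by simp
    have "?gen ?\<mu>" unfolding min_num_generators_def by (rule LeastI[of ?gen, OF g0])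
    then obtain B where B: "finite B" "card B = ?\<mu>" "B \<subseteq> carrier R" "Idl\<^bsub>R\<^esub> B = I" by blast
    obtain xs where xs: "set xs = B" "distinct xs" using finite_distinct_list[OF B(1)] by blast
    have len: "length xs = ?\<mu>" using distinct_card[OF xs(2)] xs(1) B(2) by simp
    have above: "Q = \<mm>" if Q: "primeideal Q R" "I \<subseteq> Q" for Q
    proof
      show "Q \<subseteq> \<mm>"
        by (rule proper_ideal_subset_maximal[OF prime_ideal[OF Q(1)] prime_not_one[OF Q(1)]])
      show "\<mm> \<subseteq> Q"
        unfolding rad[symmetric] ideal_radical_def using Q prime_pow_mem[OF Q(1)] by blast
    qed
    have BI: "B \<subseteq> I" using genideal_self[OF B(3)] B(4) by simp
    have Im: "I \<subseteq> \<mm>"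
      unfolding rad[symmetric] ideal_radical_def using ideal_carrier[OF Ii]
      by (auto intro!: exI[of _ "1::nat"])
    have upper: "n \<le> ?\<mu>" if "\<forall>i\<le>n. primeideal (C i) R" "\<forall>i<n. C i \<subset> C (Suc i)" "C n = \<mm>"
      for n and C :: "nat \<Rightarrow> 'a set"
    proof -
      have "prime_chain n (C 0) \<mm>" using prime_chain_of_function[OF that(1,2)] that(3) by simp
      then have "n \<le> length xs"
      proof (rule krull_height[where K = "{}"])
        show "set xs \<subseteq> \<mm>" using xs(1) BI Im by blast
        fix Q assume Q: "primeideal Q R" "{} \<union> set xs \<subseteq> Q"
        have "I \<subseteq> Q" unfolding B(4)[symmetric]
          by (rule genideal_minimal[OF prime_ideal[OF Q(1)]]) (use Q(2) xs(1) in blast)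
        then show "Q = \<mm>" using above Q(1) by blast
      qed simp
      then show ?thesis using len by simp
    qed
    have "prime_height R \<mm> \<le> enat ?\<mu>"
      unfolding prime_height_def by (rule Sup_least) (use upper in auto)
    moreover have "enat (length as) \<le> prime_height R \<mm>"
      unfolding prime_height_def by (rule Sup_upper) (use C in blast)
    ultimately have "prime_height R \<mm> = enat ?\<mu>" using le1 by order
    moreover have "{prime_height R P | P. primeideal P R \<and> I \<subseteq> P} = {prime_height R \<mm>}"
      using above maximal_prime Im by blast
    then have "ideal_height R I = prime_height R \<mm>" unfolding ideal_height_def by simp
    ultimately show False using assms(4) unfolding complete_intersection_ideal_def by simp
  qed
  ultimately show ?thesis by blast
qed

end
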